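(* Let $Q\subseteq\mathbb{R}^m$ be a closed set, let $g_1,\ldots,g_s\in\mathbb{R}[\mathrm{x},\mathrm{y}]$, $g_0:=1$, and let $K=\{x\in\mathbb{R}^n : g_1(x,y)\ge 0,\ldots,g_s(x,y)\ge 0\ \ \forall y\in Q\}$. Let $\nu$ be a nonnegative Borel measure on $\mathbb{R}^m$ with $\operatorname{supp}(\nu)=Q$ satisfying the multivariate Carleman condition. Then, for a multisequence $z=(z_\alpha)_{\alpha\in\mathbb{N}^n}$ of real numbers, we have $\mathscr{R}_z\ge 0$ on $\operatorname{QM}[g,\nu]$ if and only if for all $j=0,1,\ldots,s$, $$\mathrm{L}^{(k,l)}_{\nu,g_j}[z]\succeq 0,\qquad k=1,2,\ldots,\quad l=1,2,\ldots. \qquad ( * )$$ Moreover, when $\operatorname{QM}[g,\nu]$ is archimedean, $z$ is a $K$-moment sequence if and only if it satisfies $( * )$.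
   Context: Here $\mathrm{x}=(\mathrm{x}_1,\ldots,\mathrm{x}_n)$ and $\mathrm{y}=(\mathrm{y}_1,\ldots,\mathrm{y}_m)$ are tuples of variables; $\mathbb{N}$ is the set of nonnegative integers. All measures are finite, and $\nu$ has finite moments of all orders. The measure $\nu$ satisfies the multivariate Carleman condition if $\sum_{d=1}^\infty\big(\int y_j^{2d}\,d\nu(y)\big)^{-\frac{1}{2d}}=\infty$ for $j=1,\ldots,m$ (a term with zero moment is read as $+\infty$). $\Sigma^2[\mathrm{x},\mathrm{y}]$ is the cone of sums of squares of polynomials in $\mathbb{R}[\mathrm{x},\mathrm{y}]$. The quadratic module associated to $g=(g_0,\ldots,g_s)$ and $\nu$ is $$\operatorname{QM}[g,\nu]:=\Big\{\sum_{j=0}^s\int \tau_j(\mathrm{x},y)g_j(\mathrm{x},y)\,d\nu(y)\ :\ \tau_0,\ldots,\tau_s\in\Sigma^2[\mathrm{x},\mathrm{y}]\Big\}\subseteq\mathbb{R}[\mathrm{x}].$$ It is called archimedean if there is an integer $N>0$ with $N-\mathrm{x}_1^2-\cdots-\mathrm{x}_n^2\in\operatorname{QM}[g,\nu]$. The Riesz functional of $z$ is the linear functional $\mathscr{R}_z:\mathbb{R}[\mathrm{x}]\to\mathbb{R}$ with $\mathscr{R}_z(\mathrm{x}^\alpha)=z_\alpha$; "$\mathscr{R}_z\ge0$ on $S$" means $\mathscr{R}_z(f)\ge0$ for all $f\in S$. The multisequence $z$ is a $K$-moment sequence if there is a nonnegative Borel measure $\mu$ on $\mathbb{R}^n$ with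 $\operatorname{supp}(\mu)\subseteq K$ and $z_\alpha=\int x^\alpha\,d\mu(x)$ for all $\alpha\in\mathbb{N}^n$. Localizing matrices: let $k'=k-\lceil\deg_{\mathrm{x}}(g_j)/2\rceil$ and $l'=l-\lceil\deg_{\mathrm{y}}(g_j)/2\rceil$. $\mathrm{L}^{(k,l)}_{\nu,g_j}[z]$ is the symmetric matrix such that $$\mathscr{R}_z\Big(\int p(\mathrm{x},y)^2g_j(\mathrm{x},y)\,d\nu(y)\Big)=\mathbf{p}^T\,\mathrm{L}^{(k,l)}_{\nu,g_j}[z]\,\mathbf{p}$$ for all $p\in\mathbb{R}[\mathrm{x},\mathrm{y}]$ with $\deg_{\mathrm{x}}(p)\le k'$, $\deg_{\mathrm{y}}(p)\le l'$ (equivalently $\deg_{\mathrm{x}}(p^2g_j)\le 2k$, $\deg_{\mathrm{y}}(p^2g_j)\le 2l$), where $\mathbf{p}$ is the coefficient vector of $p$ in the basis $[\mathrm{x}]_{k'}\otimes[\mathrm{y}]_{l'}$, and $[\cdot]_d$ denotes the vector of all monomials of degree at most $d$. If $k'<0$ or $l'<0$, the matrix is empty and the condition is vacuous. $W\succeq0$ means $W$ is positive semidefinite. *)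

theory Defs
  imports "HOL-Analysis.Analysis" "HOL-Library.Poly_Mapping" "HOL-Library.Product_Plus"
begin

text \<open>
  The variables \<open>x\<^sub>1, \<dots>, x\<^sub>n\<close> and \<open>y\<^sub>1, \<dots>, y\<^sub>m\<close> are indexed by the finite types \<open>'n\<close> and \<open>'m\<close>.
  Polynomials are finitely supported coefficient functions on exponents, with the ring
  structure of \<^theory>\<open>HOL-Library.Poly_Mapping\<close>; an exponent of \<open>\<real>[x,y]\<close> is a pair
  \<open>(\<alpha>, \<beta>)\<close>, standing for the monomial \<open>x\<^sup>\<alpha> y\<^sup>\<beta>\<close>.
\<close>

type_synonym 'n expo = "'n \<Rightarrow>\<^sub>0 nat"
type_synonym 'n xpoly = "'n expo \<Rightarrow>\<^sub>0 real"
type_synonym ('n, 'm) xypoly = "('n expo \<times> 'm expo) \<Rightarrow>\<^sub>0 real"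

definition monom_at :: "real ^ 'n \<Rightarrow> 'n::finite expo \<Rightarrow> real" where
  "monom_at x \<alpha> = (\<Prod>i\<in>UNIV. (x $ i) ^ Poly_Mapping.lookup \<alpha> i)"

definition eval_x :: "'n::finite xpoly \<Rightarrow> real ^ 'n \<Rightarrow> real" where
  "eval_x f x = (\<Sum>\<alpha>\<in>Poly_Mapping.keys f. Poly_Mapping.lookup f \<alpha> * monom_at x \<alpha>)"

definition eval_xy :: "('n::finite, 'm::finite) xypoly \<Rightarrow> real ^ 'n \<Rightarrow> real ^ 'm \<Rightarrow> real" where
  "eval_xy f x y = (\<Sum>(\<alpha>, \<beta>)\<in>Poly_Mapping.keys f.
     Poly_Mapping.lookup f (\<alpha>, \<beta>) * (monom_at x \<alpha> * monom_at y \<beta>))"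

definition var_x :: "'n \<Rightarrow> 'n xpoly" where
  "var_x i = Poly_Mapping.single (Poly_Mapping.single i 1) 1"

definition total_deg :: "'n::finite expo \<Rightarrow> nat" where
  "total_deg \<alpha> = (\<Sum>i\<in>UNIV. Poly_Mapping.lookup \<alpha> i)"

text \<open>Partial degrees; the zero polynomial gets degree \<open>0\<close>.\<close>

definition deg_x :: "('n::finite, 'm) xypoly \<Rightarrow> nat" where
  "deg_x f = Max (insert 0 ((\<lambda>(\<alpha>, \<beta>). total_deg \<alpha>) ` Poly_Mapping.keys f))"

definition deg_y :: "('n, 'm::finite) xypoly \<Rightarrow> nat" where
  "deg_y f = Max (insert 0 ((\<lambda>(\<alpha>, \<beta>). total_deg \<beta>) ` Poly_Mapping.keys f))"

definition nonneg_set ::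
    "nat \<Rightarrow> (nat \<Rightarrow> ('n::finite, 'm::finite) xypoly) \<Rightarrow> (real ^ 'm) set \<Rightarrow> (real ^ 'n) set" where
  "nonneg_set s g Q = {x. \<forall>j\<in>{1..s}. \<forall>y\<in>Q. eval_xy (g j) x y \<ge> 0}"

definition measure_support :: "'a::topological_space measure \<Rightarrow> 'a set" where
  "measure_support \<mu> = {x. \<forall>U. open U \<and> x \<in> U \<longrightarrow> emeasure \<mu> U > 0}"

definition finite_moments :: "(real ^ 'm::finite) measure \<Rightarrow> bool" where
  "finite_moments \<nu> \<longleftrightarrow> (\<forall>\<beta>. integrable \<nu> (\<lambda>y. monom_at y \<beta>))"

definition carleman :: "(real ^ 'm::finite) measure \<Rightarrow> bool" where
  "carleman \<nu> \<longleftrightarrow> (\<forall>j.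
     suminf (\<lambda>e. let d = Suc e; M = (LINT y|\<nu>. (y $ j) ^ (2 * d)) in
        if M = 0 then \<infinity> else ennreal (M powr (- 1 / (2 * real d)))) = \<infinity>)"

text \<open>
  The polynomial \<open>\<integral> f(x,y) d\<nu>(y) \<in> \<real>[x]\<close>, computed by integrating the monomials \<open>y\<^sup>\<beta>\<close> of \<open>f\<close>.
\<close>

definition integral_y ::
    "(real ^ 'm) measure \<Rightarrow> ('n::finite, 'm::finite) xypoly \<Rightarrow> 'n xpoly" where
  "integral_y \<nu> f = (\<Sum>(\<alpha>, \<beta>)\<in>Poly_Mapping.keys f.
     Poly_Mapping.single \<alpha> (Poly_Mapping.lookup f (\<alpha>, \<beta>) * (LINT y|\<nu>. monom_at y \<beta>)))"

definition sos :: "'a::comm_ring_1 set" where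
  "sos = {\<Sum>q\<leftarrow>qs. q\<^sup>2 | qs. True}"

definition QM ::
    "nat \<Rightarrow> (nat \<Rightarrow> ('n::finite, 'm::finite) xypoly) \<Rightarrow> (real ^ 'm) measure \<Rightarrow> 'n xpoly set" where
  "QM s g \<nu> = {\<Sum>j\<le>s. integral_y \<nu> (\<tau> j * g j) | \<tau>. \<forall>j\<le>s. \<tau> j \<in> sos}"

definition archimedean :: "'n::finite xpoly set \<Rightarrow> bool" where
  "archimedean M \<longleftrightarrow> (\<exists>N::nat. N > 0 \<and> of_nat N - (\<Sum>i\<in>UNIV. (var_x i)\<^sup>2) \<in> M)"

definition riesz :: "('n expo \<Rightarrow> real) \<Rightarrow> 'n xpoly \<Rightarrow> real" where
  "riesz z f = (\<Sum>\<alpha>\<in>Poly_Mapping.keys f. Poly_Mapping.lookup f \<alpha> * z \<alpha>)"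

definition moment_sequence :: "(real ^ 'n) set \<Rightarrow> ('n::finite expo \<Rightarrow> real) \<Rightarrow> bool" where
  "moment_sequence K z \<longleftrightarrow> (\<exists>\<mu>. finite_measure \<mu> \<and> sets \<mu> = sets borel \<and> measure_support \<mu> \<subseteq> K \<and>
     (\<forall>\<alpha>. integrable \<mu> (\<lambda>x. monom_at x \<alpha>) \<and> z \<alpha> = (LINT x|\<mu>. monom_at x \<alpha>)))"

text \<open>
  Matrices whose rows and columns are indexed by a finite set \<open>I\<close> of monomials are functions
  of two arguments, of which only the values on \<open>I \<times> I\<close> matter.
\<close>

definition quad_form :: "'a set \<Rightarrow> ('a \<Rightarrow> 'a \<Rightarrow> real) \<Rightarrow> ('a \<Rightarrow> real) \<Rightarrow> real" where
  "quad_form I W v = (\<Sum>a\<in>I. \<Sum>b\<in>I. v a * W a b * v b)"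

definition pos_semidef :: "'a set \<Rightarrow> ('a \<Rightarrow> 'a \<Rightarrow> real) \<Rightarrow> bool" where
  "pos_semidef I W \<longleftrightarrow> (\<forall>a\<in>I. \<forall>b\<in>I. W a b = W b a) \<and> (\<forall>v. quad_form I W v \<ge> 0)"

text \<open>The basis \<open>[x]\<^sub>k \<otimes> [y]\<^sub>l\<close>; empty if \<open>k < 0\<close> or \<open>l < 0\<close>.\<close>

definition basis_xy :: "int \<Rightarrow> int \<Rightarrow> ('n::finite expo \<times> 'm::finite expo) set" where
  "basis_xy k l = {(\<alpha>, \<beta>). int (total_deg \<alpha>) \<le> k \<and> int (total_deg \<beta>) \<le> l}"

definition red_x :: "nat \<Rightarrow> ('n::finite, 'm::finite) xypoly \<Rightarrow> int" where
  "red_x k h = int k - \<lceil>real (deg_x h) / 2\<rceil>"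

definition red_y :: "nat \<Rightarrow> ('n::finite, 'm::finite) xypoly \<Rightarrow> int" where
  "red_y l h = int l - \<lceil>real (deg_y h) / 2\<rceil>"

definition loc_index ::
    "nat \<Rightarrow> nat \<Rightarrow> ('n::finite, 'm::finite) xypoly \<Rightarrow> ('n expo \<times> 'm expo) set" where
  "loc_index k l h = basis_xy (red_x k h) (red_y l h)"

definition is_loc_matrix ::
    "nat \<Rightarrow> nat \<Rightarrow> (real ^ 'm) measure \<Rightarrow> ('n::finite, 'm::finite) xypoly \<Rightarrow> ('n expo \<Rightarrow> real) \<Rightarrow>
     ('n expo \<times> 'm expo \<Rightarrow> 'n expo \<times> 'm expo \<Rightarrow> real) \<Rightarrow> bool" where
  "is_loc_matrix k l \<nu> h z W \<longleftrightarrow>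
     (\<forall>a b. W a b = W b a) \<and>
     (\<forall>a b. a \<notin> loc_index k l h \<or> b \<notin> loc_index k l h \<longrightarrow> W a b = 0) \<and>
     (\<forall>p. int (deg_x p) \<le> red_x k h \<and> int (deg_y p) \<le> red_y l h \<longrightarrow>
        riesz z (integral_y \<nu> (p\<^sup>2 * h)) = quad_form (loc_index k l h) W (Poly_Mapping.lookup p))"

text \<open>
  The localizing matrix \<open>L\<^bsup>(k,l)\<^esup>\<close>, made a unique function by vanishing off \<open>loc_index k l h\<close>.
  Existence and uniqueness are shown in \<open>is_loc_matrix_iff\<close> below.
\<close>

definition loc_matrix ::
    "nat \<Rightarrow> nat \<Rightarrow> (real ^ 'm) measure \<Rightarrow> ('n::finite, 'm::finite) xypoly \<Rightarrow> ('n expo \<Rightarrow> real) \<Rightarrow>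
     ('n expo \<times> 'm expo \<Rightarrow> 'n expo \<times> 'm expo \<Rightarrow> real)" where
  "loc_matrix k l \<nu> h z = (THE W. is_loc_matrix k l \<nu> h z W)"


subsection \<open>Well-definedness\<close>

lemma finite_expo: "finite {\<alpha>::'n::finite expo. int (total_deg \<alpha>) \<le> k}"
proof (rule finite_subset)
  let ?F = "{f::'n \<Rightarrow> nat. \<forall>i. (i \<in> UNIV \<longrightarrow> f i \<in> {..nat k}) \<and> (i \<notin> UNIV \<longrightarrow> f i = 0)}"
  have "Poly_Mapping.lookup \<alpha> i \<le> nat k" if "int (total_deg \<alpha>) \<le> k" for \<alpha> :: "'n expo" and i
  proof -
    have "Poly_Mapping.lookup \<alpha> i \<le> total_deg \<alpha>"
      unfolding total_deg_def by (rule member_le_sum) auto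
    with that show ?thesis by linarith
  qed
  then show "{\<alpha>::'n expo. int (total_deg \<alpha>) \<le> k} \<subseteq> Poly_Mapping.lookup -` ?F"
    by (intro subsetI vimageI2 CollectI) simp
  have "finite ?F" by (rule finite_set_of_finite_funs) auto
  then show "finite (Poly_Mapping.lookup -` ?F)"
    by (rule finite_vimageI) (rule injI, simp only: lookup_inject)
qed

lemma finite_loc_index: "finite (loc_index k l h)"
proof -
  have "loc_index k l h = {\<alpha>. int (total_deg \<alpha>) \<le> red_x k h} \<times> {\<beta>. int (total_deg \<beta>) \<le> red_y l h}"
    by (auto simp: loc_index_def basis_xy_def)
  then show ?thesis by (simp add: finite_expo)
qed

lemma deg_le_iff:
  assumes "k \<ge> 0" "l \<ge> 0"
  shows "int (deg_x p) \<le> k \<and> int (deg_y p) \<le> l \<longleftrightarrow> Poly_Mapping.keys p \<subseteq> basis_xy k l"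
proof -
  have "int (deg_x p) \<le> k \<longleftrightarrow> (\<forall>a\<in>Poly_Mapping.keys p. int (total_deg (fst a)) \<le> k)"
  proof -
    have "int (deg_x p) \<le> k \<longleftrightarrow> deg_x p \<le> nat k" using assms by linarith
    also have "\<dots> \<longleftrightarrow> (\<forall>a\<in>Poly_Mapping.keys p. total_deg (fst a) \<le> nat k)"
      by (simp add: deg_x_def case_prod_unfold)
    also have "\<dots> \<longleftrightarrow> (\<forall>a\<in>Poly_Mapping.keys p. int (total_deg (fst a)) \<le> k)"
      using assms by (intro ball_cong refl) linarith
    finally show ?thesis .
  qed
  moreover have "int (deg_y p) \<le> l \<longleftrightarrow> (\<forall>a\<in>Poly_Mapping.keys p. int (total_deg (snd a)) \<le> l)"
  proof -
    have "int (deg_y p) \<le> l \<longleftrightarrow> deg_y p \<le> nat l" using assms by linarith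
    also have "\<dots> \<longleftrightarrow> (\<forall>a\<in>Poly_Mapping.keys p. total_deg (snd a) \<le> nat l)"
      by (simp add: deg_y_def case_prod_unfold)
    also have "\<dots> \<longleftrightarrow> (\<forall>a\<in>Poly_Mapping.keys p. int (total_deg (snd a)) \<le> l)"
      using assms by (intro ball_cong refl) linarith
    finally show ?thesis .
  qed
  ultimately show ?thesis by (auto simp: basis_xy_def case_prod_unfold)
qed

lemma riesz_add: "riesz z (f + g) = riesz z f + riesz z g"
  unfolding riesz_def by (rule setsum_keys_plus_distrib) (auto simp: algebra_simps)

lemma riesz_single: "riesz z (Poly_Mapping.single \<alpha> c) = c * z \<alpha>"
  by (cases "c = 0") (auto simp: riesz_def)

lemma integral_y_add: "integral_y \<nu> (f + g) = integral_y \<nu> f + integral_y \<nu> g"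
  unfolding integral_y_def case_prod_unfold prod.collapse
  by (rule setsum_keys_plus_distrib) (auto simp: algebra_simps single_add)

lemma integral_y_single:
  "integral_y \<nu> (Poly_Mapping.single a c) =
     Poly_Mapping.single (fst a) (c * (LINT y|\<nu>. monom_at y (snd a)))"
  by (cases "c = 0") (auto simp: integral_y_def case_prod_unfold)

lemma poly_mapping_expand:
  "finite I \<Longrightarrow> Poly_Mapping.keys f \<subseteq> I \<Longrightarrow>
     f = (\<Sum>a\<in>I. Poly_Mapping.single a (Poly_Mapping.lookup f a))"
  by (rule poly_mapping_eqI)
     (auto simp: lookup_sum lookup_single when_def sum.delta in_keys_iff subset_iff)

lemma eval_x_add: "eval_x (f + g) x = eval_x f x + eval_x g x"
  unfolding eval_x_def by (rule setsum_keys_plus_distrib) (auto simp: algebra_simps)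

lemma eval_x_sum: "eval_x (sum f A) x = (\<Sum>a\<in>A. eval_x (f a) x)"
  by (induction A rule: infinite_finite_induct) (auto simp: eval_x_add, auto simp: eval_x_def)

lemma eval_x_single: "eval_x (Poly_Mapping.single \<alpha> c) x = c * monom_at x \<alpha>"
  by (cases "c = 0") (auto simp: eval_x_def)

text \<open>\<open>integral_y\<close> is integration of \<open>f(x,y)\<close> over \<open>y\<close>, pointwise in \<open>x\<close>.\<close>

lemma eval_integral_y:
  assumes "finite_moments \<nu>"
  shows "eval_x (integral_y \<nu> f) x = (LINT y|\<nu>. eval_xy f x y)"
  using assms
  by (auto simp: integral_y_def eval_xy_def eval_x_sum eval_x_single case_prod_unfold
      finite_moments_def Bochner_Integration.integral_sum mult_ac intro!: sum.cong)

text \<open>The entry of the localizing matrix at a pair of monomials.\<close>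

definition loc_entry ::
    "(real ^ 'm) measure \<Rightarrow> ('n::finite, 'm::finite) xypoly \<Rightarrow> ('n expo \<Rightarrow> real) \<Rightarrow>
     'n expo \<times> 'm expo \<Rightarrow> 'n expo \<times> 'm expo \<Rightarrow> real" where
  "loc_entry \<nu> h z a b = riesz z (integral_y \<nu> (Poly_Mapping.single (a + b) 1 * h))"

lemma riesz_integral_zero: "riesz z (integral_y \<nu> 0) = 0"
  by (simp add: riesz_def integral_y_def)

lemma riesz_integral_sum: "riesz z (integral_y \<nu> (sum f A)) = (\<Sum>a\<in>A. riesz z (integral_y \<nu> (f a)))"
  by (induction A rule: infinite_finite_induct)
     (auto simp: integral_y_add riesz_add riesz_integral_zero)

lemma riesz_integral_scale:
  "riesz z (integral_y \<nu> (Poly_Mapping.single a c * h)) =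
     c * riesz z (integral_y \<nu> (Poly_Mapping.single a 1 * h))"
proof -
  let ?K = "Poly_Mapping.keys h"
  have h: "h = (\<Sum>b\<in>?K. Poly_Mapping.single b (Poly_Mapping.lookup h b))"
    by (rule poly_mapping_expand) auto
  have *: "riesz z (integral_y \<nu> (Poly_Mapping.single a c * h)) =
     (\<Sum>b\<in>?K. c * Poly_Mapping.lookup h b * (LINT y|\<nu>. monom_at y (snd (a + b))) * z (fst (a + b)))" for c
  proof -
    have "riesz z (integral_y \<nu> (Poly_Mapping.single (a + b) r)) =
        r * (LINT y|\<nu>. monom_at y (snd (a + b))) * z (fst (a + b))" for b r
      by (simp add: integral_y_single riesz_single)
    then show ?thesis
      by (subst h) (simp only: sum_distrib_left mult_single riesz_integral_sum)
  qed
  show ?thesis by (simp only: * sum_distrib_left mult.assoc mult_1)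
qed

lemma riesz_integral_square:
  assumes "finite I" "Poly_Mapping.keys p \<subseteq> I"
  shows "riesz z (integral_y \<nu> (p\<^sup>2 * h)) = quad_form I (loc_entry \<nu> h z) (Poly_Mapping.lookup p)"
proof -
  let ?c = "Poly_Mapping.lookup p"
  have p: "p = (\<Sum>a\<in>I. Poly_Mapping.single a (?c a))"
    by (rule poly_mapping_expand) fact+
  have "p\<^sup>2 = (\<Sum>a\<in>I. Poly_Mapping.single a (?c a)) * (\<Sum>b\<in>I. Poly_Mapping.single b (?c b))"
    unfolding power2_eq_square by (rule arg_cong2[OF p p])
  also have "\<dots> = (\<Sum>a\<in>I. \<Sum>b\<in>I. Poly_Mapping.single (a + b) (?c a * ?c b))"
    by (simp only: sum_product mult_single)
  finally have "p\<^sup>2 * h = (\<Sum>a\<in>I. \<Sum>b\<in>I. Poly_Mapping.single (a + b) (?c a * ?c b) * h)"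
    by (simp only: sum_distrib_right)
  then have "riesz z (integral_y \<nu> (p\<^sup>2 * h)) =
      (\<Sum>a\<in>I. \<Sum>b\<in>I. riesz z (integral_y \<nu> (Poly_Mapping.single (a + b) (?c a * ?c b) * h)))"
    by (simp only: riesz_integral_sum)
  also have "\<dots> = quad_form I (loc_entry \<nu> h z) ?c"
    unfolding quad_form_def loc_entry_def
    by (intro sum.cong refl, subst riesz_integral_scale) (simp add: mult_ac)
  finally show ?thesis .
qed

lemma quad_form_single:
  assumes "finite I" "a \<in> I" "b \<in> I"
  shows "quad_form I W (\<lambda>x. (if x = a then s else 0) + (if x = b then t else 0)) =
     s * s * W a a + s * t * (W a b + W b a) + t * t * W b b"
proof -
  have lin: "(\<Sum>x\<in>I. ((if x = a then s else 0) + (if x = b then t else 0)) * F x) = s * F a + t * F b" for F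
    using assms by (simp add: distrib_right sum.distrib if_distrib[of "\<lambda>u. u * _"] sum.delta' cong: if_cong)
  have "quad_form I W (\<lambda>x. (if x = a then s else 0) + (if x = b then t else 0)) =
     (\<Sum>x\<in>I. ((if x = a then s else 0) + (if x = b then t else 0)) *
       (\<Sum>y\<in>I. ((if y = a then s else 0) + (if y = b then t else 0)) * W x y))"
    unfolding quad_form_def sum_distrib_left by (intro sum.cong refl) (simp only: mult_ac)
  also have "\<dots> = s * (s * W a a + t * W a b) + t * (s * W b a + t * W b b)"
    by (simp only: lin)
  finally show ?thesis by (simp add: algebra_simps)
qed

lemma is_loc_matrix_iff:
  "is_loc_matrix k l \<nu> (h :: ('n::finite, 'm::finite) xypoly) z W \<longleftrightarrow>
     W = (\<lambda>a b. if a \<in> loc_index k l h \<and> b \<in> loc_index k l h then loc_entry \<nu> h z a b else 0)"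
    (is "_ \<longleftrightarrow> W = ?E")
proof -
  define I where "I = loc_index k l h"
  have fin: "finite I" unfolding I_def by (rule finite_loc_index)
  have adm: "int (deg_x p) \<le> red_x k h \<and> int (deg_y p) \<le> red_y l h \<longleftrightarrow> Poly_Mapping.keys p \<subseteq> I"
    if "I \<noteq> {}" for p :: "('n, 'm) xypoly"
  proof -
    have "red_x k h \<ge> 0" "red_y l h \<ge> 0" using that by (auto simp: I_def loc_index_def basis_xy_def)
    from deg_le_iff[OF this, of p] show ?thesis by (simp add: I_def loc_index_def)
  qed
  have empty: "\<not> (int (deg_x p) \<le> red_x k h \<and> int (deg_y p) \<le> red_y l h)" if "I = {}" for p :: "('n, 'm) xypoly"
  proof
    assume "int (deg_x p) \<le> red_x k h \<and> int (deg_y p) \<le> red_y l h"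
    then have "(0, 0) \<in> I" by (auto simp: I_def loc_index_def basis_xy_def total_deg_def)
    with that show False by simp
  qed
  have sym: "loc_entry \<nu> h z a b = loc_entry \<nu> h z b a" for a b
    by (simp add: loc_entry_def add.commute)
  have q: "quad_form I ?E v = quad_form I (loc_entry \<nu> h z) v" for v
    unfolding quad_form_def by (intro sum.cong refl) (simp add: I_def)
  have ex: "is_loc_matrix k l \<nu> h z ?E"
    unfolding is_loc_matrix_def I_def[symmetric]
  proof (intro conjI allI impI)
    fix p :: "('n, 'm) xypoly"
    assume "int (deg_x p) \<le> red_x k h \<and> int (deg_y p) \<le> red_y l h"
    then have "Poly_Mapping.keys p \<subseteq> I" using adm empty by blast
    from riesz_integral_square[OF fin this]
    show "riesz z (integral_y \<nu> (p\<^sup>2 * h)) = quad_form I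
       (\<lambda>a b. if a \<in> I \<and> b \<in> I then loc_entry \<nu> h z a b else 0) (Poly_Mapping.lookup p)"
      using q by (simp add: I_def)
  qed (auto simp: sym)
  have un: "W = W'" if W: "is_loc_matrix k l \<nu> h z W" and W': "is_loc_matrix k l \<nu> h z W'" for W W'
  proof (intro ext)
    fix a b
    show "W a b = W' a b"
    proof (cases "a \<in> I \<and> b \<in> I")
      case False
      then have "W a b = 0" "W' a b = 0" using W W' unfolding is_loc_matrix_def I_def by blast+
      then show ?thesis by simp
    next
      case True
      have eq: "s * s * W a a + s * t * (W a b + W b a) + t * t * W b b =
          s * s * W' a a + s * t * (W' a b + W' b a) + t * t * W' b b" for s t
      proof -
        let ?p = "Poly_Mapping.single a s + Poly_Mapping.single b t"
        have "Poly_Mapping.keys ?p \<subseteq> I"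
          using True Poly_Mapping.keys_add[of "Poly_Mapping.single a s" "Poly_Mapping.single b t"]
          by (auto split: if_splits)
        then have "int (deg_x ?p) \<le> red_x k h \<and> int (deg_y ?p) \<le> red_y l h" using adm True by blast
        then have "riesz z (integral_y \<nu> (?p\<^sup>2 * h)) = quad_form I W (Poly_Mapping.lookup ?p)"
          "riesz z (integral_y \<nu> (?p\<^sup>2 * h)) = quad_form I W' (Poly_Mapping.lookup ?p)"
          using W W' unfolding is_loc_matrix_def I_def by blast+
        then have "quad_form I W (Poly_Mapping.lookup ?p) = quad_form I W' (Poly_Mapping.lookup ?p)"
          by simp
        moreover have "Poly_Mapping.lookup ?p =
            (\<lambda>x. (if x = a then s else 0) + (if x = b then t else 0))"
          by (auto simp: lookup_add lookup_single when_def)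
        ultimately show ?thesis
          using True quad_form_single[OF fin, of a b W s t] quad_form_single[OF fin, of a b W' s t]
          by (simp only: simp_thms)
      qed
      have "W a b = W b a" "W' a b = W' b a" using W W' unfolding is_loc_matrix_def by blast+
      with eq[of 1 1] eq[of 1 0] eq[of 0 1] show ?thesis by simp
    qed
  qed
  show ?thesis
  proof
    show "W = ?E" if "is_loc_matrix k l \<nu> h z W" using that ex by (rule un)
    show "is_loc_matrix k l \<nu> h z W" if "W = ?E" using ex by (simp only: that)
  qed
qed

lemma loc_matrix_eq:
  "loc_matrix k l \<nu> h z =
     (\<lambda>a b. if a \<in> loc_index k l h \<and> b \<in> loc_index k l h then loc_entry \<nu> h z a b else 0)"
  unfolding loc_matrix_def is_loc_matrix_iff by simp

end

theory Submission
  imports Defs "HOL-Probability.Probability"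
begin

text \<open>
  Positive semidefiniteness of all localizing matrices says that the Riesz functional \<open>L\<close> of
  \<open>z\<close> is nonnegative on all \<open>\<integral> p\<^sup>2 g\<^sub>j d\<nu>\<close>, hence on the quadratic module.

  In the archimedean case \<open>L (p\<^sup>2) \<ge> 0\<close> and \<open>L (p\<^sup>2 (r\<^sup>2 - x\<^sub>i\<^sup>2)) \<ge> 0\<close>. By Cauchy-Schwarz
  \<open>L\<close> stays of this kind when it is multiplied by \<open>r \<plusminus> x\<^sub>i\<close>, so it is nonnegative on all products of
  these factors, in particular on the Bernstein basis polynomials of the box \<open>[-r, r]\<^sup>n\<close>. Their
  values are the weights of discrete measures on the box whose moments converge to \<open>z\<close>. These
  measures are lifted to \<open>[0, 1]\<close> along a space-filling curve, where Helly's selection theorem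
  gives a limit; its image is a representing measure \<open>\<mu>\<close> of \<open>L\<close>.

  To locate the support of \<open>\<mu>\<close>, let \<open>\<nu>\<close> satisfy Carleman's condition and let \<open>G\<close> be a polynomial with
  \<open>\<integral> q\<^sup>2 G d\<nu> \<ge> 0\<close> for all polynomials \<open>q\<close>. Bang's proof of the Denjoy-Carleman theorem, applied to the
  distance from the polynomials in \<open>L\<^sup>2(|G| \<nu>)\<close>, shows that products of functions \<open>cos (t y\<^sub>j + c)\<close>
  are limits of polynomials there. As \<open>cos (t / sqrt n)\<^sup>n\<close> tends to \<open>exp (- t\<^sup>2 / 2)\<close>, integrating
  \<open>G\<close> against Gaussians gives nonnegative values, so \<open>G \<ge> 0\<close> on the support of \<open>\<nu>\<close>. This is
  used once for \<open>\<nu>\<close> in the variables \<open>y\<close> and once for \<open>\<mu>\<close> in the variables \<open>x\<close>.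
\<close>

subsection \<open>Polynomials and the quadratic module\<close>

lemma poly_mapping_induct_add [case_names single add]:
  assumes "\<And>a c. P (Poly_Mapping.single a c)" "\<And>f g. P f \<Longrightarrow> P g \<Longrightarrow> P (f + g)"
  shows "P (f :: 'a \<Rightarrow>\<^sub>0 real)"
proof -
  have "P (\<Sum>a\<in>A. Poly_Mapping.single a (Poly_Mapping.lookup f a))" if "finite A" for A
    using that
  proof (induction A rule: finite_induct)
    case empty
    \<comment> \<open>A term with coefficient 0 is the zero polynomial, so the empty sum needs no
      case of its own.\<close>
    show ?case using assms(1)[of undefined 0] by simp
  qed (simp add: assms)
  from this[OF finite_keys[of f]] show ?thesis
    using poly_mapping_expand[OF finite_keys order_refl, of f] by simp
qed

lemma monom_at_add: "monom_at x (\<alpha> + \<beta>) = monom_at x \<alpha> * monom_at x \<beta>"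
  by (simp add: monom_at_def lookup_add power_add prod.distrib)

lemma monom_at_0 [simp]: "monom_at x 0 = 1"
  by (simp add: monom_at_def)

lemma eval_x_0 [simp]: "eval_x 0 x = 0"
  by (simp add: eval_x_def)

lemma eval_x_mult: "eval_x (f * g) x = eval_x f x * eval_x g x"
proof (induction f rule: poly_mapping_induct_add)
  case (single a c)
  show ?case
    by (induction g rule: poly_mapping_induct_add)
       (simp_all add: mult_single eval_x_single monom_at_add eval_x_add algebra_simps)
qed (simp add: eval_x_add algebra_simps)

lemma eval_x_1 [simp]: "eval_x 1 x = 1"
  by (metis eval_x_single monom_at_0 mult_1 single_one)

lemma eval_x_uminus: "eval_x (- f) x = - eval_x f x"
  using eval_x_add[of f "- f" x] by simp

lemma eval_x_diff: "eval_x (f - g) x = eval_x f x - eval_x g x"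
  using eval_x_add[of f "- g" x] by (simp add: eval_x_uminus)

lemma eval_x_power: "eval_x (f ^ k) x = eval_x f x ^ k"
  by (induction k) (simp_all add: eval_x_mult)

lemma monom_at_single: "monom_at x (Poly_Mapping.single i k) = (x $ i) ^ k"
proof -
  have "monom_at x (Poly_Mapping.single i k) = (\<Prod>j\<in>UNIV. if j = i then (x $ i) ^ k else 1)"
    unfolding monom_at_def by (intro prod.cong) (auto simp: lookup_single when_def)
  then show ?thesis by simp
qed

lemma eval_x_var: "eval_x (var_x i) x = x $ i"
  by (simp add: var_x_def eval_x_single monom_at_single)

lemma eval_xy_add: "eval_xy (f + g) x y = eval_xy f x y + eval_xy g x y"
  unfolding eval_xy_def case_prod_unfold prod.collapse
  by (rule setsum_keys_plus_distrib) (auto simp: algebra_simps)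

lemma eval_xy_single:
  "eval_xy (Poly_Mapping.single a c) x y = c * (monom_at x (fst a) * monom_at y (snd a))"
  by (cases "c = 0") (auto simp: eval_xy_def case_prod_unfold)

lemma eval_xy_mult: "eval_xy (f * g) x y = eval_xy f x y * eval_xy g x y"
proof (induction f rule: poly_mapping_induct_add)
  case (single a c)
  show ?case
    by (induction g rule: poly_mapping_induct_add)
       (simp_all add: mult_single eval_xy_single monom_at_add eval_xy_add algebra_simps)
qed (simp add: eval_xy_add algebra_simps)

lemma eval_xy_power2: "eval_xy (f\<^sup>2) x y = (eval_xy f x y)\<^sup>2"
  by (simp add: power2_eq_square eval_xy_mult)

section \<open>Polynomials in one group of variables, and linearity of the functionals\<close>

definition emb_x :: "'n xpoly \<Rightarrow> ('n::finite, 'm::finite) xypoly" where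
  "emb_x f = (\<Sum>\<alpha>\<in>Poly_Mapping.keys f. Poly_Mapping.single (\<alpha>, 0) (Poly_Mapping.lookup f \<alpha>))"

definition emb_y :: "'m xpoly \<Rightarrow> ('n::finite, 'm::finite) xypoly" where
  "emb_y f = (\<Sum>\<beta>\<in>Poly_Mapping.keys f. Poly_Mapping.single (0, \<beta>) (Poly_Mapping.lookup f \<beta>))"

lemma emb_x_add: "emb_x (f + g) = emb_x f + emb_x g"
  unfolding emb_x_def by (rule setsum_keys_plus_distrib) (simp_all add: single_add)

lemma emb_y_add: "emb_y (f + g) = emb_y f + emb_y g"
  unfolding emb_y_def by (rule setsum_keys_plus_distrib) (simp_all add: single_add)

lemma emb_x_single: "emb_x (Poly_Mapping.single \<alpha> c) = Poly_Mapping.single (\<alpha>, 0) c"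
  by (cases "c = 0") (simp_all add: emb_x_def)

lemma emb_y_single: "emb_y (Poly_Mapping.single \<beta> c) = Poly_Mapping.single (0, \<beta>) c"
  by (cases "c = 0") (simp_all add: emb_y_def)

lemma eval_emb_x: "eval_xy (emb_x f) x y = eval_x f x"
  by (induction f rule: poly_mapping_induct_add)
     (simp_all add: emb_x_single emb_x_add eval_xy_single eval_xy_add eval_x_single eval_x_add)

lemma eval_emb_y: "eval_xy (emb_y f) x y = eval_x f y"
  by (induction f rule: poly_mapping_induct_add)
     (simp_all add: emb_y_single emb_y_add eval_xy_single eval_xy_add eval_x_single eval_x_add)

text \<open>Factors in \<open>x\<close> alone are constants for the integration over
  \<open>y\<close>, so \<open>integral_y\<close> is linear over the polynomials in \<open>x\<close>.
  This lets squares in \<open>x\<close> be moved into the multipliers of the quadratic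
  module.\<close>

lemma integral_y_emb_x: "integral_y \<nu> (emb_x f * h) = f * integral_y \<nu> h"
proof (induction f rule: poly_mapping_induct_add)
  case (single a c)
  show ?case
    by (induction h rule: poly_mapping_induct_add)
       (simp_all add: mult_single emb_x_single integral_y_single integral_y_add distrib_left mult.assoc)
qed (simp add: emb_x_add integral_y_add distrib_right)

lemma integral_y_0 [simp]: "integral_y \<nu> 0 = 0"
  by (simp add: integral_y_def)

lemma riesz_0 [simp]: "riesz z 0 = 0"
  by (simp add: riesz_def)

lemma riesz_sum: "riesz z (sum f A) = (\<Sum>a\<in>A. riesz z (f a))"
  by (induction A rule: infinite_finite_induct) (auto simp: riesz_add)

lemma riesz_scale: "riesz z (Poly_Mapping.single 0 c * f) = c * riesz z f"
  by (induction f rule: poly_mapping_induct_add)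
     (simp_all add: mult_single riesz_single riesz_add distrib_left)

lemma sum_list_add_hom:
  assumes "F 0 = (0::'b::comm_monoid_add)" "\<And>f g. F (f + g) = F f + F g"
  shows "F (sum_list xs) = (\<Sum>x\<leftarrow>xs. F x)"
  by (induction xs) (simp_all add: assms)

text \<open>The cone is generated by the integrals of one square times one \<open>g j\<close>: a
  single such integral arises by taking all other multipliers to be the empty sum of squares, and a
  general element splits by additivity.\<close>

lemma riesz_nonneg_on_QM_iff:
  fixes g :: "nat \<Rightarrow> ('a::finite, 'b::finite) xypoly"
  shows "(\<forall>f\<in>QM s g \<nu>. riesz z f \<ge> 0) \<longleftrightarrow> (\<forall>j\<le>s. \<forall>p. riesz z (integral_y \<nu> (p\<^sup>2 * g j)) \<ge> 0)"
proof (intro iffI allI impI ballI)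
  fix j and p :: "('a, 'b) xypoly" assume *: "\<forall>f\<in>QM s g \<nu>. riesz z f \<ge> 0" and "j \<le> s"
  define \<tau> where "\<tau> i = (if i = j then p\<^sup>2 else 0)" for i
  have sos: "\<tau> i \<in> sos" for i
  proof -
    have "\<tau> i = (\<Sum>q\<leftarrow>(if i = j then [p] else []). q\<^sup>2)" by (simp add: \<tau>_def)
    then show ?thesis unfolding sos_def by blast
  qed
  have "(\<Sum>i\<le>s. integral_y \<nu> (\<tau> i * g i)) = (\<Sum>i\<le>s. if i = j then integral_y \<nu> (p\<^sup>2 * g j) else 0)"
    by (intro sum.cong refl) (simp add: \<tau>_def)
  also have "\<dots> = integral_y \<nu> (p\<^sup>2 * g j)" using \<open>j \<le> s\<close> by simp
  finally have "integral_y \<nu> (p\<^sup>2 * g j) = (\<Sum>i\<le>s. integral_y \<nu> (\<tau> i * g i))" ..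
  moreover have "(\<Sum>i\<le>s. integral_y \<nu> (\<tau> i * g i)) \<in> QM s g \<nu>"
    unfolding QM_def using sos by blast
  ultimately show "riesz z (integral_y \<nu> (p\<^sup>2 * g j)) \<ge> 0"
    using * by metis
next
  fix f assume *: "\<forall>j\<le>s. \<forall>p. riesz z (integral_y \<nu> (p\<^sup>2 * g j)) \<ge> 0" and "f \<in> QM s g \<nu>"
  then obtain \<tau> where f: "f = (\<Sum>j\<le>s. integral_y \<nu> (\<tau> j * g j))" and \<tau>: "\<And>j. j \<le> s \<Longrightarrow> \<tau> j \<in> sos"
    by (auto simp: QM_def)
  have "riesz z (integral_y \<nu> (\<tau> j * g j)) \<ge> 0" if "j \<le> s" for j
  proof -
    obtain qs where qs: "\<tau> j = (\<Sum>q\<leftarrow>qs. q\<^sup>2)" using \<tau>[OF \<open>j \<le> s\<close>] by (auto simp: sos_def)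
    have "riesz z (integral_y \<nu> (sum_list xs * g j)) = (\<Sum>x\<leftarrow>xs. riesz z (integral_y \<nu> (x * g j)))" for xs
      by (rule sum_list_add_hom[where F = "\<lambda>x. riesz z (integral_y \<nu> (x * g j))"])
         (simp_all add: distrib_right integral_y_add riesz_add)
    then show ?thesis unfolding qs
      using * \<open>j \<le> s\<close> by (auto simp: o_def intro!: sum_list_nonneg)
  qed
  then show "riesz z f \<ge> 0" by (auto simp: f riesz_sum intro!: sum_nonneg)
qed

text \<open>Every polynomial has its exponents in some index set, and every vector on an index set
  is the coefficient vector of a polynomial. The matrices thus encode the same squares, sorted by
  degree.\<close>

lemma loc_matrix_psd_iff:
  fixes h :: "('a::finite, 'b::finite) xypoly"
  shows "(\<forall>k\<ge>1. \<forall>l\<ge>1. pos_semidef (loc_index k l h) (loc_matrix k l \<nu> h z)) \<longleftrightarrow>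
     (\<forall>p. riesz z (integral_y \<nu> (p\<^sup>2 * h)) \<ge> 0)"
proof (intro iffI allI impI)
  have quad: "quad_form (loc_index k l h) (loc_matrix k l \<nu> h z) v =
      quad_form (loc_index k l h) (loc_entry \<nu> h z) v" for k l v
    unfolding quad_form_def loc_matrix_eq by (intro sum.cong refl) simp
  {
    fix p :: "('a, 'b) xypoly" assume *: "\<forall>k\<ge>1. \<forall>l\<ge>1. pos_semidef (loc_index k l h) (loc_matrix k l \<nu> h z)"
    \<comment> \<open>Half the degree of \<open>h\<close>, rounded up, is at most that degree, so
      the reduced bounds still exceed the degrees of \<open>p\<close>; \<open>Suc\<close> secures
      \<open>d \<ge> 1\<close>.\<close>
    define d where "d = Suc (deg_x p + deg_y p + deg_x h + deg_y h)"
    have "\<lceil>real n / 2\<rceil> \<le> int n" for n by linarith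
    from this[of "deg_x h"] this[of "deg_y h"]
    have red: "red_x d h \<ge> int (deg_x p)" "red_y d h \<ge> int (deg_y p)"
      by (simp_all add: red_x_def red_y_def d_def)
    with deg_le_iff[of "red_x d h" "red_y d h" p]
    have "Poly_Mapping.keys p \<subseteq> loc_index d d h"
      by (simp add: loc_index_def)
    then have "riesz z (integral_y \<nu> (p\<^sup>2 * h)) =
        quad_form (loc_index d d h) (loc_matrix d d \<nu> h z) (Poly_Mapping.lookup p)"
      by (simp add: quad riesz_integral_square finite_loc_index)
    moreover have "d \<ge> 1" by (simp add: d_def)
    ultimately show "riesz z (integral_y \<nu> (p\<^sup>2 * h)) \<ge> 0"
      using * by (simp add: pos_semidef_def)
  next
    fix k l :: nat assume *: "\<forall>p. riesz z (integral_y \<nu> (p\<^sup>2 * h)) \<ge> 0"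
    let ?I = "loc_index k l h"
    have "quad_form ?I (loc_entry \<nu> h z) v \<ge> 0" for v
    proof -
      define p where "p = (\<Sum>a\<in>?I. Poly_Mapping.single a (v a))"
      have lookup: "Poly_Mapping.lookup p a = (if a \<in> ?I then v a else 0)" for a
        by (auto simp: p_def lookup_sum lookup_single when_def finite_loc_index)
      then have "Poly_Mapping.keys p \<subseteq> ?I" by (auto simp: in_keys_iff split: if_splits)
      then have "riesz z (integral_y \<nu> (p\<^sup>2 * h)) = quad_form ?I (loc_entry \<nu> h z) (Poly_Mapping.lookup p)"
        by (rule riesz_integral_square[OF finite_loc_index])
      also have "\<dots> = quad_form ?I (loc_entry \<nu> h z) v"
        unfolding quad_form_def by (intro sum.cong refl) (simp add: lookup)
      finally show ?thesis using * by metis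
    qed
    then show "pos_semidef ?I (loc_matrix k l \<nu> h z)"
      unfolding pos_semidef_def quad by (auto simp: loc_matrix_eq loc_entry_def add.commute)
  }
qed

subsection \<open>Functionals nonnegative on Bernstein polynomials\<close>

text \<open>The discriminant argument. For \<open>A = 0\<close> and \<open>B\<close> nonzero, a
  suitable \<open>c\<close> with \<open>d = 1\<close> gives the value -1; for \<open>A > 0\<close>
  the choice \<open>c = B\<close>, \<open>d = - A\<close> gives \<open>A\<close> times the claimed
  difference.\<close>

lemma quadratic_form_nonneg_imp_le:
  fixes A B E :: real
  assumes "\<And>c d. c\<^sup>2 * A + 2 * c * d * B + d\<^sup>2 * E \<ge> 0"
  shows "B\<^sup>2 \<le> A * E"
proof (cases "A = 0")
  case True
  have "B = 0"
  proof (rule ccontr)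
    assume "B \<noteq> 0"
    then show False using assms[of "- (E + 1) / (2 * B)" 1] True by (simp add: field_simps)
  qed
  with True show ?thesis by simp
next
  case False
  with assms[of 1 0] have "A > 0" by simp
  have "A * (A * E - B\<^sup>2) \<ge> 0"
    using assms[of B "- A"] by (simp add: power2_eq_square algebra_simps)
  with \<open>A > 0\<close> show ?thesis by (simp add: zero_le_mult_iff)
qed

text \<open>Log-convexity makes the ratios of consecutive terms nondecreasing. If the first ratio
  \<open>q\<close> exceeded 1, the sequence would grow at least like \<open>q ^ m\<close> and be
  unbounded.\<close>

lemma log_convex_bounded_imp_le:
  fixes a :: "nat \<Rightarrow> real"
  assumes nonneg: "\<And>m. a m \<ge> 0" and conv: "\<And>m. (a (Suc m))\<^sup>2 \<le> a m * a (Suc (Suc m))"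
    and bound: "\<And>m. a m \<le> B"
  shows "a 1 \<le> a 0"
proof (rule ccontr)
  assume "\<not> a 1 \<le> a 0"
  then have less: "a 0 < a 1" by simp
  have "a 0 \<noteq> 0"
  proof
    assume "a 0 = 0"
    then have "(a 1)\<^sup>2 \<le> 0" using conv[of 0] by simp
    then show False using less nonneg[of 0] by simp
  qed
  with nonneg[of 0] have pos0: "a 0 > 0" by simp
  define q where "q = a 1 / a 0"
  have q: "q > 1" using less pos0 by (simp add: q_def)
  have step: "a m > 0 \<and> a (Suc m) \<ge> q * a m" for m
  proof (induction m)
    case 0
    show ?case using pos0 by (simp add: q_def)
  next
    case (Suc m)
    then have pos: "a (Suc m) > 0" using q by (smt (verit) mult_pos_pos)
    have "q * a m * a (Suc m) \<le> a (Suc m) * a (Suc m)"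
      using Suc pos by (simp add: mult_right_mono)
    also have "\<dots> \<le> a m * a (Suc (Suc m))" using conv[of m] by (simp add: power2_eq_square)
    finally have "a m * (q * a (Suc m)) \<le> a m * a (Suc (Suc m))" by (simp add: mult_ac)
    with Suc pos show ?case by simp
  qed
  have "a m \<ge> q ^ m * a 0" for m
  proof (induction m)
    case (Suc m)
    have "q ^ Suc m * a 0 \<le> q * a m" using Suc q by (simp add: mult.assoc)
    with step[of m] show ?case by linarith
  qed simp
  then have "q ^ m \<le> B / a 0" for m
    using bound[of m] pos0 by (smt (verit) pos_le_divide_eq)
  moreover obtain m where "q ^ m > B / a 0" using real_arch_pow[OF q] by blast
  ultimately show False by (meson not_le)
qed

abbreviation const_poly :: "real \<Rightarrow> ('a::comm_monoid_add) \<Rightarrow>\<^sub>0 real" where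
  "const_poly \<equiv> Poly_Mapping.single 0"

lemma const_poly_add: "const_poly (c + d) = const_poly c + const_poly d"
  by (rule single_add)

lemma const_poly_mult: "const_poly (c * d) = const_poly c * const_poly d"
  by (simp add: mult_single)

definition linear_functional :: "(('a::comm_monoid_add \<Rightarrow>\<^sub>0 real) \<Rightarrow> real) \<Rightarrow> bool" where
  "linear_functional L \<longleftrightarrow> (\<forall>f g. L (f + g) = L f + L g) \<and> (\<forall>c f. L (const_poly c * f) = c * L f)"

text \<open>The \<open>u i\<close> are meant as affine coordinates in which the box is the unit
  cube, and \<open>u i * (1 - u i)\<close> is its quadratic description. The condition is chosen so
  that multiplying by \<open>u k\<close> or \<open>1 - u k\<close> preserves it.\<close>

definition box_positive :: "('i \<Rightarrow> 'n xpoly) \<Rightarrow> ('n xpoly \<Rightarrow> real) \<Rightarrow> bool" where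
  "box_positive u L \<longleftrightarrow> linear_functional L \<and> (\<forall>p. L (p\<^sup>2) \<ge> 0) \<and>
     (\<forall>i p. L (p\<^sup>2 * (u i * (1 - u i))) \<ge> 0)"

lemma functional_Cauchy_Schwarz:
  fixes L :: "'n xpoly \<Rightarrow> real"
  assumes "linear_functional L" "\<And>p. L (p\<^sup>2) \<ge> 0"
  shows "(L (f * g))\<^sup>2 \<le> L (f\<^sup>2) * L (g\<^sup>2)"
proof (rule quadratic_form_nonneg_imp_le)
  fix c d
  have add: "L (p + q) = L p + L q" and scale: "L (const_poly r * p) = r * L p" for p q r
    using assms(1) by (simp_all add: linear_functional_def)
  have "(const_poly c * f + const_poly d * g)\<^sup>2 =
      const_poly (c\<^sup>2) * f\<^sup>2 + const_poly (2 * c * d) * (f * g) + const_poly (d\<^sup>2) * g\<^sup>2"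
  proof -
    have sq: "const_poly (r\<^sup>2) = const_poly r * const_poly r" for r :: real
      by (simp only: power2_eq_square const_poly_mult)
    have mixed: "const_poly (2 * c * d) = const_poly c * const_poly d + const_poly c * const_poly d"
      unfolding const_poly_mult[symmetric] const_poly_add[symmetric] by (simp add: algebra_simps)
    show ?thesis unfolding sq mixed by (simp add: power2_eq_square algebra_simps)
  qed
  then show "c\<^sup>2 * L (f\<^sup>2) + 2 * c * d * L (f * g) + d\<^sup>2 * L (g\<^sup>2) \<ge> 0"
    using assms(2)[of "const_poly c * f + const_poly d * g"] by (simp add: add scale)
qed

text \<open>
  With \<open>t = 2 u i - 1\<close> the moments \<open>L (w t\<^sup>2\<^sup>m p\<^sup>2)\<close> are log-convex in \<open>m\<close> by Cauchy-Schwarz and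
  bounded by \<open>L (p\<^sup>2)\<close>, hence cannot increase from \<open>m = 0\<close> to \<open>m = 1\<close>.
\<close>

lemma box_positive_mult:
  fixes u :: "'i \<Rightarrow> 'n xpoly"
  assumes L: "box_positive u L" and w: "w = u k \<or> w = 1 - u k"
  shows "box_positive u (\<lambda>p. L (w * p))"
proof -
  have lin: "linear_functional L" using L by (simp add: box_positive_def)
  have add: "L (p + q) = L p + L q" and scale: "L (const_poly r * p) = r * L p" for p q r
    using lin by (simp_all add: linear_functional_def)
  have sq: "L (p\<^sup>2) \<ge> 0" and sq_u: "L (p\<^sup>2 * (u i * (1 - u i))) \<ge> 0" for p i
    using L by (simp_all add: box_positive_def)
  have half: "L (v * p\<^sup>2) \<ge> 0" if "v = u k \<or> v = 1 - u k" for v p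
  proof -
    \<comment> \<open>For both choices of \<open>v\<close> one has
      \<open>v * (1 - v) = u k * (1 - u k)\<close>.\<close>
    have "v * p\<^sup>2 = (v * p)\<^sup>2 + p\<^sup>2 * (u k * (1 - u k))"
      using that by (elim disjE; simp only:) (simp_all add: power2_eq_square algebra_simps)
    then show ?thesis by (simp add: add sq sq_u)
  qed
  have w_pos: "L (w * p\<^sup>2) \<ge> 0" for p using half w by blast
  have w_le: "L (w * p\<^sup>2) \<le> L (p\<^sup>2)" for p
  proof -
    have "L ((1 - w) * p\<^sup>2) \<ge> 0" using half[of "1 - w"] w by auto
    moreover have "p\<^sup>2 = w * p\<^sup>2 + (1 - w) * p\<^sup>2" by (simp add: algebra_simps)
    then have "L (p\<^sup>2) = L (w * p\<^sup>2) + L ((1 - w) * p\<^sup>2)" by (metis add)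
    ultimately show ?thesis by linarith
  qed
  have linw: "linear_functional (\<lambda>p. L (w * p))"
    unfolding linear_functional_def
    by (simp add: distrib_left add mult.left_commute[of w] scale)
  \<comment> \<open>This is \<open>1 = (2 * u i - 1)\<close> squared plus
    \<open>4 * (u i * (1 - u i))\<close>, times the square of \<open>q\<close>. The four copies are
    written out so that additivity alone can be applied to them.\<close>
  have t: "q\<^sup>2 = ((2 * u i - 1) * q)\<^sup>2 + (q\<^sup>2 * (u i * (1 - u i)) + q\<^sup>2 * (u i * (1 - u i)) +
     (q\<^sup>2 * (u i * (1 - u i)) + q\<^sup>2 * (u i * (1 - u i))))" for q i
    by (simp add: power2_eq_square algebra_simps)
  have "L (w * (p\<^sup>2 * (u i * (1 - u i)))) \<ge> 0" for i p
  proof -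
    define a where "a m = L (w * ((2 * u i - 1) ^ m * p)\<^sup>2)" for m
    have "a 1 \<le> a 0"
    proof (rule log_convex_bounded_imp_le)
      show "a m \<ge> 0" for m unfolding a_def by (rule w_pos)
      show "(a (Suc m))\<^sup>2 \<le> a m * a (Suc (Suc m))" for m
      proof -
        have "a (Suc m) = L (w * (((2 * u i - 1) ^ m * p) * ((2 * u i - 1) ^ Suc (Suc m) * p)))"
          unfolding a_def by (rule arg_cong[where f = L]) (simp add: power2_eq_square mult_ac)
        then show ?thesis
          unfolding a_def using functional_Cauchy_Schwarz[OF linw w_pos] by metis
      qed
      show "a m \<le> L (p\<^sup>2)" for m
      proof -
        have "L (((2 * u i - 1) ^ m * p)\<^sup>2) \<le> L (p\<^sup>2)"
        proof (induction m)
          case (Suc m)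
          let ?q = "(2 * u i - 1) ^ m * p"
          have "L (?q\<^sup>2) = L (((2 * u i - 1) * ?q)\<^sup>2) + 4 * L (?q\<^sup>2 * (u i * (1 - u i)))"
            using arg_cong[OF t[of ?q i], of L] unfolding add by simp
          with Suc sq_u[of ?q i] show ?case by (simp add: mult.assoc)
        qed simp
        with w_le show ?thesis unfolding a_def by (meson order_trans)
      qed
    qed
    moreover have "L (w * p\<^sup>2) = L (w * ((2 * u i - 1) * p)\<^sup>2) + 4 * L (w * (p\<^sup>2 * (u i * (1 - u i))))"
      using arg_cong[OF t[of p i], of "\<lambda>q. L (w * q)"] unfolding distrib_left[of w] add by simp
    ultimately show ?thesis by (simp add: a_def)
  qed
  with linw w_pos show ?thesis by (simp add: box_positive_def)
qed

lemma box_positive_power: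
  assumes "box_positive u L" "w = u k \<or> w = 1 - u k"
  shows "box_positive u (\<lambda>p. L (w ^ a * p))"
proof (induction a)
  case (Suc a)
  show ?case using box_positive_mult[OF Suc assms(2)] by (simp add: mult_ac)
qed (simp add: assms)

lemma box_positive_prod:
  assumes "box_positive u L" "finite A"
  shows "box_positive u (\<lambda>p. L ((\<Prod>i\<in>A. u i ^ a i * (1 - u i) ^ b i) * p))"
  using assms(2)
proof (induction A rule: finite_induct)
  case (insert x A)
  from box_positive_power[OF box_positive_power[OF insert.IH, of "u x" x "a x"], of "1 - u x" x "b x"]
  have "box_positive u (\<lambda>p. L ((\<Prod>i\<in>A. u i ^ a i * (1 - u i) ^ b i) * (u x ^ a x * ((1 - u x) ^ b x * p))))"
    by simp
  then show ?case using insert by (simp add: mult_ac)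
qed (simp add: assms)

section \<open>Bernstein polynomials and discretization on a grid\<close>

definition bernstein_poly :: "nat \<Rightarrow> nat \<Rightarrow> 'a::comm_ring_1 \<Rightarrow> 'a" where
  "bernstein_poly k j u = of_nat (k choose j) * (u ^ j * (1 - u) ^ (k - j))"

text \<open>Choosing \<open>j\<close> out of \<open>k\<close> and then \<open>d\<close> out of
  \<open>j\<close> amounts to choosing \<open>d\<close> first and \<open>j - d\<close> from the
  rest. The remaining sum is the binomial expansion of \<open>(u + (1 - u)) ^ (k - d)\<close>. It
  holds in any commutative ring, so \<open>u\<close> may itself be a polynomial.\<close>

lemma sum_choose_bernstein_poly:
  assumes "d \<le> k"
  shows "(\<Sum>j\<le>k. of_nat (j choose d) * bernstein_poly k j u) = of_nat (k choose d) * u ^ d"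
proof -
  have "(\<Sum>j\<le>k. of_nat (j choose d) * bernstein_poly k j u) =
      (\<Sum>j\<in>{d..k}. of_nat (j choose d) * bernstein_poly k j u)"
    by (rule sum.mono_neutral_right) (auto simp: binomial_eq_0)
  also have "\<dots> = (\<Sum>i\<le>k - d. of_nat ((i + d) choose d) * bernstein_poly k (i + d) u)"
    by (rule sum.reindex_bij_witness[of _ "\<lambda>i. i + d" "\<lambda>j. j - d"]) (use assms in auto)
  also have "\<dots> = (\<Sum>i\<le>k - d. of_nat (k choose d) * u ^ d *
      (of_nat (k - d choose i) * u ^ i * (1 - u) ^ (k - d - i)))"
  proof (rule sum.cong[OF refl])
    fix i assume "i \<in> {..k - d}"
    then have "(k choose (i + d)) * ((i + d) choose d) = (k choose d) * (k - d choose i)"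
      using choose_mult[of d "i + d" k] assms by simp
    then have "(of_nat ((i + d) choose d) :: 'a) * of_nat (k choose (i + d)) =
        of_nat (k choose d) * of_nat (k - d choose i)"
      by (metis of_nat_mult mult.commute)
    moreover have "k - (i + d) = k - d - i" by simp
    ultimately show "of_nat ((i + d) choose d) * bernstein_poly k (i + d) u =
        of_nat (k choose d) * u ^ d * (of_nat (k - d choose i) * u ^ i * (1 - u) ^ (k - d - i))"
      unfolding bernstein_poly_def mult.assoc[symmetric] by (simp add: power_add mult_ac)
  qed
  also have "\<dots> = of_nat (k choose d) * u ^ d * (u + (1 - u)) ^ (k - d)"
    by (simp only: binomial_ring sum_distrib_left)
  finally show ?thesis by simp
qed

text \<open>The ratio is the product of the factors \<open>(j - i) / (k - i)\<close> for
  \<open>i < d\<close>. Each lies in the unit interval and within \<open>i / k\<close> of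
  \<open>j / k\<close>, and errors of such factors at most add up.\<close>

lemma choose_ratio_approx:
  assumes "j \<le> k" "d \<le> k" "k > 0"
  shows "\<bar>real (j choose d) / real (k choose d) - (real j / real k) ^ d\<bar> \<le> real (d * d) / real k"
    and "real (j choose d) / real (k choose d) \<in> {0..1}"
proof -
  show "real (j choose d) / real (k choose d) \<in> {0..1}" 
    using assms by (auto simp: divide_le_eq_1 binomial_right_mono)
  show "\<bar>real (j choose d) / real (k choose d) - (real j / real k) ^ d\<bar> \<le> real (d * d) / real k"
    using \<open>d \<le> k\<close>
  proof (induction d)
    case (Suc d)
    define \<rho> \<sigma> where "\<rho> = real (j choose d) / real (k choose d)" and "\<sigma> = real (j - d) / real (k - d)"
    have eq: "real (i choose Suc d) = real (i choose d) * real (i - d) / real (Suc d)" for i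
    proof -
      have "(i choose Suc d) * Suc d = (i choose d) * (i - d)"
        using binomial_absorb_comp[of i d] binomial_absorption[of d i] by (simp only: mult.commute)
      then have "real (i choose Suc d) * real (Suc d) = real (i choose d) * real (i - d)"
        by (simp only: of_nat_mult[symmetric])
      then show ?thesis by (simp add: field_simps del: of_nat_Suc)
    qed
    have "real (j choose Suc d) / real (k choose Suc d) = \<rho> * \<sigma>"
      unfolding eq \<rho>_def \<sigma>_def by (simp add: field_simps del: of_nat_Suc)
    moreover have "\<rho> \<in> {0..1}" using assms Suc.prems by (auto simp: \<rho>_def divide_le_eq_1 binomial_right_mono)
    moreover have "\<bar>\<sigma> - real j / real k\<bar> \<le> real d / real k"
    proof (cases "d \<le> j")
      case True
      then have diff: "real j / real k - \<sigma> = (real d / real k) * (real (k - j) / real (k - d))"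
        using assms Suc.prems by (simp add: \<sigma>_def of_nat_diff field_simps)
      have frac: "real (k - j) / real (k - d) \<in> {0..1}" using True Suc.prems by (auto simp: divide_le_eq_1)
      have "\<bar>(real d / real k) * (real (k - j) / real (k - d))\<bar> \<le> real d / real k"
        unfolding abs_mult using frac mult_left_le[of "real (k - j) / real (k - d)" "real d / real k"] by simp
      with diff show ?thesis by (metis abs_minus_commute)
    next
      case False
      \<comment> \<open>Truncated subtraction makes \<open>\<sigma>\<close> zero here, and
        \<open>j / k\<close> is below \<open>d / k\<close>.\<close>
      then show ?thesis by (simp add: \<sigma>_def divide_right_mono)
    qed
    moreover have "\<bar>\<rho> - (real j / real k) ^ d\<bar> \<le> real (d * d) / real k"
      using Suc by (simp add: \<rho>_def)
    moreover have "real j / real k \<in> {0..1}" using assms by auto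
    moreover have "\<bar>\<rho> * \<sigma> - y ^ d * y\<bar> \<le> \<bar>\<rho> - y ^ d\<bar> + \<bar>\<sigma> - y\<bar>" if "y \<in> {0..1}" "\<rho> \<in> {0..1}" for y
    proof -
      have "\<rho> * \<sigma> - y ^ d * y = (\<rho> - y ^ d) * y + \<rho> * (\<sigma> - y)" by (simp add: algebra_simps)
      also have "\<bar>\<dots>\<bar> \<le> \<bar>\<rho> - y ^ d\<bar> * \<bar>y\<bar> + \<bar>\<rho>\<bar> * \<bar>\<sigma> - y\<bar>"
        by (metis abs_mult abs_triangle_ineq)
      also have "\<dots> \<le> \<bar>\<rho> - y ^ d\<bar> + \<bar>\<sigma> - y\<bar>"
        using that by (intro add_mono) (auto intro: mult_left_le mult_left_le_one_le)
      finally show ?thesis .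
    qed
    ultimately have "\<bar>real (j choose Suc d) / real (k choose Suc d) - (real j / real k) ^ Suc d\<bar>
        \<le> real (d * d) / real k + real d / real k"
      by (smt (verit) power_Suc2)
    also have "\<dots> \<le> real (Suc d * Suc d) / real k"
      by (simp add: field_simps flip: add_divide_distrib) (simp add: divide_right_mono)
    finally show ?case .
  qed simp
qed

lemma linear_functional_0: "linear_functional L \<Longrightarrow> L 0 = 0"
  unfolding linear_functional_def by (metis add_0 add_cancel_right_left)

lemma linear_functional_sum:
  assumes "linear_functional L"
  shows "L (sum f A) = (\<Sum>a\<in>A. L (f a))"
  by (induction A rule: infinite_finite_induct)
     (use assms in \<open>auto simp: linear_functional_0\<close>, auto simp: linear_functional_def)

lemma linear_functional_of_nat:
  assumes "linear_functional L"
  shows "L (of_nat n * f) = real n * L f"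
proof -
  have "L (const_poly (of_nat n) * f) = real n * L f"
    using assms unfolding linear_functional_def by blast
  then show ?thesis by simp
qed

lemma single_eq_prod_var_x:
  "Poly_Mapping.single \<alpha> c = const_poly c * (\<Prod>i\<in>UNIV. var_x (i::'n::finite) ^ Poly_Mapping.lookup \<alpha> i)"
proof -
  have "(\<Prod>i\<in>A. var_x i ^ Poly_Mapping.lookup \<alpha> i) =
      Poly_Mapping.single (\<Sum>i\<in>A. Poly_Mapping.single i (Poly_Mapping.lookup \<alpha> i)) 1" if "finite A" for A
    using that
  proof (induction A rule: finite_induct)
    case (insert i A)
    have "var_x i ^ k = Poly_Mapping.single (Poly_Mapping.single i k) 1" for k
    proof (induction k)
      case (Suc k)
      then show ?case by (simp add: var_x_def mult_single flip: single_add)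
    qed simp
    with insert show ?case by (simp add: mult_single)
  qed simp
  moreover have "(\<Sum>i\<in>UNIV. Poly_Mapping.single i (Poly_Mapping.lookup \<alpha> i)) = \<alpha>"
    by (rule poly_mapping_eqI) (simp add: lookup_sum lookup_single when_def)
  ultimately have "(\<Prod>i\<in>UNIV. var_x i ^ Poly_Mapping.lookup \<alpha> i) = Poly_Mapping.single \<alpha> 1"
    by simp
  then show ?thesis by (simp add: mult_single)
qed

text \<open>Polynomials arise from constants by sums and multiplication by variables. This form lets
  a limit be transferred one variable at a time.\<close>

lemma xpoly_induct [case_names const add var]:
  fixes f :: "'n::finite xpoly"
  assumes const: "\<And>c. P (const_poly c)" and add: "\<And>f g. P f \<Longrightarrow> P g \<Longrightarrow> P (f + g)"
    and var: "\<And>i f. P f \<Longrightarrow> P (var_x i * f)"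
  shows "P f"
proof (induction f rule: poly_mapping_induct_add)
  case (single \<alpha> c)
  have power: "P (var_x i ^ k * f)" if "P f" for f i k
    using that by (induction k) (simp_all add: var mult.assoc)
  have "P ((\<Prod>i\<in>A. var_x i ^ Poly_Mapping.lookup \<alpha> i) * const_poly c)" if "finite A" for A
    using that by (induction A rule: finite_induct) (simp_all add: const power mult.assoc)
  from this[of UNIV] show ?case by (simp add: single_eq_prod_var_x[of \<alpha>] mult.commute)
qed (rule add)

text \<open>The affine coordinate carrying \<open>[-r, r]\<close> onto \<open>[0, 1]\<close>;
  \<open>box_point\<close> is the inverse map on points.\<close>

definition box_var :: "real \<Rightarrow> 'n \<Rightarrow> 'n xpoly" where
  "box_var r i = const_poly (1 / 2) + const_poly (1 / (2 * r)) * var_x i"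

definition box_point :: "real \<Rightarrow> (real ^ 'n::finite) \<Rightarrow> real ^ 'n" where
  "box_point r y = (\<chi> i. r * (2 * y $ i - 1))"

definition grid_point :: "nat \<Rightarrow> ('n \<Rightarrow> nat) \<Rightarrow> real ^ 'n::finite" where
  "grid_point k J = (\<chi> i. real (J i) / real k)"

lemma eval_box_var: "r > 0 \<Longrightarrow> eval_x (box_var r i) (box_point r y) = y $ i"
  by (simp add: box_var_def box_point_def eval_x_add eval_x_mult eval_x_single eval_x_var field_simps)

text \<open>The weights are the values of \<open>L\<close> on tensor products of Bernstein
  polynomials, nonnegative because these are products of powers of \<open>u i\<close> and
  \<open>1 - u i\<close>. On a monomial in the coordinates \<open>u i\<close> the weighted sum
  differs from \<open>L\<close> only by replacing binomial ratios with powers of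
  \<open>J i / k\<close>, an error of order \<open>1 / k\<close>.\<close>

lemma box_positive_discretization:
  fixes L :: "'n::finite xpoly \<Rightarrow> real"
  assumes L: "box_positive (box_var r) L" and r: "r > 0"
  obtains w :: "nat \<Rightarrow> ('n \<Rightarrow> nat) \<Rightarrow> real"
  where "\<And>k J. w k J \<ge> 0" "\<And>k. (\<Sum>J\<in>PiE UNIV (\<lambda>_. {..k}). w k J) = L 1"
    "\<And>f. (\<lambda>k. \<Sum>J\<in>PiE UNIV (\<lambda>_. {..k}). w k J * eval_x f (box_point r (grid_point k J))) \<longlonglongrightarrow> L f"
proof -
  let ?u = "box_var r :: 'n \<Rightarrow> 'n xpoly" and ?I = "\<lambda>k. PiE (UNIV::'n set) (\<lambda>_. {..k::nat})"
  define B where "B k J = (\<Prod>i\<in>UNIV. bernstein_poly k (J i) (?u i))" for k J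
  define w where "w k J = L (B k J)" for k J
  have lin: "linear_functional L" using L by (simp add: box_positive_def)
  have fin: "finite (?I k)" for k by (intro finite_PiE) auto
  have w: "w k J \<ge> 0" for k J
  proof -
    have "B k J = of_nat (\<Prod>i\<in>UNIV. k choose J i) * (\<Prod>i\<in>UNIV. ?u i ^ J i * (1 - ?u i) ^ (k - J i))"
      by (simp add: B_def bernstein_poly_def prod.distrib)
    moreover have "L (\<Prod>i\<in>UNIV. ?u i ^ J i * (1 - ?u i) ^ (k - J i)) \<ge> 0"
      using box_positive_prod[OF L finite_class.finite_UNIV, of J "\<lambda>i. k - J i"]
      unfolding box_positive_def by (metis (no_types, lifting) mult_1_right power_one)
    ultimately show ?thesis unfolding w_def
      by (simp add: linear_functional_of_nat[OF lin] del: of_nat_prod)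
  qed
  \<comment> \<open>An exact formula: the Bernstein identity in each coordinate, multiplied out over
    all coordinates, then \<open>L\<close> applied.\<close>
  have expand: "L (\<Prod>i\<in>UNIV. ?u i ^ d i) =
      (\<Sum>J\<in>?I k. w k J * (\<Prod>i\<in>UNIV. real (J i choose d i) / real (k choose d i)))"
    if "\<And>i. d i \<le> k" for d k
  proof -
    have "(\<Sum>J\<in>?I k. of_nat (\<Prod>i\<in>UNIV. J i choose d i) * B k J) =
        (\<Sum>J\<in>?I k. \<Prod>i\<in>UNIV. of_nat (J i choose d i) * bernstein_poly k (J i) (?u i))"
      by (simp add: B_def prod.distrib)
    also have "\<dots> = (\<Prod>i\<in>UNIV. \<Sum>j\<le>k. of_nat (j choose d i) * bernstein_poly k j (?u i))"
      by (rule prod_sum_PiE[symmetric]) auto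
    also have "\<dots> = of_nat (\<Prod>i\<in>UNIV. k choose d i) * (\<Prod>i\<in>UNIV. ?u i ^ d i)"
      using that by (simp add: sum_choose_bernstein_poly prod.distrib)
    finally have eq: "(\<Sum>J\<in>?I k. of_nat (\<Prod>i\<in>UNIV. J i choose d i) * B k J) =
        of_nat (\<Prod>i\<in>UNIV. k choose d i) * (\<Prod>i\<in>UNIV. ?u i ^ d i)" .
    have "(\<Sum>J\<in>?I k. real (\<Prod>i\<in>UNIV. J i choose d i) * w k J) =
        L (\<Sum>J\<in>?I k. of_nat (\<Prod>i\<in>UNIV. J i choose d i) * B k J)"
      by (simp only: w_def linear_functional_sum[OF lin] linear_functional_of_nat[OF lin])
    also have "\<dots> = real (\<Prod>i\<in>UNIV. k choose d i) * L (\<Prod>i\<in>UNIV. ?u i ^ d i)"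
      unfolding eq by (rule linear_functional_of_nat[OF lin])
    finally have "(\<Sum>J\<in>?I k. real (\<Prod>i\<in>UNIV. J i choose d i) * w k J) =
        real (\<Prod>i\<in>UNIV. k choose d i) * L (\<Prod>i\<in>UNIV. ?u i ^ d i)" .
    moreover have "real (\<Prod>i\<in>UNIV. k choose d i) \<noteq> 0" using that by (simp add: not_less)
    ultimately have "L (\<Prod>i\<in>UNIV. ?u i ^ d i) =
        (\<Sum>J\<in>?I k. real (\<Prod>i\<in>UNIV. J i choose d i) * w k J) / real (\<Prod>i\<in>UNIV. k choose d i)"
      by (simp add: field_simps)
    then show ?thesis
      by (simp add: sum_divide_distrib prod_dividef mult.commute)
  qed
  have total: "(\<Sum>J\<in>?I k. w k J) = L 1" for k
    using expand[of "\<lambda>_. 0" k] by simp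
  let ?\<Phi> = "\<lambda>f k. \<Sum>J\<in>?I k. w k J * eval_x f (box_point r (grid_point k J))"
  have lim_monom: "?\<Phi> (\<Prod>i\<in>UNIV. ?u i ^ d i) \<longlonglongrightarrow> L (\<Prod>i\<in>UNIV. ?u i ^ d i)" for d
  proof -
    define D where "D = Max (range d)"
    have D: "d i \<le> D" for i by (simp add: D_def)
    have bound: "\<bar>?\<Phi> (\<Prod>i\<in>UNIV. ?u i ^ d i) k - L (\<Prod>i\<in>UNIV. ?u i ^ d i)\<bar>
        \<le> L 1 * (\<Sum>i\<in>UNIV. real (d i * d i)) * inverse (real k)" if k: "k \<ge> D" "k > 0" for k
    proof -
      have dk: "d i \<le> k" for i using D[of i] k by simp
      let ?e = "\<lambda>J. (\<Prod>i\<in>UNIV. (real (J i) / real k) ^ d i)"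
      let ?c = "\<lambda>J. (\<Prod>i\<in>UNIV. real (J i choose d i) / real (k choose d i))"
      have eval: "eval_x (\<Prod>i\<in>A. ?u i ^ d i) (box_point r (grid_point k J)) =
          (\<Prod>i\<in>A. (real (J i) / real k) ^ d i)" for J A
        by (induction A rule: infinite_finite_induct)
           (simp_all add: eval_x_mult eval_x_power eval_box_var[OF r] grid_point_def)
      have diff: "?\<Phi> (\<Prod>i\<in>UNIV. ?u i ^ d i) k - L (\<Prod>i\<in>UNIV. ?u i ^ d i) = (\<Sum>J\<in>?I k. w k J * (?e J - ?c J))"
      proof -
        have "L (\<Prod>i\<in>UNIV. ?u i ^ d i) = (\<Sum>J\<in>?I k. w k J * ?c J)"
          by (rule expand) (rule dk)
        moreover have "?\<Phi> (\<Prod>i\<in>UNIV. ?u i ^ d i) k = (\<Sum>J\<in>?I k. w k J * ?e J)"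
          by (rule sum.cong[OF refl]) (simp only: eval)
        ultimately show ?thesis by (simp only: sum_subtractf right_diff_distrib)
      qed
      have "\<bar>\<Sum>J\<in>?I k. w k J * (?e J - ?c J)\<bar> \<le> (\<Sum>J\<in>?I k. w k J * \<bar>?e J - ?c J\<bar>)"
        by (rule order_trans[OF sum_abs]) (simp add: abs_mult w)
      also have "\<dots> \<le> (\<Sum>J\<in>?I k. w k J * ((\<Sum>i\<in>UNIV. real (d i * d i)) * inverse (real k)))"
      proof (intro sum_mono mult_left_mono w)
        fix J assume "J \<in> ?I k"
        then have J: "J i \<le> k" for i by (auto simp: PiE_def Pi_def)
        have "norm (?e J - ?c J) \<le> (\<Sum>i\<in>UNIV. norm ((real (J i) / real k) ^ d i - real (J i choose d i) / real (k choose d i)))"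
          using choose_ratio_approx(2)[OF J dk] k(2) J
          by (intro norm_prod_diff) (auto simp: norm_power intro!: power_le_one)
        also have "\<dots> \<le> (\<Sum>i\<in>UNIV. real (d i * d i) / real k)"
          using choose_ratio_approx(1)[OF J dk k(2)] by (intro sum_mono) (simp add: abs_minus_commute)
        finally show "\<bar>?e J - ?c J\<bar> \<le> (\<Sum>i\<in>UNIV. real (d i * d i)) * inverse (real k)"
          by (simp add: sum_divide_distrib divide_inverse sum_distrib_right)
      qed
      also have "\<dots> = L 1 * (\<Sum>i\<in>UNIV. real (d i * d i)) * inverse (real k)"
        by (simp add: total flip: sum_distrib_right)
      finally show ?thesis unfolding diff .
    qed
    have ev: "\<forall>\<^sub>F k in sequentially. norm (?\<Phi> (\<Prod>i\<in>UNIV. ?u i ^ d i) k - L (\<Prod>i\<in>UNIV. ?u i ^ d i))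
        \<le> L 1 * (\<Sum>i\<in>UNIV. real (d i * d i)) * inverse (real k)"
      using eventually_gt_at_top[of 0] eventually_ge_at_top[of D]
      by eventually_elim (simp only: real_norm_def bound)
    have "(\<lambda>k. L 1 * (\<Sum>i\<in>UNIV. real (d i * d i)) * inverse (real k)) \<longlonglongrightarrow> 0"
      by (intro tendsto_mult_right_zero lim_inverse_n)
    from LIM_zero_cancel[OF Lim_null_comparison[OF ev this]] show ?thesis .
  qed
  \<comment> \<open>An arbitrary monomial in the \<open>u i\<close> is carried along as cofactor.
    Since \<open>var_x j\<close> equals \<open>2 * r * u j - r\<close>, a new variable is absorbed
    by raising the exponent \<open>d j\<close>.\<close>
  have step: "?\<Phi> (f * (\<Prod>i\<in>UNIV. ?u i ^ d i)) \<longlonglongrightarrow> L (f * (\<Prod>i\<in>UNIV. ?u i ^ d i))" for f d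
  proof (induction f arbitrary: d rule: xpoly_induct)
    case (const c)
    have "?\<Phi> (const_poly c * f) = (\<lambda>k. c * ?\<Phi> f k)" for f
      by (simp add: eval_x_mult eval_x_single sum_distrib_left mult_ac)
    then show ?case
      using tendsto_mult_left[OF lim_monom[of d], of c] lin by (simp add: linear_functional_def)
  next
    case (add f g)
    have "?\<Phi> (p + q) = (\<lambda>k. ?\<Phi> p k + ?\<Phi> q k)" for p q
      by (simp add: eval_x_add sum.distrib distrib_left)
    then show ?case
      using tendsto_add[OF add.IH[of d]] lin by (simp add: linear_functional_def distrib_right)
  next
    case (var j f)
    let ?M = "\<Prod>i\<in>UNIV. ?u i ^ d i" and ?M' = "\<Prod>i\<in>UNIV. ?u i ^ (d(j := Suc (d j))) i"
    have M': "?M' = ?u j * ?M"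
      by (simp add: prod.remove[of UNIV j] mult.assoc)
    have x: "var_x j = const_poly (2 * r) * ?u j + const_poly (- r)"
    proof -
      have "const_poly (2 * r) * (const_poly (1 / (2 * r)) * var_x j) = var_x j"
        using r by (simp add: mult_single flip: mult.assoc)
      moreover have "const_poly (2 * r) * const_poly (1 / 2) + const_poly (- r) = (0 :: 'n xpoly)"
        by (simp add: mult_single flip: single_add)
      ultimately show ?thesis unfolding box_var_def by (simp add: distrib_left algebra_simps)
    qed
    have eq: "var_x j * f * ?M = const_poly (2 * r) * (f * ?M') + const_poly (- r) * (f * ?M)"
      unfolding M' by (subst x) (simp only: algebra_simps)
    have "?\<Phi> (var_x j * f * ?M) = (\<lambda>k. 2 * r * ?\<Phi> (f * ?M') k + (- r) * ?\<Phi> (f * ?M) k)"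
      unfolding eq
      by (simp only: eval_x_add eval_x_mult[of "const_poly _"] eval_x_single monom_at_0 sum.distrib
          sum_distrib_left mult_1_right) (simp add: algebra_simps sum.distrib sum_subtractf sum_negf)
    moreover have "L (var_x j * f * ?M) = 2 * r * L (f * ?M') + (- r) * L (f * ?M)"
      unfolding eq using lin by (simp add: linear_functional_def)
    ultimately show ?case
      using tendsto_add[OF tendsto_mult_left[OF var.IH[of "d(j := Suc (d j))"], of "2 * r"]
          tendsto_mult_left[OF var.IH[of d], of "- r"]] by simp
  qed
  show thesis
  proof (rule that)
    show "w k J \<ge> 0" for k J by (rule w)
    show "(\<Sum>J\<in>?I k. w k J) = L 1" for k by (rule total)
    show "?\<Phi> f \<longlonglongrightarrow> L f" for f using step[of f "\<lambda>_. 0"] by simp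
  qed
qed

subsection \<open>A space-filling curve\<close>

lemma binary_expansion:
  fixes y :: real
  assumes "y \<in> {0..1}"
  shows "\<exists>b::nat \<Rightarrow> nat. (\<forall>k. b k \<le> 1) \<and> (\<lambda>k. real (b k) * (1 / 2) ^ Suc k) sums y"
proof (cases "y = 1")
  case True
  have "(\<lambda>k. real 1 * (1 / 2) ^ Suc k) sums (1::real)" using power_half_series by simp
  with True show ?thesis by (intro exI[of _ "\<lambda>_. 1"]) simp
next
  case False
  \<comment> \<open>The digits are increments of the dyadic floors. At \<open>y = 1\<close> they
    would all be 0, which is why that point received the expansion with all digits 1.\<close>
  define c where "c k = \<lfloor>2 ^ k * y\<rfloor>" for k
  define b where "b k = nat (c (Suc k) - 2 * c k)" for k
  have c: "c (Suc k) - 2 * c k \<in> {0..1}" for k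
  proof -
    have "real_of_int (c k) \<le> 2 ^ k * y" "2 ^ k * y < real_of_int (c k) + 1"
      "real_of_int (c (Suc k)) \<le> 2 * (2 ^ k * y)" "2 * (2 ^ k * y) < real_of_int (c (Suc k)) + 1"
      unfolding c_def by (simp_all add: mult.assoc)
    then show ?thesis unfolding atLeastAtMost_iff by linarith
  qed
  then have b: "b k \<le> 1" "real (b k) = c (Suc k) - 2 * c k" for k
    using c[of k] unfolding b_def atLeastAtMost_iff by linarith+
  have "c 0 = 0" using assms False by (simp add: c_def floor_eq_iff)
  have partial: "(\<Sum>k<n. real (b k) * (1 / 2) ^ Suc k) = c n * (1 / 2) ^ n" for n
    by (induction n) (simp_all add: \<open>c 0 = 0\<close> b algebra_simps)
  have "\<bar>c n * (1 / 2) ^ n - y\<bar> \<le> (1 / 2) ^ n" for n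
  proof -
    have "\<bar>c n - 2 ^ n * y\<bar> \<le> 1" unfolding c_def by linarith
    moreover have "c n * (1 / 2) ^ n - y = (c n - 2 ^ n * y) * (1 / 2) ^ n"
      by (simp add: algebra_simps flip: power_mult_distrib)
    ultimately show ?thesis using mult_right_mono[of "\<bar>c n - 2 ^ n * y\<bar>" 1 "(1 / 2) ^ n"] by (simp add: abs_mult)
  qed
  then have "(\<lambda>n. c n * (1 / 2) ^ n - y) \<longlonglongrightarrow> 0"
    by (intro Lim_null_comparison[OF always_eventually LIMSEQ_realpow_zero[of "1 / 2"]]) auto
  then have "(\<lambda>k. real (b k) * (1 / 2) ^ Suc k) sums y"
    unfolding sums_def partial by (rule LIM_zero_cancel)
  with b(1) show ?thesis by blast
qed

text \<open>Schoenberg's curve: at a point of the Cantor set, the halved base-3 digits of \<open>t\<close>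
  are the interleaved binary digits of the coordinates.\<close>

lemma space_filling_curve:
  obtains \<phi> :: "real \<Rightarrow> real ^ 'n::finite"
  where "continuous_on UNIV \<phi>" "\<And>t i. \<phi> t $ i \<in> {0..1}"
    "\<And>y. \<forall>i. y $ i \<in> {0..1} \<Longrightarrow> \<exists>t\<in>{0..1}. \<phi> t = y"
proof -
  \<comment> \<open>The clamped cosine has period 2, equals 0 on \<open>[0, 1/3]\<close> and 1 on
    \<open>[2/3, 1]\<close>: on Cantor points it reads the first ternary digit, halved.\<close>
  define p :: "real \<Rightarrow> real" where "p t = max 0 (min 1 (1 / 2 - cos (pi * t)))" for t
  have p_range: "p t \<in> {0..1}" for t by (simp add: p_def)
  have p_cont: "continuous_on UNIV p" unfolding p_def by (intro continuous_intros)
  have p_digit: "p t = real b" if "t = 2 * of_int m + 2 * real b / 3 + s" "b \<le> 1" "s \<in> {0..1/3}" for t m b s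
  proof -
    have "cos (pi * t) = cos (pi * (2 * real b / 3 + s) + 2 * of_int m * pi)"
      by (rule arg_cong[where f = cos]) (simp add: that(1) algebra_simps)
    also have "\<dots> = cos (pi * (2 * real b / 3 + s))"
      using cos_int_2pin[of m] sin_int_2pin[of m] by (simp add: cos_add mult_ac)
    finally have cos_t: "cos (pi * t) = cos (pi * (2 * real b / 3 + s))" .
    from that(2) consider "b = 0" | "b = 1" by force
    then show ?thesis
    proof cases
      case 1
      have "cos (pi / 3) \<le> cos (pi * s)" using that(3) by (intro cos_monotone_0_pi_le) auto
      then show ?thesis using 1 cos_t by (simp add: p_def cos_60)
    next
      case 2
      have "cos (pi * (2 / 3 + s)) \<le> cos (pi * (2 / 3))"
        using that(3) by (intro cos_monotone_0_pi_le) auto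
      also have "cos (pi * (2 / 3)) = - (1 / 2)" using cos_120 by (simp add: mult.commute)
      finally show ?thesis using 2 cos_t by (simp add: p_def)
    qed
  qed
  obtain e :: "'n \<Rightarrow> nat" where e: "bij_betw e UNIV {0..<CARD('n)}"
    using ex_bij_betw_finite_nat[OF finite_class.finite_UNIV] by blast
  define N where "N = CARD('n)"
  have N: "e i < N" for i using e unfolding N_def bij_betw_def by auto
  \<comment> \<open>Coordinate \<open>i\<close> owns the digit positions \<open>N * k + e i\<close>;
    multiplying by that power of 3 brings the digit to the front, where \<open>p\<close> can read
    it.\<close>
  define f where "f i k t = (1 / 2) ^ Suc k * p (3 ^ (N * k + e i) * t)" for i k t
  have f_bound: "norm (f i k t) \<le> (1 / 2) ^ Suc k" for i k t
    using p_range[of "3 ^ (N * k + e i) * t"] by (simp add: f_def)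
  have geo: "summable (\<lambda>k. (1 / 2 :: real) ^ Suc k)" using power_half_series sums_summable by blast
  have f_summable: "summable (\<lambda>k. f i k t)" for i t
    by (rule summable_comparison_test'[OF geo f_bound])
  define \<phi> :: "real \<Rightarrow> real ^ 'n" where "\<phi> t = (\<chi> i. suminf (\<lambda>k. f i k t))" for t
  have "continuous_on UNIV (\<lambda>t. suminf (\<lambda>k. f i k t))" for i
  proof (rule uniform_limit_theorem)
    show "uniform_limit UNIV (\<lambda>n t. \<Sum>k<n. f i k t) (\<lambda>t. suminf (\<lambda>k. f i k t)) sequentially"
      using f_bound geo by (intro Weierstrass_m_test)
    have "continuous_on UNIV (f i k)" for k
      unfolding f_def by (intro continuous_intros continuous_on_compose2[OF p_cont]) auto
    then show "\<forall>\<^sub>F n in sequentially. continuous_on UNIV (\<lambda>t. \<Sum>k<n. f i k t)"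
      by (intro always_eventually allI continuous_on_sum)
  qed simp
  then have "continuous_on UNIV \<phi>" unfolding \<phi>_def by (intro continuous_on_vec_lambda)
  moreover have "\<phi> t $ i \<in> {0..1}" for t i
  proof -
    have "f i k t \<ge> 0" for k using p_range[of "3 ^ (N * k + e i) * t"] by (simp add: f_def)
    moreover from this have "f i k t \<le> (1 / 2) ^ Suc k" for k
      using f_bound[of i k t] by simp
    then have "suminf (\<lambda>k. f i k t) \<le> suminf (\<lambda>k. (1 / 2) ^ Suc k)"
      by (intro suminf_le f_summable geo)
    ultimately show ?thesis
      using f_summable power_half_series by (auto simp: \<phi>_def suminf_nonneg sums_iff)
  qed
  moreover have "\<exists>t\<in>{0..1}. \<phi> t = y" if y: "\<forall>i. y $ i \<in> {0..1}" for y
  proof -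
    have "\<forall>i. \<exists>b. (\<forall>k. b k \<le> (1::nat)) \<and> (\<lambda>k. real (b k) * (1 / 2) ^ Suc k) sums (y $ i)"
      using binary_expansion[OF y[rule_format]] by blast
    from choice[OF this] obtain b where
      b: "\<And>i k. b i k \<le> (1::nat)" and b_sums: "\<And>i. (\<lambda>k. real (b i k) * (1 / 2) ^ Suc k) sums (y $ i)"
      by blast
    \<comment> \<open>The interleaved digit sequence: the remainder modulo \<open>N\<close> selects
      the coordinate, the quotient the position within it.\<close>
    define B where "B m = b (inv e (m mod N)) (m div N)" for m
    have B: "B (N * k + e i) = b i k" for k i
      using N[of i] e by (simp add: B_def bij_betw_def)
    have B_le: "B m \<le> 1" for m using b by (simp add: B_def)
    define d where "d m = 2 * real (B m) * (1 / 3) ^ Suc m" for m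
    have third: "(\<lambda>m. 2 * (1 / 3 :: real) ^ Suc m) sums 1"
      using sums_mult[OF geometric_sums[of "1 / 3 :: real"], of "2 / 3"] by simp
    have d_nonneg: "d m \<ge> 0" for m by (simp add: d_def)
    have d_le: "d m \<le> 2 * (1 / 3) ^ Suc m" for m
      using B_le[of m] by (simp add: d_def)
    have d_summable: "summable d"
      by (rule summable_comparison_test'[OF sums_summable[OF third]]) (use d_le d_nonneg in auto)
    have tail: "suminf (\<lambda>m. d (m + n)) \<in> {0..(1/3) ^ n}" for n
    proof -
      have "suminf (\<lambda>m. d (m + n)) \<le> suminf (\<lambda>m. 2 * (1 / 3) ^ Suc m * (1 / 3) ^ n)"
        using d_summable sums_summable[OF third] d_le[of "_ + n"]
        by (intro suminf_le summable_mult2) (auto simp: summable_iff_shift power_add mult_ac)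
      also have "\<dots> = (1 / 3) ^ n" using sums_mult2[OF third, of "(1 / 3) ^ n"] by (simp add: sums_iff)
      finally show ?thesis using d_summable d_nonneg by (simp add: suminf_nonneg summable_iff_shift)
    qed
    define t where "t = suminf (\<lambda>m. d m)"
    have "p (3 ^ n * t) = real (B n)" for n
    proof -
      \<comment> \<open>As the ternary digits are 0 or 2, the part in front of the ternary point is
        an even integer and is ignored by the period 2 of \<open>p\<close>.\<close>
      have int: "\<exists>m::int. 3 ^ n * (\<Sum>k<n. d k) = 2 * of_int m" for n
      proof (induction n)
        case (Suc n)
        then obtain m :: int where m: "3 ^ n * (\<Sum>k<n. d k) = 2 * of_int m" by blast
        have "3 ^ Suc n * (\<Sum>k<Suc n. d k) = 3 * (3 ^ n * (\<Sum>k<n. d k)) + 2 * real (B n)"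
          by (simp add: d_def algebra_simps flip: power_mult_distrib)
        also have "\<dots> = 2 * of_int (3 * m + int (B n))" by (simp add: m)
        finally show ?case by blast
      qed auto
      then obtain m :: int where m: "3 ^ n * (\<Sum>k<n. d k) = 2 * of_int m" by blast
      have "t = (\<Sum>k<n. d k) + d n + suminf (\<lambda>m. d (m + Suc n))"
        unfolding t_def by (subst suminf_split_initial_segment[OF d_summable, of "Suc n"]) simp
      then have t: "3 ^ n * t = 2 * of_int m + 2 * real (B n) / 3 + 3 ^ n * suminf (\<lambda>m. d (m + Suc n))"
        using m by (simp add: d_def distrib_left flip: power_mult_distrib)
      have "3 ^ n * suminf (\<lambda>m. d (m + Suc n)) \<le> 3 ^ n * (1 / 3) ^ Suc n"
        using tail[of "Suc n"] by (intro mult_left_mono) auto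
      also have "\<dots> = 1 / 3" by (simp flip: power_mult_distrib)
      finally have "3 ^ n * suminf (\<lambda>m. d (m + Suc n)) \<in> {0..1/3}" using tail[of "Suc n"] by simp
      with t B_le show ?thesis by (rule p_digit)
    qed
    then have "f i k t = real (b i k) * (1 / 2) ^ Suc k" for i k
      by (simp add: f_def B)
    with b_sums have "(\<lambda>k. f i k t) sums (y $ i)" for i by (simp only:)
    then have "\<phi> t = y"
      by (simp add: \<phi>_def vec_eq_iff sums_unique[symmetric])
    moreover have "t \<in> {0..1}" using tail[of 0] by (simp add: t_def)
    ultimately show ?thesis by blast
  qed
  ultimately show thesis by (rule that)
qed

subsection \<open>Representing measures on a box\<close>

lemma continuous_on_monom_at: "continuous_on S (\<lambda>x. monom_at x \<alpha>)"
  unfolding monom_at_def by (intro continuous_intros)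

lemma continuous_on_eval_x: "continuous_on S (\<lambda>x. eval_x f x)"
  unfolding eval_x_def by (intro continuous_intros continuous_on_monom_at)

lemma borel_measurable_eval_x [measurable]: "eval_x f \<in> borel_measurable borel"
  by (intro borel_measurable_continuous_onI continuous_on_eval_x)

text \<open>All image measures under \<open>\<theta>\<close> live on the unit interval, hence are
  tight, and Helly's selection theorem yields a weakly convergent subsequence.\<close>

lemma discrete_measures_convergent_subseq:
  fixes A :: "nat \<Rightarrow> 'a set" and w :: "nat \<Rightarrow> 'a \<Rightarrow> real" and \<theta> :: "nat \<Rightarrow> 'a \<Rightarrow> real"
  assumes fin: "\<And>k. finite (A k)" and nonneg: "\<And>k a. a \<in> A k \<Longrightarrow> w k a \<ge> 0"
    and total: "\<And>k. (\<Sum>a\<in>A k. w k a) = 1" and range: "\<And>k a. a \<in> A k \<Longrightarrow> \<theta> k a \<in> {0..1}"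
  obtains M :: "real measure" and r :: "nat \<Rightarrow> nat" where "strict_mono r" "real_distribution M"
    "\<And>f :: real \<Rightarrow> real. continuous_on UNIV f \<Longrightarrow> bounded (range f) \<Longrightarrow>
       (\<lambda>k. \<Sum>a\<in>A (r k). w (r k) a * f (\<theta> (r k) a)) \<longlonglongrightarrow> (LINT t|M. f t)"
proof -
  define P where "P k = point_measure (A k) (w k)" for k
  define m where "m k = distr (P k) borel (\<theta> k)" for k
  have \<theta>_meas: "\<theta> k \<in> borel_measurable (P k)" for k by (simp add: P_def)
  have prob: "prob_space (P k)" for k
    by (rule prob_spaceI)
       (simp add: P_def space_point_measure emeasure_point_measure_finite fin sum_ennreal nonneg total)
  have dist: "real_distribution (m k)" for k
    unfolding m_def using prob \<theta>_meas by (rule prob_space.real_distribution_distr)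
  have "tight m"
    unfolding tight_def
  proof (intro conjI allI impI dist)
    fix \<epsilon> :: real assume "\<epsilon> > 0"
    \<comment> \<open>Tightness is phrased with intervals open on the left, so the left end is moved
      to -1 in order to include 0.\<close>
    have "measure (m k) {-1<..1} = 1" for k
    proof -
      interpret prob_space "P k" by (rule prob)
      have "\<theta> k -` {-1<..1} \<inter> space (P k) = space (P k)"
        using range by (force simp: P_def space_point_measure)
      then show ?thesis unfolding m_def by (subst measure_distr[OF \<theta>_meas]) (auto simp: prob_space)
    qed
    with \<open>\<epsilon> > 0\<close> show "\<exists>a b. a < b \<and> (\<forall>k. 1 - \<epsilon> < measure (m k) {a<..b})"
      by (intro exI[of _ "-1"] exI[of _ 1]) auto
  qed
  from tight_imp_convergent_subsubsequence[OF this strict_mono_id]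
  obtain r M where r: "strict_mono (r :: nat \<Rightarrow> nat)" and M: "real_distribution M"
    and conv: "weak_conv_m (m \<circ> id \<circ> r) M" by blast
  have "(\<lambda>k. \<Sum>a\<in>A (r k). w (r k) a * f (\<theta> (r k) a)) \<longlonglongrightarrow> (LINT t|M. f t)"
    if cont: "continuous_on UNIV f" and bdd: "bounded (range f)" for f :: "real \<Rightarrow> real"
  proof -
    have [measurable]: "f \<in> borel_measurable borel" using cont by (rule borel_measurable_continuous_onI)
    have int: "(LINT t|m k. f t) = (\<Sum>a\<in>A k. w k a * f (\<theta> k a))" for k
      unfolding m_def by (subst integral_distr[OF \<theta>_meas])
        (simp_all add: P_def lebesgue_integral_point_measure_finite fin nonneg)
    obtain B where B: "norm (f x) \<le> B" for x using bdd by (auto simp: bounded_iff)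
    have "isCont f x" for x using cont by (simp add: continuous_on_eq_continuous_at)
    from weak_conv_imp_integral_bdd_continuous_conv[OF _ M conv this B]
    show ?thesis using dist by (simp add: int)
  qed
  with r M show thesis by (rule that)
qed

text \<open>Grid points are replaced by parameters on the curve, reducing compactness of measures on
  the box to the real line. The weights are normalized by the mass \<open>L 1\<close>, which is
  restored as a constant density at the end. If \<open>L 1 = 0\<close>, all weights vanish and
  \<open>L\<close> is zero.\<close>

theorem box_moment_problem:
  fixes L :: "'n::finite xpoly \<Rightarrow> real"
  assumes L: "box_positive (box_var r) L" and r: "r > 0"
  obtains \<mu> :: "(real ^ 'n) measure" where "finite_measure \<mu>" "sets \<mu> = sets borel"
    "AE x in \<mu>. \<forall>i. \<bar>x $ i\<bar> \<le> r" "\<And>f. integrable \<mu> (eval_x f)" "\<And>f. L f = (LINT x|\<mu>. eval_x f x)"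
proof -
  let ?I = "\<lambda>k::nat. PiE (UNIV::'n set) (\<lambda>_. {..k})"
  obtain w :: "nat \<Rightarrow> ('n \<Rightarrow> nat) \<Rightarrow> real" where w: "\<And>k J. w k J \<ge> 0"
    and total: "\<And>k. (\<Sum>J\<in>?I k. w k J) = L 1"
    and lim: "\<And>f. (\<lambda>k. \<Sum>J\<in>?I k. w k J * eval_x f (box_point r (grid_point k J))) \<longlonglongrightarrow> L f"
    by (rule box_positive_discretization[OF L r]) (rule that)
  have fin: "finite (?I k)" for k by (intro finite_PiE) auto
  show thesis
  proof (cases "L 1 = 0")
    case True
    have "L f = 0" for f
    proof -
      have "w k J = 0" if "J \<in> ?I k" for k J
        using total[of k] True w that fin sum_nonneg_eq_0_iff[of "?I k" "w k"] by auto
      with lim[of f] show ?thesis by (simp add: LIMSEQ_const_iff)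
    qed
    then show thesis
      by (intro that[of "null_measure borel"])
         (auto intro!: finite_measureI integrableI_bounded AE_I[where N = UNIV])
  next
    case False
    have "(\<Sum>J\<in>?I 0. w 0 J) \<ge> 0" by (intro sum_nonneg w)
    with False have pos: "L 1 > 0" unfolding total by linarith
    obtain \<phi> :: "real \<Rightarrow> real ^ 'n" where \<phi>_cont: "continuous_on UNIV \<phi>"
      and \<phi>_range: "\<And>t i. \<phi> t $ i \<in> {0..1}"
      and \<phi>_surj: "\<And>y. \<forall>i. y $ i \<in> {0..1} \<Longrightarrow> \<exists>t\<in>{0..1}. \<phi> t = y"
      by (rule space_filling_curve) (rule that)
    have "\<exists>t. J \<in> ?I k \<longrightarrow> t \<in> {0..1} \<and> \<phi> t = grid_point k J" for k J
    proof (cases "J \<in> ?I k")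
      case True
      then have "\<forall>i. grid_point k J $ i \<in> {0..1}"
        by (auto simp: grid_point_def PiE_def Pi_def divide_le_eq_1)
      from \<phi>_surj[OF this] show ?thesis by blast
    qed simp
    then have "\<forall>k. \<forall>J. \<exists>t. J \<in> ?I k \<longrightarrow> t \<in> {0..1} \<and> \<phi> t = grid_point k J" by blast
    then obtain \<theta> where "\<forall>k J. J \<in> ?I k \<longrightarrow> \<theta> k J \<in> {0..1} \<and> \<phi> (\<theta> k J) = grid_point k J"
      unfolding choice_iff by blast
    then have \<theta>: "\<And>k J. J \<in> ?I k \<Longrightarrow> \<theta> k J \<in> {0..1} \<and> \<phi> (\<theta> k J) = grid_point k J" by blast
    define \<psi> where "\<psi> t = box_point r (\<phi> t)" for t
    have \<psi>_cont: "continuous_on UNIV \<psi>"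
      unfolding \<psi>_def box_point_def by (intro continuous_intros \<phi>_cont)
    have \<psi>_range: "\<bar>\<psi> t $ i\<bar> \<le> r" for t i
      using r \<phi>_range[of t i] by (auto simp: \<psi>_def box_point_def abs_mult intro!: mult_left_le)
    have nonneg: "w k J / L 1 \<ge> 0" for k J using w pos by simp
    have total': "(\<Sum>J\<in>?I k. w k J / L 1) = 1" for k
      using total pos by (simp flip: sum_divide_distrib)
    obtain M s where s: "strict_mono (s :: nat \<Rightarrow> nat)" and M: "real_distribution M"
      and conv: "\<And>f :: real \<Rightarrow> real. continuous_on UNIV f \<Longrightarrow> bounded (range f) \<Longrightarrow>
        (\<lambda>k. \<Sum>J\<in>?I (s k). w (s k) J / L 1 * f (\<theta> (s k) J)) \<longlonglongrightarrow> (LINT t|M. f t)"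
      by (rule discrete_measures_convergent_subseq[OF fin nonneg total']) (use \<theta> in blast, rule that)
    interpret M: real_distribution M by fact
    have \<psi>_meas [measurable]: "\<psi> \<in> borel_measurable M"
      using borel_measurable_continuous_onI[OF \<psi>_cont] by simp
    have bounded: "bounded (range (\<lambda>t. eval_x f (\<psi> t)))" for f
    proof (rule bounded_subset)
      have "compact {x::real^'n. \<forall>i. \<bar>x $ i\<bar> \<le> r}"
      proof -
        have "{x::real^'n. \<forall>i. \<bar>x $ i\<bar> \<le> r} = cbox (\<chi> i. - r) (\<chi> i. r)"
          by (simp add: set_eq_iff mem_box_cart abs_le_iff minus_le_iff conj_commute)
        then show ?thesis by simp
      qed
      then show "bounded (eval_x f ` {x. \<forall>i. \<bar>x $ i\<bar> \<le> r})"
        by (intro compact_imp_bounded compact_continuous_image continuous_on_eval_x)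
      show "range (\<lambda>t. eval_x f (\<psi> t)) \<subseteq> eval_x f ` {x. \<forall>i. \<bar>x $ i\<bar> \<le> r}"
        using \<psi>_range by auto
    qed
    have integral: "(LINT t|M. eval_x f (\<psi> t)) = L f / L 1" for f
    proof (rule LIMSEQ_unique)
      have "continuous_on UNIV (\<lambda>t. eval_x f (\<psi> t))"
        by (rule continuous_on_compose2[OF continuous_on_eval_x[of UNIV] \<psi>_cont]) auto
      from conv[OF this bounded]
      show "(\<lambda>k. \<Sum>J\<in>?I (s k). w (s k) J / L 1 * eval_x f (\<psi> (\<theta> (s k) J))) \<longlonglongrightarrow> (LINT t|M. eval_x f (\<psi> t))" .
      have "(\<Sum>J\<in>?I k. w k J / L 1 * eval_x f (\<psi> (\<theta> k J))) =
          (\<Sum>J\<in>?I k. w k J * eval_x f (box_point r (grid_point k J))) / L 1" for k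
        unfolding sum_divide_distrib by (intro sum.cong refl) (simp add: \<psi>_def \<theta>)
      with LIMSEQ_subseq_LIMSEQ[OF tendsto_divide[OF lim[of f] tendsto_const[of "L 1"]] s] False
      show "(\<lambda>k. \<Sum>J\<in>?I (s k). w (s k) J / L 1 * eval_x f (\<psi> (\<theta> (s k) J))) \<longlonglongrightarrow> L f / L 1"
        by (simp add: o_def)
    qed
    have int_\<psi>: "integrable M (\<lambda>t. eval_x f (\<psi> t))" for f
    proof -
      obtain B where "norm (eval_x f (\<psi> t)) \<le> B" for t using bounded[of f] by (auto simp: bounded_iff)
      then show ?thesis by (intro M.integrable_const_bound[of _ B]) auto
    qed
    define \<mu> where "\<mu> = density (distr M borel \<psi>) (\<lambda>_. ennreal (L 1))"
    show thesis
    proof (rule that)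
      show "sets \<mu> = sets borel" by (simp add: \<mu>_def)
      show "finite_measure \<mu>"
      proof
        have "emeasure \<mu> (space \<mu>) = ennreal (L 1) * emeasure (distr M borel \<psi>) UNIV"
          unfolding \<mu>_def by (simp add: emeasure_density_const)
        also have "emeasure (distr M borel \<psi>) UNIV = 1"
          using prob_space.emeasure_space_1[OF M.prob_space_distr[OF \<psi>_meas]] by simp
        finally show "emeasure \<mu> (space \<mu>) \<noteq> \<infinity>" by simp
      qed
      have "AE x in distr M borel \<psi>. \<forall>i. \<bar>x $ i\<bar> \<le> r"
        by (subst AE_distr_iff[OF \<psi>_meas]) (use \<psi>_range in auto)
      then show "AE x in \<mu>. \<forall>i. \<bar>x $ i\<bar> \<le> r"
        unfolding \<mu>_def by (subst AE_density) auto
      show "integrable \<mu> (eval_x f)" for f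
        unfolding \<mu>_def using pos int_\<psi>[of f]
        by (subst integrable_density) (simp_all add: integrable_distr_eq[OF \<psi>_meas])
      show "L f = (LINT x|\<mu>. eval_x f x)" for f
        unfolding \<mu>_def using pos integral[of f]
        by (subst integral_density) (simp_all add: integral_distr[OF \<psi>_meas])
    qed
  qed
qed

subsection \<open>Carleman's inequality and quasi-analyticity\<close>

text \<open>The weights \<open>k + 1\<close> in the arithmetic-geometric mean inequality bound the
  geometric mean of \<open>n\<close> terms by a multiple of \<open>S n\<close> over the square of
  \<open>n\<close>. Bounding the reciprocal square by twice \<open>1 / n - 1 / (n + 1)\<close>,
  summation by parts returns the partial sum of \<open>a\<close> minus a nonnegative term.\<close>

lemma Carleman_inequality_summable:
  fixes a :: "nat \<Rightarrow> real"
  assumes nonneg: "\<And>k. a k \<ge> 0" and sum: "summable a"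
  shows "summable (\<lambda>d. (\<Prod>k<Suc d. a k) powr (1 / real (Suc d)))"
proof -
  define S where "S n = (\<Sum>k<n. real (Suc k) * a k)" for n
  have S_nonneg: "S n \<ge> 0" for n by (auto simp: S_def intro!: sum_nonneg mult_nonneg_nonneg nonneg)
  have abel: "(\<Sum>n<N. S (Suc n) * (1 / real (Suc n) - 1 / real (Suc (Suc n)))) = (\<Sum>k<N. a k) - S N / real (Suc N)" for N
  proof (induction N)
    case (Suc N)
    have "S (Suc N) / real (Suc N) = S N / real (Suc N) + a N"
      by (simp add: S_def add_divide_distrib)
    with Suc show ?case by (simp add: right_diff_distrib del: of_nat_Suc)
  qed (simp add: S_def)
  have summand: "(\<Prod>k<Suc d. a k) powr (1 / real (Suc d)) \<le>
      2 * exp 1 * (S (Suc d) * (1 / real (Suc d) - 1 / real (Suc (Suc d))))" for d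
  proof -
    define n where "n = Suc d"
    have n: "n > 0" by (simp add: n_def)
    have prod: "(\<Prod>k<n. real (Suc k) * a k) = fact n * (\<Prod>k<n. a k)"
      by (simp add: prod.distrib fact_prod_Suc atLeast0LessThan)
    \<comment> \<open>AM-GM for the numbers \<open>(k + 1) a k\<close>, combined with \<open>n! \<ge> (n / e)\<^sup>n\<close>\<close>
    have "(fact n * (\<Prod>k<n. a k)) powr (1 / real n) \<le> S n / real n"
      using arith_geom_mean[of "{..<n}" "\<lambda>k. real (Suc k) * a k"] n nonneg
      unfolding S_def prod[symmetric] sum_divide_distrib by (simp add: lessThan_empty_iff)
    then have am_gm: "fact n powr (1 / real n) * (\<Prod>k<n. a k) powr (1 / real n) \<le> S n / real n"
      by (simp add: powr_mult prod_nonneg nonneg)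
    have "real n ^ n / fact n \<le> exp (real n)"
    proof -
      have "(\<Sum>k\<in>{n}. real n ^ k /\<^sub>R fact k) \<le> suminf (\<lambda>k. real n ^ k /\<^sub>R fact k)"
        by (rule sum_le_suminf[OF summable_exp_generic]) auto
      then show ?thesis by (simp add: exp_def divide_inverse mult.commute)
    qed
    then have "(real n / exp 1) ^ n \<le> fact n"
      by (simp add: power_divide field_simps exp_of_nat_mult[symmetric])
    then have "((real n / exp 1) ^ n) powr (1 / real n) \<le> fact n powr (1 / real n)"
      by (intro powr_mono2) auto
    moreover have "((real n / exp 1) ^ n) powr (1 / real n) = real n / exp 1"
      using n by (simp add: powr_powr flip: powr_realpow)
    ultimately have root_le: "real n / exp 1 \<le> fact n powr (1 / real n)" by (simp only:)
    have "real n / exp 1 * (\<Prod>k<n. a k) powr (1 / real n) \<le> S n / real n"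
      by (rule order_trans[OF mult_right_mono[OF root_le powr_ge_zero] am_gm])
    then have "(\<Prod>k<n. a k) powr (1 / real n) \<le> exp 1 * (S n * (1 / real n ^ 2))"
      using n by (simp add: field_simps power2_eq_square)
    also have "\<dots> \<le> exp 1 * (S n * (2 * (1 / real n - 1 / real (Suc n))))"
    proof (intro mult_left_mono S_nonneg)
      show "1 / real n ^ 2 \<le> 2 * (1 / real n - 1 / real (Suc n))"
      proof -
        have "2 * (1 / real n - 1 / real (Suc n)) = 2 / (real n * real (Suc n))"
          using n by (simp add: field_simps)
        moreover have "1 / real n ^ 2 = 2 / (real n * (2 * real n))"
          by (simp add: power2_eq_square)
        moreover have "2 / (real n * (2 * real n)) \<le> 2 / (real n * real (Suc n))"
          using n by (intro divide_left_mono mult_left_mono) auto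
        ultimately show ?thesis by (simp only:)
      qed
    qed simp
    finally show ?thesis by (simp add: n_def mult_ac)
  qed
  have "(\<Sum>d<N. (\<Prod>k<Suc d. a k) powr (1 / real (Suc d))) \<le> 2 * exp 1 * suminf a" for N
  proof -
    have "(\<Sum>d<N. (\<Prod>k<Suc d. a k) powr (1 / real (Suc d))) \<le>
        2 * exp 1 * (\<Sum>d<N. S (Suc d) * (1 / real (Suc d) - 1 / real (Suc (Suc d))))"
      unfolding sum_distrib_left by (intro sum_mono summand)
    also have "\<dots> \<le> 2 * exp 1 * suminf a"
    proof (rule mult_left_mono)
      have "(\<Sum>k<N. a k) - S N / real (Suc N) \<le> (\<Sum>k<N. a k)" using S_nonneg by simp
      also have "\<dots> \<le> suminf a" using sum nonneg by (intro sum_le_suminf) auto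
      finally show "(\<Sum>d<N. S (Suc d) * (1 / real (Suc d) - 1 / real (Suc (Suc d)))) \<le> suminf a"
        unfolding abel .
    qed simp
    finally show ?thesis .
  qed
  then show ?thesis by (intro summableI_nonneg_bounded) auto
qed

text \<open>Here \<open>m k\<close> stands for the moment of order \<open>2 * k\<close>. Each ratio
  of \<open>M\<close> is the geometric mean of \<open>c (2 * k)\<close> and
  \<open>c (2 * k + 1)\<close>, so summable ratios force the decreasing sequence \<open>c\<close> to
  be summable. The products of \<open>c\<close> telescope, and Carleman's inequality then
  contradicts the divergence of the Carleman series.\<close>

lemma Carleman_imp_ratios_not_summable:
  fixes m :: "nat \<Rightarrow> real"
  assumes pos: "\<And>k. m k > 0" and conv: "\<And>k. (m (Suc k))\<^sup>2 \<le> m k * m (Suc (Suc k))"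
    and div: "\<not> summable (\<lambda>d. m (Suc d) powr (- 1 / (2 * real (Suc d))))"
  defines "M \<equiv> \<lambda>k. root 4 (m (2 * k))"
  shows "\<not> summable (\<lambda>k. M k / M (Suc k))"
proof
  assume sum: "summable (\<lambda>k. M k / M (Suc k))"
  define c where "c k = sqrt (m k / m (Suc k))" for k
  have c_pos: "c k > 0" for k using pos by (simp add: c_def)
  have c_dec: "c (Suc k) \<le> c k" for k
    using conv[of k] pos[of "Suc k"] pos[of "Suc (Suc k)"]
    by (simp add: c_def field_simps power2_eq_square)
  have "c (Suc (2 * k)) \<le> M k / M (Suc k)" for k
  proof -
    have "(c (Suc (2 * k))) ^ 4 \<le> (c (2 * k))\<^sup>2 * (c (Suc (2 * k)))\<^sup>2"
      using power_mono[OF c_dec[of "2 * k"], of 2] c_pos[of "Suc (2 * k)"]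
      by (simp add: numeral_eq_Suc mult_right_mono mult.assoc)
    also have "\<dots> = m (2 * k) / m (Suc (2 * k)) * (m (Suc (2 * k)) / m (Suc (Suc (2 * k))))"
      unfolding c_def by (subst (1 2) real_sqrt_pow2) (use pos in \<open>simp_all add: less_imp_le\<close>)
    also have "\<dots> = m (2 * k) / m (2 * Suc k)"
      using pos[of "Suc (2 * k)"] by simp
    finally have "root 4 ((c (Suc (2 * k))) ^ 4) \<le> root 4 (m (2 * k) / m (2 * Suc k))"
      by simp
    then show ?thesis using c_pos[of "Suc (2 * k)"] by (simp add: M_def real_root_divide real_root_power_cancel)
  qed
  then have odd: "summable (\<lambda>k. c (Suc (2 * k)))"
    by (intro summable_comparison_test'[OF sum]) (simp add: less_imp_le[OF c_pos])
  have "summable c"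
  proof (rule summableI_nonneg_bounded)
    show "0 \<le> c n" for n by (simp add: less_imp_le[OF c_pos])
    have b1: "(\<Sum>k<n. c k) \<le> (\<Sum>k<Suc (2 * n). c k)" for n
      by (rule sum_mono2) (auto simp: less_imp_le[OF c_pos])
    \<comment> \<open>By monotonicity each even-indexed term after the first is dominated by its
      odd-indexed predecessor.\<close>
    have b2: "(\<Sum>k<Suc (2 * n). c k) \<le> c 0 + 2 * (\<Sum>k<n. c (Suc (2 * k)))" for n
    proof (induction n)
      case (Suc n)
      have "c (Suc (Suc (2 * n))) \<le> c (Suc (2 * n))" by (rule c_dec)
      with Suc show ?case by simp
    qed simp
    have b3: "(\<Sum>k<n. c (Suc (2 * k))) \<le> suminf (\<lambda>k. c (Suc (2 * k)))" for n
      using odd by (intro sum_le_suminf) (auto simp: less_imp_le[OF c_pos])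
    show "(\<Sum>k<n. c k) \<le> c 0 + 2 * suminf (\<lambda>k. c (Suc (2 * k)))" for n
      using b1[of n] b2[of n] b3[of n] by linarith
  qed
  then have "summable (\<lambda>d. (\<Prod>k<Suc d. c k) powr (1 / real (Suc d)))"
    by (intro Carleman_inequality_summable) (simp_all add: less_imp_le[OF c_pos])
  then have summable: "summable (\<lambda>d. max 1 (1 / sqrt (m 0)) * (\<Prod>k<Suc d. c k) powr (1 / real (Suc d)))"
    by (rule summable_mult)
  have "m (Suc d) powr (- 1 / (2 * real (Suc d))) \<le> max 1 (1 / sqrt (m 0)) * (\<Prod>k<Suc d. c k) powr (1 / real (Suc d))" for d
  proof -
    have "(\<Prod>k<n. c k) = sqrt (m 0 / m n)" for n
    proof (induction n)
      case 0
      show ?case using pos[of 0] by simp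
    next
      case (Suc n)
      have "(\<Prod>k<Suc n. c k) = sqrt (m 0 / m n * (m n / m (Suc n)))"
        unfolding prod.lessThan_Suc Suc real_sqrt_mult by (simp only: c_def)
      then show ?case using pos[of n] by simp
    qed
    then have prod: "(\<Prod>k<Suc d. c k) = sqrt (m 0 / m (Suc d))" .
    have "sqrt (m 0 / m (Suc d)) = m 0 powr (1 / 2) * m (Suc d) powr (- (1 / 2))"
      by (simp only: powr_minus powr_half_sqrt[OF less_imp_le[OF pos]] real_sqrt_divide divide_inverse[of "sqrt _"])
    then have "sqrt (m 0 / m (Suc d)) powr (1 / real (Suc d)) =
        m 0 powr (1 / 2 * (1 / real (Suc d))) * m (Suc d) powr (- (1 / 2) * (1 / real (Suc d)))"
      by (simp only: powr_mult powr_powr)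
    then have powr_eq: "(\<Prod>k<Suc d. c k) powr (1 / real (Suc d)) =
        m 0 powr (1 / (2 * real (Suc d))) * m (Suc d) powr (- 1 / (2 * real (Suc d)))"
      unfolding prod by (simp del: of_nat_Suc)
    \<comment> \<open>The power of \<open>m 0\<close> is at least 1 if \<open>m 0 \<ge> 1\<close>,
      and at least \<open>sqrt (m 0)\<close> otherwise, so one constant compensates for it at all
      \<open>d\<close>.\<close>
    have one_le: "1 \<le> max 1 (1 / sqrt (m 0)) * m 0 powr (1 / (2 * real (Suc d)))"
    proof (cases "m 0 \<ge> 1")
      case True
      then have "1 \<le> m 0 powr (1 / (2 * real (Suc d)))" by (intro ge_one_powr_ge_zero) auto
      then show ?thesis
        by (smt (verit, best) max.cobounded1 mult_le_cancel_right1)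
    next
      case False
      have "1 = 1 / sqrt (m 0) * m 0 powr (1 / 2)" using pos[of 0] by (simp add: powr_half_sqrt)
      also have "\<dots> \<le> max 1 (1 / sqrt (m 0)) * m 0 powr (1 / (2 * real (Suc d)))"
        using pos[of 0] False by (intro mult_mono powr_mono') (auto simp: field_simps)
      finally show ?thesis .
    qed
    from mult_right_mono[OF one_le powr_ge_zero[of "m (Suc d)" "- 1 / (2 * real (Suc d))"]]
    show ?thesis unfolding powr_eq by (simp only: mult.assoc mult_1_left)
  qed
  then have "summable (\<lambda>d. m (Suc d) powr (- 1 / (2 * real (Suc d))))"
    by (intro summable_comparison_test'[OF summable]) simp
  with div show False by blast
qed

text \<open>
  A form of the Denjoy-Carleman theorem in which \<open>D c n t\<close> plays the role of the size of the
  \<open>n\<close>-th derivative at \<open>t\<close> of a function vanishing to infinite order at \<open>0\<close>. Bang's argument: the quantity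
  \<open>sup\<^sub>n (D c n t / (e\<^sup>n M n))\<close> needs a step of length at least \<open>M K / (e M (K + 1))\<close> to grow from
  \<open>e\<^sup>-\<^sup>K\<^sup>-\<^sup>1\<close> to \<open>e\<^sup>-\<^sup>K\<close>, and these lengths have infinite sum.
\<close>

lemma Bang_quasianalytic:
  fixes D :: "'c \<Rightarrow> nat \<Rightarrow> real \<Rightarrow> real" and M :: "nat \<Rightarrow> real"
  assumes M_pos: "\<And>n. M n > 0" and M_conv: "\<And>n. (M (Suc n))\<^sup>2 \<le> M n * M (Suc (Suc n))"
    and M_div: "\<not> summable (\<lambda>n. M n / M (Suc n))"
    and D_le: "\<And>c n t. D c n t \<le> M n"
    and D_0: "\<And>c n. D c n 0 \<le> 0"
    and taylor: "\<And>c n t h k. h \<ge> 0 \<Longrightarrow> \<exists>c'. D c n (t + h) \<le>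
      (\<Sum>i<k. D (c' i) (n + i) t * (h ^ i / fact i)) + M (n + k) * (h ^ k / fact k)"
    and t: "t \<ge> 0"
  shows "D c 0 t \<le> 0"
proof -
  define q where "q n = M n / M (Suc n)" for n
  have q_pos: "q n > 0" for n using M_pos by (simp add: q_def)
  have q_dec: "q n \<le> q m" if "m \<le> n" for m n
    using that
  proof (induction n rule: dec_induct)
    case (step n)
    have "q (Suc n) \<le> q n"
      using M_conv[of n] M_pos[of "Suc n"] M_pos[of "Suc (Suc n)"]
      by (simp add: q_def field_simps power2_eq_square)
    with step show ?case by linarith
  qed simp
  \<comment> \<open>\<open>M n\<close> is \<open>M (n + i)\<close> times the ratios
    \<open>q n, ..., q (n + i - 1)\<close>, each at least \<open>q K\<close> because
    \<open>q\<close> decreases.\<close>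
  have M_le: "M (n + i) * q K ^ i \<le> M n" if "n + i \<le> Suc K" for n i K
    using that
  proof (induction i)
    case (Suc i)
    have "M (n + Suc i) * q K ^ Suc i = M (n + Suc i) * q K * q K ^ i" by simp
    also have "\<dots> \<le> M (n + Suc i) * q (n + i) * q K ^ i"
      using Suc.prems q_pos[of K] M_pos[of "n + Suc i"]
      by (intro mult_right_mono mult_left_mono q_dec) auto
    also have "M (n + Suc i) * q (n + i) = M (n + i)" using M_pos[of "n + Suc i"] by (simp add: q_def)
    also have "M (n + i) * q K ^ i \<le> M n" using Suc by simp
    finally show ?case .
  qed simp
  \<comment> \<open>Level \<open>K\<close> of smallness. Only orders \<open>n \<le> K\<close> carry
    information; above that \<open>D_le\<close> is stronger.\<close>
  define P where "P K t \<longleftrightarrow> (\<forall>c n. D c n t \<le> M n * exp (real n - real K))" for K :: nat and t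
  have P_step: "P K (t + h)" if "P (Suc K) t" "0 \<le> h" "h \<le> q K / exp 1" for K t h
    unfolding P_def
  proof (intro allI)
    fix c n
    show "D c n (t + h) \<le> M n * exp (real n - real K)"
    proof (cases "n \<le> K")
      case False
      then have "M n * 1 \<le> M n * exp (real n - real K)"
        using M_pos[of n] by (intro mult_left_mono) auto
      with D_le[of c n "t + h"] show ?thesis by linarith
    next
      case True
      \<comment> \<open>The expansion stops at order \<open>K + 1\<close>, where the level
        \<open>K + 1\<close> bound is just \<open>M (K + 1)\<close>. The remainder therefore fits as
        the next term of the exponential series in \<open>x\<close>, whose sum is at most
        \<open>exp 1\<close>: the loss of exactly one level.\<close>
      define k where "k = Suc K - n"
      have k: "n + k = Suc K" using True by (simp add: k_def)
      define x where "x = exp 1 * h / q K"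
      have x: "0 \<le> x" "x \<le> 1" using that q_pos[of K] by (simp_all add: x_def field_simps)
      have bound: "M (n + i) * exp (real (n + i) - real (Suc K)) * (h ^ i / fact i) \<le>
          M n * exp (real n - real (Suc K)) * (x ^ i / fact i)" if "i \<le> k" for i
      proof -
        have "exp (real (n + i) - real (Suc K)) * h ^ i = exp (real n - real (Suc K)) * (exp 1 * h) ^ i"
          by (simp add: power_mult_distrib exp_diff exp_add flip: exp_of_nat_mult)
        also have "exp 1 * h = q K * x" using q_pos[of K] by (simp add: x_def)
        finally have "M (n + i) * exp (real (n + i) - real (Suc K)) * (h ^ i / fact i) =
            M (n + i) * q K ^ i * (exp (real n - real (Suc K)) * (x ^ i / fact i))"
          by (simp add: power_mult_distrib mult_ac)
        also have "\<dots> \<le> M n * (exp (real n - real (Suc K)) * (x ^ i / fact i))"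
          using M_le[of n i K] that k x by (intro mult_right_mono) auto
        finally show ?thesis by (simp add: mult_ac)
      qed
      obtain c' where "D c n (t + h) \<le>
          (\<Sum>i<k. D (c' i) (n + i) t * (h ^ i / fact i)) + M (n + k) * (h ^ k / fact k)"
        using taylor \<open>0 \<le> h\<close> by blast
      also have "\<dots> \<le> (\<Sum>i<k. M n * exp (real n - real (Suc K)) * (x ^ i / fact i)) +
          M n * exp (real n - real (Suc K)) * (x ^ k / fact k)"
      proof (intro add_mono sum_mono)
        fix i assume "i \<in> {..<k}"
        have "D (c' i) (n + i) t * (h ^ i / fact i) \<le>
            M (n + i) * exp (real (n + i) - real (Suc K)) * (h ^ i / fact i)"
        proof (rule mult_right_mono)
          show "D (c' i) (n + i) t \<le> M (n + i) * exp (real (n + i) - real (Suc K))"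
            using \<open>P (Suc K) t\<close> unfolding P_def by blast
        qed (use \<open>0 \<le> h\<close> in auto)
        with bound[of i] \<open>i \<in> {..<k}\<close>
        show "D (c' i) (n + i) t * (h ^ i / fact i) \<le> M n * exp (real n - real (Suc K)) * (x ^ i / fact i)"
          by simp
      next
        show "M (n + k) * (h ^ k / fact k) \<le> M n * exp (real n - real (Suc K)) * (x ^ k / fact k)"
          using bound[of k] by (simp add: k)
      qed
      also have "\<dots> = M n * exp (real n - real (Suc K)) * (\<Sum>i<Suc k. x ^ i / fact i)"
        by (simp add: sum_distrib_left distrib_left)
      also have "\<dots> \<le> M n * exp (real n - real (Suc K)) * exp 1"
      proof (rule mult_left_mono)
        have "(\<Sum>i<Suc k. x ^ i /\<^sub>R fact i) \<le> suminf (\<lambda>i. x ^ i /\<^sub>R fact i)"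
          using x by (intro sum_le_suminf summable_exp_generic) auto
        also have "\<dots> = exp x" by (simp add: exp_def)
        also have "\<dots> \<le> exp 1" using x by simp
        finally show "(\<Sum>i<Suc k. x ^ i / fact i) \<le> exp 1" by (simp add: divide_inverse mult.commute)
      qed (use M_pos[of n] in auto)
      also have "\<dots> = M n * exp (real n - real K)"
        by (simp add: mult.assoc flip: exp_add)
      finally show ?thesis .
    qed
  qed
  \<comment> \<open>At time 0 every level holds since \<open>D\<close> is nonpositive there.
    Descending from level \<open>N\<close>, each lost level \<open>j\<close> extends the time
    interval by \<open>q j / exp 1\<close>.\<close>
  have reach: "\<forall>t. 0 \<le> t \<and> t \<le> (\<Sum>j=K..<N. q j / exp 1) \<longrightarrow> P K t" if "K \<le> N" for K N
    using that
  proof (induction K rule: inc_induct)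
    case base
    have "D c n 0 \<le> M n * exp (real n - real N)" for c n
      using D_0[of c n] M_pos[of n] by (smt (verit) exp_gt_zero mult_pos_pos)
    then have "P N 0" by (simp add: P_def)
    then show ?case by (metis atLeastLessThan_empty order_antisym order_refl sum.empty)
  next
    case (step K)
    show ?case
    proof (intro allI impI)
      fix t assume t: "0 \<le> t \<and> t \<le> (\<Sum>j=K..<N. q j / exp 1)"
      define s where "s = min t (\<Sum>j=Suc K..<N. q j / exp 1)"
      have "(\<Sum>j=Suc K..<N. q j / exp 1) \<ge> 0" using q_pos by (intro sum_nonneg) (simp add: less_imp_le)
      then have "P (Suc K) s" using step.IH t by (simp add: s_def)
      moreover have "t - s \<le> q K / exp 1"
        using t step.hyps q_pos[of K] by (auto simp: s_def sum.atLeast_Suc_lessThan min_def)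
      moreover have "0 \<le> t - s" by (simp add: s_def)
      ultimately have "P K (s + (t - s))" by (intro P_step)
      then show "P K t" by simp
    qed
  qed
  \<comment> \<open>By divergence, starting from a high enough level reaches any \<open>t\<close>
    with level \<open>K\<close> still valid.\<close>
  have "P K t" for K
  proof -
    have "\<not> summable (\<lambda>j. q (j + K) / exp 1)"
    proof
      assume "summable (\<lambda>j. q (j + K) / exp 1)"
      then have "summable (\<lambda>j. q (j + K) / exp 1 * exp 1)" by (rule summable_mult2)
      then have "summable (\<lambda>j. q (j + K))" by simp
      then have "summable q" by (simp only: summable_iff_shift)
      with M_div show False unfolding q_def by blast
    qed
    moreover have "summable (\<lambda>j. q (j + K) / exp 1)" if "\<forall>n. (\<Sum>j<n. q (j + K) / exp 1) \<le> t"
      using that q_pos by (intro summableI_nonneg_bounded[of _ t]) (simp_all add: less_imp_le)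
    ultimately have "\<not> (\<forall>n. (\<Sum>j<n. q (j + K) / exp 1) \<le> t)" by blast
    then obtain n where "t \<le> (\<Sum>j<n. q (j + K) / exp 1)" unfolding not_all not_le using less_imp_le by blast
    also have "\<dots> = (\<Sum>j=K..<K + n. q j / exp 1)"
      by (rule sum.reindex_bij_witness[of _ "\<lambda>j. j - K" "\<lambda>j. j + K"]) auto
    finally show ?thesis using reach[of K "K + n"] t by simp
  qed
  then have "D c 0 t \<le> M 0 * exp (0 - real K)" for K unfolding P_def by (metis of_nat_0)
  moreover have "(\<lambda>K. M 0 * exp (0 - real K)) \<longlonglongrightarrow> M 0 * 0"
    by (intro tendsto_mult_left) real_asymp
  ultimately show ?thesis by (intro LIMSEQ_le_const) auto
qed

subsection \<open>Polynomial approximation in L2\<close>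

lemma integrable_product_of_squares:
  fixes f g :: "'a \<Rightarrow> real"
  assumes "f \<in> borel_measurable M" "g \<in> borel_measurable M"
    "integrable M (\<lambda>x. (f x)\<^sup>2)" "integrable M (\<lambda>x. (g x)\<^sup>2)"
  shows "integrable M (\<lambda>x. f x * g x)"
proof (rule Bochner_Integration.integrable_bound)
  show "integrable M (\<lambda>x. (f x)\<^sup>2 + (g x)\<^sup>2)" using assms by simp
  have "\<bar>a * b\<bar> \<le> a\<^sup>2 + b\<^sup>2" for a b :: real
  proof -
    have "0 \<le> \<bar>a\<bar> * \<bar>b\<bar>" by simp
    with sum_squares_bound[of "\<bar>a\<bar>" "\<bar>b\<bar>"] show ?thesis by (simp only: abs_mult power2_abs)
  qed
  then show "AE x in M. norm (f x * g x) \<le> norm ((f x)\<^sup>2 + (g x)\<^sup>2)" by simp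
qed (use assms in simp)

lemma integral_Cauchy_Schwarz:
  fixes f g :: "'a \<Rightarrow> real"
  assumes "f \<in> borel_measurable M" "g \<in> borel_measurable M"
    "integrable M (\<lambda>x. (f x)\<^sup>2)" "integrable M (\<lambda>x. (g x)\<^sup>2)"
  shows "(LINT x|M. f x * g x)\<^sup>2 \<le> (LINT x|M. (f x)\<^sup>2) * (LINT x|M. (g x)\<^sup>2)"
proof (rule quadratic_form_nonneg_imp_le)
  fix c d :: real
  note int = integrable_product_of_squares[OF assms]
  have "0 \<le> (LINT x|M. (c * f x + d * g x)\<^sup>2)" by simp
  also have "\<dots> = (LINT x|M. c\<^sup>2 * (f x)\<^sup>2 + 2 * c * d * (f x * g x) + d\<^sup>2 * (g x)\<^sup>2)"
    by (simp add: power2_eq_square algebra_simps)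
  also have "\<dots> = c\<^sup>2 * (LINT x|M. (f x)\<^sup>2) + 2 * c * d * (LINT x|M. f x * g x) + d\<^sup>2 * (LINT x|M. (g x)\<^sup>2)"
    using int assms by simp
  finally show "0 \<le> c\<^sup>2 * (LINT x|M. (f x)\<^sup>2) + 2 * c * d * (LINT x|M. f x * g x) + d\<^sup>2 * (LINT x|M. (g x)\<^sup>2)" .
qed

text \<open>Differentiating a cosine shifts its phase by \<open>pi / 2\<close>, so the Taylor
  coefficients are again cosines and the family of functions used with Bang's argument is closed
  under expansion in \<open>t\<close>.\<close>

lemma cos_Taylor_bound:
  fixes a x :: real
  shows "\<bar>cos (a + x) - (\<Sum>i<k. cos (a + real i * pi / 2) * (x ^ i / fact i))\<bar> \<le> \<bar>x\<bar> ^ k / fact k"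
proof -
  define d where "d i x = cos (a + real i * pi / 2 + x)" for i x
  have "DERIV (d i) x :> d (Suc i) x" for i x
  proof -
    have "d (Suc i) x = cos ((a + real i * pi / 2 + x) + pi / 2)" by (simp add: d_def field_simps)
    also have "\<dots> = - sin (a + real i * pi / 2 + x)" by (simp add: cos_add)
    finally show ?thesis unfolding d_def by (auto intro!: derivative_eq_intros simp: d_def)
  qed
  then obtain s where "d 0 x = (\<Sum>i<k. d i 0 / fact i * x ^ i) + d k s / fact k * x ^ k"
    using Maclaurin_all_le[of d "d 0" x k] by blast
  then have "cos (a + x) - (\<Sum>i<k. cos (a + real i * pi / 2) * (x ^ i / fact i)) = d k s * (x ^ k / fact k)"
    by (simp add: d_def)
  moreover have "\<bar>d k s * (x ^ k / fact k)\<bar> \<le> \<bar>x\<bar> ^ k / fact k"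
    unfolding abs_mult using mult_right_mono[of "\<bar>d k s\<bar>" 1 "\<bar>x\<bar> ^ k / fact k"]
    by (simp add: d_def power_abs)
  ultimately show ?thesis by simp
qed

lemma monom_at_mult_power: "monom_at y \<beta> * (y $ j) ^ n = monom_at y (\<beta> + Poly_Mapping.single j n)"
  by (simp add: monom_at_add monom_at_single)

lemma borel_measurable_monom_at [measurable]: "(\<lambda>y. monom_at y \<beta>) \<in> borel_measurable borel"
  by (intro borel_measurable_continuous_onI continuous_on_monom_at)

section \<open>The L2 seminorm and the distance to the polynomials\<close>

locale moment_measure =
  fixes \<rho> :: "(real ^ 'm::finite) measure"
  assumes sets_eq: "sets \<rho> = sets borel" and moments: "finite_moments \<rho>"
begin

lemma measurable_eq [simp]: "measurable \<rho> N = measurable borel N"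
  by (rule measurable_cong_sets) (simp_all add: sets_eq)

lemma integrable_monom: "integrable \<rho> (\<lambda>y. monom_at y \<beta>)"
  using moments by (simp add: finite_moments_def)

lemma integrable_eval: "integrable \<rho> (eval_x q)"
  unfolding eval_x_def by (intro Bochner_Integration.integrable_sum integrable_mult_right integrable_monom)

lemma finite_measure: "finite_measure \<rho>"
proof -
  have "integrable \<rho> (\<lambda>_. 1 :: real)" using integrable_monom[of 0] by simp
  then show ?thesis by (auto simp: integrable_iff_bounded intro!: finite_measureI)
qed

definition L2 :: "(real ^ 'm \<Rightarrow> real) \<Rightarrow> bool" where
  "L2 f \<longleftrightarrow> f \<in> borel_measurable borel \<and> integrable \<rho> (\<lambda>y. (f y)\<^sup>2)"

definition nrm :: "(real ^ 'm \<Rightarrow> real) \<Rightarrow> real" where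
  "nrm f = sqrt (LINT y|\<rho>. (f y)\<^sup>2)"

text \<open>The quotient seminorm modulo polynomials. Being sublinear and bounded by
  \<open>nrm\<close>, it turns Taylor expansions in \<open>t\<close> into the inequality on which
  Bang's argument runs.\<close>

definition poly_dist :: "(real ^ 'm \<Rightarrow> real) \<Rightarrow> real" where
  "poly_dist f = (INF q. nrm (\<lambda>y. f y - eval_x q y))"

lemma L2_eval: "L2 (eval_x q)"
  using integrable_eval[of "q\<^sup>2"] by (simp add: L2_def eval_x_power[abs_def])

lemma L2_add: "L2 f \<Longrightarrow> L2 g \<Longrightarrow> L2 (\<lambda>y. f y + g y)"
  using integrable_product_of_squares[of f \<rho> g]
  by (auto simp: L2_def power2_sum mult.assoc intro!: borel_measurable_add)

lemma L2_cmult: "L2 f \<Longrightarrow> L2 (\<lambda>y. c * f y)"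
  by (auto simp: L2_def power_mult_distrib intro!: borel_measurable_times)

lemma L2_diff: "L2 f \<Longrightarrow> L2 g \<Longrightarrow> L2 (\<lambda>y. f y - g y)"
  using L2_add[of f "\<lambda>y. -1 * g y"] L2_cmult[of g "-1"] by simp

lemma L2_sum: "(\<And>i. i \<in> A \<Longrightarrow> L2 (f i)) \<Longrightarrow> L2 (\<lambda>y. \<Sum>i\<in>A. f i y)"
proof (induction A rule: infinite_finite_induct)
  case (insert x A)
  then show ?case by (simp add: L2_add)
qed (simp_all add: L2_def)

lemma nrm_nonneg: "nrm f \<ge> 0"
  by (simp add: nrm_def)

lemma nrm_triangle:
  assumes "L2 f" "L2 g"
  shows "nrm (\<lambda>y. f y + g y) \<le> nrm f + nrm g"
proof (rule power2_le_imp_le)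
  have int: "integrable \<rho> (\<lambda>y. (f y)\<^sup>2)" "integrable \<rho> (\<lambda>y. (g y)\<^sup>2)" "integrable \<rho> (\<lambda>y. f y * g y)"
    using assms by (auto simp: L2_def intro!: integrable_product_of_squares)
  have sq: "(nrm h)\<^sup>2 = (LINT y|\<rho>. (h y)\<^sup>2)" for h by (simp add: nrm_def)
  have "\<bar>LINT y|\<rho>. f y * g y\<bar> \<le> nrm f * nrm g"
  proof (rule power2_le_imp_le)
    show "\<bar>LINT y|\<rho>. f y * g y\<bar>\<^sup>2 \<le> (nrm f * nrm g)\<^sup>2"
      using assms by (simp add: power_mult_distrib sq L2_def integral_Cauchy_Schwarz)
  qed (simp add: nrm_nonneg)
  moreover have "(nrm (\<lambda>y. f y + g y))\<^sup>2 = (nrm f)\<^sup>2 + (nrm g)\<^sup>2 + 2 * (LINT y|\<rho>. f y * g y)"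
    unfolding sq using int by (simp add: power2_sum mult.assoc)
  ultimately show "(nrm (\<lambda>y. f y + g y))\<^sup>2 \<le> (nrm f + nrm g)\<^sup>2"
    by (simp add: power2_sum)
qed (simp add: nrm_nonneg add_nonneg_nonneg)

lemma nrm_cmult: "nrm (\<lambda>y. c * f y) = \<bar>c\<bar> * nrm f"
  by (simp add: nrm_def power_mult_distrib real_sqrt_mult)

lemma nrm_mono:
  assumes "f \<in> borel_measurable borel" "L2 g" "\<And>y. \<bar>f y\<bar> \<le> \<bar>g y\<bar>"
  shows "L2 f" "nrm f \<le> nrm g"
proof -
  have sq: "(f y)\<^sup>2 \<le> (g y)\<^sup>2" for y using assms(3) by (simp add: abs_le_square_iff)
  show "L2 f" unfolding L2_def
    using assms sq by (auto simp: L2_def intro: Bochner_Integration.integrable_bound[of \<rho> "\<lambda>y. (g y)\<^sup>2"])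
  with assms sq show "nrm f \<le> nrm g" unfolding nrm_def
    by (intro real_sqrt_le_mono integral_mono) (auto simp: L2_def)
qed

lemma poly_dist_le: "poly_dist f \<le> nrm (\<lambda>y. f y - eval_x q y)"
  unfolding poly_dist_def by (rule cINF_lower) (auto intro!: bdd_belowI[of _ 0] nrm_nonneg)

lemma poly_dist_le_nrm: "poly_dist f \<le> nrm f"
  using poly_dist_le[of f 0] by simp

lemma poly_dist_approx:
  assumes "poly_dist f < e"
  obtains q where "nrm (\<lambda>y. f y - eval_x q y) < e"
proof -
  have "\<exists>x\<in>range (\<lambda>q. nrm (\<lambda>y. f y - eval_x q y)). x < e"
    using assms unfolding poly_dist_def by (intro cInf_lessD) auto
  then show thesis using that by blast
qed

lemma poly_dist_add:
  assumes "L2 f" "L2 g"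
  shows "poly_dist (\<lambda>y. f y + g y) \<le> poly_dist f + poly_dist g"
proof (rule field_le_epsilon)
  fix e :: real assume "e > 0"
  obtain p where p: "nrm (\<lambda>y. f y - eval_x p y) < poly_dist f + e / 2"
    using poly_dist_approx[of f "poly_dist f + e / 2"] \<open>e > 0\<close> by auto
  obtain q where q: "nrm (\<lambda>y. g y - eval_x q y) < poly_dist g + e / 2"
    using poly_dist_approx[of g "poly_dist g + e / 2"] \<open>e > 0\<close> by auto
  have "poly_dist (\<lambda>y. f y + g y) \<le> nrm (\<lambda>y. (f y + g y) - eval_x (p + q) y)"
    by (rule poly_dist_le)
  also have "(\<lambda>y. (f y + g y) - eval_x (p + q) y) = (\<lambda>y. (f y - eval_x p y) + (g y - eval_x q y))"
    by (simp add: eval_x_add algebra_simps)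
  also have "nrm \<dots> \<le> nrm (\<lambda>y. f y - eval_x p y) + nrm (\<lambda>y. g y - eval_x q y)"
    using assms by (intro nrm_triangle L2_diff L2_eval)
  also have "\<dots> \<le> poly_dist f + poly_dist g + e" using p q by simp
  finally show "poly_dist (\<lambda>y. f y + g y) \<le> poly_dist f + poly_dist g + e" .
qed

lemma poly_dist_cmult: "poly_dist (\<lambda>y. c * f y) \<le> \<bar>c\<bar> * poly_dist f"
proof (rule field_le_epsilon)
  fix e :: real assume "e > 0"
  then have "poly_dist f < poly_dist f + e / (\<bar>c\<bar> + 1)" by (simp add: add_pos_pos)
  then obtain q where q: "nrm (\<lambda>y. f y - eval_x q y) < poly_dist f + e / (\<bar>c\<bar> + 1)"
    by (rule poly_dist_approx)
  have "poly_dist (\<lambda>y. c * f y) \<le> nrm (\<lambda>y. c * f y - eval_x (const_poly c * q) y)"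
    by (rule poly_dist_le)
  also have "\<dots> = nrm (\<lambda>y. c * (f y - eval_x q y))"
    by (simp add: eval_x_mult eval_x_single algebra_simps)
  also have "\<dots> \<le> \<bar>c\<bar> * (poly_dist f + e / (\<bar>c\<bar> + 1))"
    unfolding nrm_cmult using q by (intro mult_left_mono) auto
  also have "\<dots> \<le> \<bar>c\<bar> * poly_dist f + e"
    using \<open>e > 0\<close> by (simp add: field_simps)
  finally show "poly_dist (\<lambda>y. c * f y) \<le> \<bar>c\<bar> * poly_dist f + e" .
qed

lemma poly_dist_sum:
  assumes "\<And>i. i \<in> A \<Longrightarrow> L2 (f i)"
  shows "poly_dist (\<lambda>y. \<Sum>i\<in>A. f i y) \<le> (\<Sum>i\<in>A. poly_dist (f i))"
  using assms
proof (induction A rule: infinite_finite_induct)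
  case (insert x A)
  have "poly_dist (\<lambda>y. f x y + (\<Sum>i\<in>A. f i y)) \<le> poly_dist (f x) + poly_dist (\<lambda>y. \<Sum>i\<in>A. f i y)"
    using insert.prems by (intro poly_dist_add L2_sum) auto
  also have "\<dots> \<le> poly_dist (f x) + (\<Sum>i\<in>A. poly_dist (f i))"
    using insert.IH insert.prems by simp
  finally show ?case using insert.hyps by simp
qed (use poly_dist_le_nrm[of "\<lambda>_. 0"] in \<open>simp_all add: nrm_def\<close>)

lemma poly_dist_cong_AE:
  assumes "AE y in \<rho>. f y = g y" "f \<in> borel_measurable borel" "g \<in> borel_measurable borel"
  shows "poly_dist f = poly_dist g"
proof -
  have "(LINT y|\<rho>. (f y - eval_x q y)\<^sup>2) = (LINT y|\<rho>. (g y - eval_x q y)\<^sup>2)" for q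
    using assms by (intro integral_cong_AE) auto
  then show ?thesis by (simp add: poly_dist_def nrm_def)
qed

section \<open>Products of cosines as limits of polynomials\<close>

text \<open>
  The monomial factors make this class stable under multiplication by \<open>cos (t y\<^sub>j + c)\<close>: the
  derivatives in \<open>t\<close> only bring in further powers of \<open>y\<^sub>j\<close>.
\<close>

definition approximable :: "(real ^ 'm \<Rightarrow> real) \<Rightarrow> bool" where
  "approximable u \<longleftrightarrow> u \<in> borel_measurable borel \<and> (\<exists>B. \<forall>y. \<bar>u y\<bar> \<le> B) \<and>
     (\<forall>\<beta>. poly_dist (\<lambda>y. monom_at y \<beta> * u y) \<le> 0)"

text \<open>The input of Bang's argument in direction \<open>j\<close>: up to constants, one
  sequence \<open>M\<close> bounds the sizes of the successive \<open>t\<close>-derivatives for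
  every monomial factor. A coordinate that vanishes almost everywhere is listed apart, as its
  moments supply no positive \<open>M\<close>.\<close>

definition quasianalytic :: "'m \<Rightarrow> bool" where
  "quasianalytic j \<longleftrightarrow> (AE y in \<rho>. y $ j = 0) \<or>
     (\<exists>M. (\<forall>n. M n > 0) \<and> (\<forall>n. (M (Suc n))\<^sup>2 \<le> M n * M (Suc (Suc n))) \<and>
       \<not> summable (\<lambda>n. M n / M (Suc n)) \<and>
       (\<forall>\<beta>. \<exists>C>0. \<forall>n. nrm (\<lambda>y. monom_at y \<beta> * (y $ j) ^ n) \<le> C * M n))"

text \<open>Up to a phase shift \<open>F c n t\<close> is the \<open>n\<close>-th derivative in
  \<open>t\<close> of the function to be approximated. Its distance to the polynomials plays the
  role of \<open>D\<close>, and at \<open>t = 0\<close> it vanishes because the cosine is constant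
  and \<open>u\<close> is approximable with any monomial factor.\<close>

lemma approximable_mult_cos_nonneg:
  assumes u: "approximable u" and j: "quasianalytic j" and t: "t \<ge> 0"
  shows "approximable (\<lambda>y. u y * cos (t * y $ j + c))"
proof -
  obtain B0 where B0: "\<And>y. \<bar>u y\<bar> \<le> B0" using u by (auto simp: approximable_def)
  \<comment> \<open>The maximum with 1 makes the bound strictly positive, as
    \<open>B * C * M n\<close> must be.\<close>
  define B where "B = max 1 B0"
  have B: "B > 0" "\<And>y. \<bar>u y\<bar> \<le> B" using B0 by (auto simp: B_def le_max_iff_disj)
  have [measurable]: "u \<in> borel_measurable borel" using u by (simp add: approximable_def)
  have cos_le: "\<bar>a * cos b\<bar> \<le> \<bar>a\<bar>" for a b :: real by (simp add: abs_mult mult_left_le)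
  have "poly_dist (\<lambda>y. monom_at y \<beta> * (u y * cos (t * y $ j + c))) \<le> 0" for \<beta>
    using j unfolding quasianalytic_def
  proof (elim disjE exE conjE)
    assume AE: "AE y in \<rho>. y $ j = 0"
    have "poly_dist (\<lambda>y. monom_at y \<beta> * (u y * cos (t * y $ j + c))) =
        poly_dist (\<lambda>y. cos c * (monom_at y \<beta> * u y))"
      by (rule poly_dist_cong_AE) (use AE in auto)
    also have "\<dots> \<le> \<bar>cos c\<bar> * poly_dist (\<lambda>y. monom_at y \<beta> * u y)" by (rule poly_dist_cmult)
    also have "\<dots> \<le> 0" using u by (auto simp: approximable_def mult_nonneg_nonpos)
    finally show ?thesis .
  next
    fix M assume M: "\<forall>n. M n > 0" "\<forall>n. (M (Suc n))\<^sup>2 \<le> M n * M (Suc (Suc n))"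
      "\<not> summable (\<lambda>n. M n / M (Suc n))"
      and "\<forall>\<beta>. \<exists>C>0. \<forall>n. nrm (\<lambda>y. monom_at y \<beta> * (y $ j) ^ n) \<le> C * M n"
    then obtain C where C: "C > 0" "\<And>n. nrm (\<lambda>y. monom_at y \<beta> * (y $ j) ^ n) \<le> C * M n" by blast
    define F where "F c n t y = monom_at y \<beta> * (y $ j) ^ n * (u y * cos (t * y $ j + c))" for c n t y
    have [measurable]: "F c n t \<in> borel_measurable borel" for c n t unfolding F_def by measurable
    have L2_monom: "L2 (\<lambda>y. c * (monom_at y \<beta> * (y $ j) ^ n))" for n c
    proof (rule L2_cmult)
      have "(\<lambda>y. monom_at y \<beta> * (y $ j) ^ n) =
          eval_x (Poly_Mapping.single (\<beta> + Poly_Mapping.single j n) 1)"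
        by (simp add: fun_eq_iff eval_x_single monom_at_mult_power)
      then show "L2 (\<lambda>y. monom_at y \<beta> * (y $ j) ^ n)" by (simp only: L2_eval)
    qed
    have bound: "L2 f \<and> nrm f \<le> a * (B * C * M n)"
      if "f \<in> borel_measurable borel" "a \<ge> 0" "\<And>y. \<bar>f y\<bar> \<le> \<bar>(a * B) * (monom_at y \<beta> * (y $ j) ^ n)\<bar>" for f a n
    proof -
      have "nrm (\<lambda>y. (a * B) * (monom_at y \<beta> * (y $ j) ^ n)) \<le> (a * B) * (C * M n)"
        unfolding nrm_cmult using B \<open>a \<ge> 0\<close> C(2)[of n] by (simp add: mult_left_mono abs_mult)
      with nrm_mono[OF that(1) L2_monom that(3)] show ?thesis by (simp add: mult_ac)
    qed
    have F_bound: "L2 (F c n t) \<and> nrm (F c n t) \<le> B * C * M n" for c n t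
    proof -
      have "\<bar>F c n t y\<bar> \<le> \<bar>(1 * B) * (monom_at y \<beta> * (y $ j) ^ n)\<bar>" for y
      proof -
        have "\<bar>F c n t y\<bar> \<le> \<bar>monom_at y \<beta> * (y $ j) ^ n\<bar> * \<bar>u y\<bar>"
          unfolding F_def by (subst (1) abs_mult) (intro mult_left_mono cos_le abs_ge_zero)
        also have "\<dots> \<le> \<bar>monom_at y \<beta> * (y $ j) ^ n\<bar> * B" using B by (intro mult_left_mono) auto
        finally show ?thesis using B by (simp add: abs_mult mult_ac)
      qed
      from bound[OF _ _ this] show ?thesis by simp
    qed
    have "poly_dist (F c 0 t) \<le> 0"
    proof (rule Bang_quasianalytic[where M = "\<lambda>n. B * C * M n" and D = "\<lambda>c n t. poly_dist (F c n t)"])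
      show "B * C * M n > 0" for n using B C M by simp
      show "(B * C * M (Suc n))\<^sup>2 \<le> B * C * M n * (B * C * M (Suc (Suc n)))" for n
      proof -
        have "(B * C)\<^sup>2 * (M (Suc n))\<^sup>2 \<le> (B * C)\<^sup>2 * (M n * M (Suc (Suc n)))"
          using M(2) by (intro mult_left_mono) auto
        then show ?thesis by (simp add: power2_eq_square mult_ac)
      qed
      show "\<not> summable (\<lambda>n. B * C * M n / (B * C * M (Suc n)))" using M(3) B C by simp
      show "poly_dist (F c n t) \<le> B * C * M n" for c n t
        using poly_dist_le_nrm[of "F c n t"] F_bound[of c n t] by linarith
      show "poly_dist (F c n 0) \<le> 0" for c n
      proof -
        have "F c n 0 = (\<lambda>y. cos c * (monom_at y (\<beta> + Poly_Mapping.single j n) * u y))"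
          by (simp add: F_def fun_eq_iff flip: monom_at_mult_power)
        then have "poly_dist (F c n 0) \<le> \<bar>cos c\<bar> * poly_dist (\<lambda>y. monom_at y (\<beta> + Poly_Mapping.single j n) * u y)"
          by (simp only: poly_dist_cmult)
        also have "\<dots> \<le> 0" using u by (auto simp: approximable_def mult_nonneg_nonpos)
        finally show ?thesis .
      qed
      show "t \<ge> 0" by fact
      fix c n t h k assume h: "(h::real) \<ge> 0"
      define G where "G i y = h ^ i / fact i * F (c + real i * pi / 2) (n + i) t y" for i y
      define R where "R y = F c n (t + h) y - (\<Sum>i<k. G i y)" for y
      have [measurable]: "G i \<in> borel_measurable borel" for i unfolding G_def by measurable
      have [measurable]: "R \<in> borel_measurable borel" unfolding R_def by measurable
      have L2_G: "L2 (G i)" for i unfolding G_def using F_bound by (intro L2_cmult) blast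
      have "\<bar>R y\<bar> \<le> \<bar>(h ^ k / fact k * B) * (monom_at y \<beta> * (y $ j) ^ (n + k))\<bar>" for y
      proof -
        have "R y = monom_at y \<beta> * (y $ j) ^ n * u y * (cos ((t * y $ j + c) + h * y $ j) -
            (\<Sum>i<k. cos ((t * y $ j + c) + real i * pi / 2) * ((h * y $ j) ^ i / fact i)))"
          unfolding R_def G_def F_def right_diff_distrib sum_distrib_left
          by (intro arg_cong2[where f = minus] sum.cong) (simp_all add: power_add power_mult_distrib algebra_simps)
        also have "\<bar>\<dots>\<bar> \<le> \<bar>monom_at y \<beta> * (y $ j) ^ n\<bar> * B * (\<bar>h * y $ j\<bar> ^ k / fact k)"
          unfolding abs_mult[of _ "cos _ - _"] abs_mult[of _ "u y"]
          using B by (intro mult_mono cos_Taylor_bound) auto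
        also have "\<dots> = \<bar>(h ^ k / fact k * B) * (monom_at y \<beta> * (y $ j) ^ (n + k))\<bar>"
          using B h by (simp add: abs_mult power_abs power_add power_mult_distrib mult_ac)
        finally show ?thesis .
      qed
      from bound[OF _ _ this] h have R: "L2 R" "nrm R \<le> h ^ k / fact k * (B * C * M (n + k))" by simp_all
      have "F c n (t + h) = (\<lambda>y. (\<Sum>i<k. G i y) + R y)" by (simp add: R_def)
      then have "poly_dist (F c n (t + h)) \<le> poly_dist (\<lambda>y. \<Sum>i<k. G i y) + poly_dist R"
        using L2_G R by (simp only:) (intro poly_dist_add L2_sum)
      also have "poly_dist (\<lambda>y. \<Sum>i<k. G i y) \<le> (\<Sum>i<k. poly_dist (G i))"
        using L2_G by (rule poly_dist_sum)
      also have "\<dots> \<le> (\<Sum>i<k. poly_dist (F (c + real i * pi / 2) (n + i) t) * (h ^ i / fact i))"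
      proof (rule sum_mono)
        fix i
        have "poly_dist (G i) \<le> \<bar>h ^ i / fact i\<bar> * poly_dist (F (c + real i * pi / 2) (n + i) t)"
          unfolding G_def by (rule poly_dist_cmult)
        then show "poly_dist (G i) \<le> poly_dist (F (c + real i * pi / 2) (n + i) t) * (h ^ i / fact i)"
          using h by (simp add: mult.commute)
      qed
      also have "poly_dist R \<le> B * C * M (n + k) * (h ^ k / fact k)"
        using poly_dist_le_nrm[of R] R(2) by (simp add: mult.commute)
      finally show "\<exists>c'. poly_dist (F c n (t + h)) \<le>
          (\<Sum>i<k. poly_dist (F (c' i) (n + i) t) * (h ^ i / fact i)) + B * C * M (n + k) * (h ^ k / fact k)"
        by (intro exI[of _ "\<lambda>i. c + real i * pi / 2"]) simp
    qed
    then show ?thesis by (simp add: F_def[abs_def])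
  qed
  moreover have "\<bar>u y * cos (t * y $ j + c)\<bar> \<le> B" for y
    using cos_le[of "u y" "t * y $ j + c"] B(2)[of y] by linarith
  ultimately show ?thesis unfolding approximable_def by auto
qed

lemma approximable_mult_cos:
  assumes "approximable u" "quasianalytic j"
  shows "approximable (\<lambda>y. u y * cos (t * y $ j + c))"
proof (cases "t \<ge> 0")
  case False
  have "cos (t * y $ j + c) = cos (- t * y $ j + - c)" for y
    by (metis cos_minus minus_add_distrib mult_minus_left)
  with approximable_mult_cos_nonneg[OF assms, of "- t" "- c"] False show ?thesis by simp
qed (rule approximable_mult_cos_nonneg[OF assms])

lemma approximable_1: "approximable (\<lambda>_. 1)"
proof -
  have "poly_dist (\<lambda>y. monom_at y \<beta>) \<le> 0" for \<beta>
    using poly_dist_le[of "\<lambda>y. monom_at y \<beta>" "Poly_Mapping.single \<beta> 1"]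
    by (simp add: eval_x_single nrm_def)
  then show ?thesis by (auto simp: approximable_def)
qed

lemma approximable_cos_product:
  assumes "\<And>j. quasianalytic j"
  shows "approximable (\<lambda>y. \<Prod>j\<in>UNIV. cos (t * y $ j + c j) ^ k)"
proof -
  have power: "approximable (\<lambda>y. u y * cos (t * y $ j + c j) ^ k)" if "approximable u" for u j k
  proof (induction k)
    case (Suc k)
    from approximable_mult_cos[OF this assms[of j], of t "c j"] show ?case by (simp add: mult_ac)
  qed (simp add: that)
  have "approximable (\<lambda>y. \<Prod>j\<in>A. cos (t * y $ j + c j) ^ k)" if "finite A" for A
    using that
  proof (induction A rule: finite_induct)
    case (insert j A)
    from power[OF insert.IH, of j k] insert.hyps show ?case by (simp add: mult.commute)
  qed (simp add: approximable_1)
  then show ?thesis by simp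
qed

end

subsection \<open>Nonnegativity on the support of a Carleman measure\<close>

text \<open>If \<open>h a < 0\<close>, then \<open>h\<close> is at most \<open>- \<delta>\<close> on
  a ball of radius \<open>e\<close>. The Gaussian integral over the half ball is negative of order
  \<open>exp (- k * (e / 2) ^ 2)\<close>, while the part outside the ball is at most of order
  \<open>exp (- k * e ^ 2)\<close>. For large \<open>k\<close> the negative part wins.\<close>

lemma Gaussian_peak_nonneg:
  fixes \<nu> :: "(real ^ 'm::finite) measure" and h :: "real ^ 'm \<Rightarrow> real"
  assumes sets: "sets \<nu> = sets borel" and fin: "finite_measure \<nu>"
    and int: "integrable \<nu> h" and cont: "isCont h a" and a: "a \<in> measure_support \<nu>"
    and nonneg: "\<And>k. (LINT y|\<nu>. exp (- real k * (dist y a)\<^sup>2) * h y) \<ge> 0"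
  shows "h a \<ge> 0"
proof (rule ccontr)
  assume "\<not> h a \<ge> 0"
  interpret finite_measure \<nu> by fact
  have meas [simp]: "measurable \<nu> N = measurable borel N" for N
    by (rule measurable_cong_sets) (simp_all add: sets)
  have [measurable]: "h \<in> borel_measurable borel" using borel_measurable_integrable[OF int] by simp
  define \<delta> where "\<delta> = - h a / 2"
  have \<delta>: "\<delta> > 0" using \<open>\<not> h a \<ge> 0\<close> by (simp add: \<delta>_def)
  obtain e where e: "e > 0" "\<And>y. dist y a < e \<Longrightarrow> dist (h y) (h a) < \<delta>"
    using cont \<delta> unfolding continuous_at_eps_delta by blast
  have neg: "h y \<le> - \<delta>" if "dist y a < e" for y
    using e(2)[OF that] by (simp add: \<delta>_def dist_real_def abs_less_iff field_simps)
  define b where "b = measure \<nu> (ball a (e / 2))"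
  have "emeasure \<nu> (ball a (e / 2)) > 0" using a e(1) by (simp add: measure_support_def)
  then have b: "b > 0" by (simp add: b_def emeasure_eq_measure)
  define H where "H = (LINT y|\<nu>. \<bar>h y\<bar>)"
  \<comment> \<open>The factor 3/4 is 1 - 1/4, from comparing the radii \<open>e\<close> and
    \<open>e / 2\<close>.\<close>
  have "\<delta> * b \<le> exp (- (3 / 4 * e\<^sup>2)) ^ k * H" for k
  proof -
    let ?f = "\<lambda>y. exp (- real k * (dist y a)\<^sup>2) * h y"
    let ?g = "\<lambda>y. exp (- real k * e\<^sup>2) * \<bar>h y\<bar> - \<delta> * exp (- real k * (e / 2)\<^sup>2) * indicator (ball a (e / 2)) y"
    have "0 \<le> (LINT y|\<nu>. ?f y)" by (rule nonneg)
    also have "\<dots> \<le> (LINT y|\<nu>. ?g y)"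
    proof (rule integral_mono)
      show "integrable \<nu> ?f"
        by (rule Bochner_Integration.integrable_bound[OF int]) (auto simp: abs_mult intro!: mult_left_le_one_le)
      show "integrable \<nu> ?g"
        using int by (intro Bochner_Integration.integrable_diff integrable_mult_right integrable_abs)
          (auto simp: integrable_indicator_iff sets emeasure_eq_measure)
      fix y
      show "?f y \<le> ?g y"
      proof (cases "dist y a < e")
        case True
        note h = neg[OF True]
        show ?thesis
        proof (cases "dist y a < e / 2")
          case True
          have "exp (- real k * (e / 2)\<^sup>2) \<le> exp (- real k * (dist y a)\<^sup>2)"
            using True by (simp add: mult_left_mono power_mono)
          then have "\<delta> * exp (- real k * (e / 2)\<^sup>2) \<le> (- h y) * exp (- real k * (dist y a)\<^sup>2)"
            using h \<delta> by (intro mult_mono) auto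
          moreover have "0 \<le> exp (- real k * e\<^sup>2) * \<bar>h y\<bar>" by simp
          moreover have "?g y = exp (- real k * e\<^sup>2) * \<bar>h y\<bar> - \<delta> * exp (- real k * (e / 2)\<^sup>2)"
            using True by (simp add: dist_commute)
          moreover have "?f y = - ((- h y) * exp (- real k * (dist y a)\<^sup>2))" by simp
          ultimately show ?thesis by linarith
        next
          case False
          then have "?g y = exp (- real k * e\<^sup>2) * \<bar>h y\<bar>" by (simp add: dist_commute)
          moreover have "?f y \<le> 0" using h \<delta> by (simp add: mult_nonneg_nonpos)
          moreover have "0 \<le> exp (- real k * e\<^sup>2) * \<bar>h y\<bar>" by simp
          ultimately show ?thesis by linarith
        qed
      next
        case False
        then have "?g y = exp (- real k * e\<^sup>2) * \<bar>h y\<bar>" using e(1) by (simp add: dist_commute)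
        moreover have "exp (- real k * (dist y a)\<^sup>2) \<le> exp (- real k * e\<^sup>2)"
          using False e(1) by (simp add: mult_left_mono power_mono)
        then have "exp (- real k * (dist y a)\<^sup>2) * \<bar>h y\<bar> \<le> exp (- real k * e\<^sup>2) * \<bar>h y\<bar>"
          by (intro mult_right_mono) auto
        moreover have "exp (- real k * (dist y a)\<^sup>2) * h y \<le> exp (- real k * (dist y a)\<^sup>2) * \<bar>h y\<bar>"
          by (intro mult_left_mono) auto
        ultimately show ?thesis by linarith
      qed
    qed
    also have "\<dots> = exp (- real k * e\<^sup>2) * H - \<delta> * exp (- real k * (e / 2)\<^sup>2) * b"
      using int by (subst Bochner_Integration.integral_diff)
        (auto simp: H_def b_def integrable_indicator_iff sets emeasure_eq_measure)
    finally have le: "\<delta> * b * exp (- real k * (e / 2)\<^sup>2) \<le> exp (- real k * e\<^sup>2) * H" by (simp add: mult_ac)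
    have "exp (- real k * e\<^sup>2) = exp (- (3 / 4 * e\<^sup>2)) ^ k * exp (- real k * (e / 2)\<^sup>2)"
      by (simp add: power_divide algebra_simps flip: exp_of_nat_mult exp_add)
    with le have "\<delta> * b * exp (- real k * (e / 2)\<^sup>2) \<le> exp (- (3 / 4 * e\<^sup>2)) ^ k * H * exp (- real k * (e / 2)\<^sup>2)"
      by (simp add: mult_ac)
    then show ?thesis by (rule mult_right_le_imp_le) simp
  qed
  moreover have "(\<lambda>k. exp (- (3 / 4 * e\<^sup>2)) ^ k * H) \<longlonglongrightarrow> 0"
    using e(1) by (intro tendsto_mult_left_zero LIMSEQ_realpow_zero) auto
  ultimately have "\<delta> * b \<le> 0" by (intro LIMSEQ_le_const) auto
  with \<delta> b show False by (simp add: mult_le_0_iff)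
qed

lemma cos_power_tendsto_exp:
  "(\<lambda>n. cos (s / sqrt (real n)) ^ n) \<longlonglongrightarrow> exp (- s\<^sup>2 / 2)"
proof (cases "s = 0")
  case False
  then have "(\<lambda>n. cos (s / sqrt (real n)) ^ n) \<longlonglongrightarrow> exp (- (s * s / 2))" by real_asymp
  then show ?thesis by (simp add: power2_eq_square)
qed simp

section \<open>Carleman's condition for weighted measures\<close>

lemma carleman_moments:
  fixes \<nu> :: "(real ^ 'm::finite) measure"
  assumes "carleman \<nu>" and pos: "\<And>k. (LINT y|\<nu>. (y $ j) ^ (2 * k)) > 0"
  shows "\<not> summable (\<lambda>d. (LINT y|\<nu>. (y $ j) ^ (2 * Suc d)) powr (- 1 / (2 * real (Suc d))))"
proof -
  define m where "m k = (LINT y|\<nu>. (y $ j) ^ (2 * k))" for k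
  have "suminf (\<lambda>e. if m (Suc e) = 0 then \<infinity> else ennreal (m (Suc e) powr (- 1 / (2 * real (Suc e))))) = \<infinity>"
    using assms(1) unfolding carleman_def Let_def m_def by (rule spec)
  moreover have "(if m (Suc e) = 0 then \<infinity> else ennreal (m (Suc e) powr (- 1 / (2 * real (Suc e))))) =
      ennreal (m (Suc e) powr (- 1 / (2 * real (Suc e))))" for e
    using pos[of "Suc e"] by (intro if_not_P) (simp add: m_def)
  ultimately have top: "suminf (\<lambda>e. ennreal (m (Suc e) powr (- 1 / (2 * real (Suc e))))) = \<infinity>"
    by (simp only:)
  have "\<not> summable (\<lambda>d. m (Suc d) powr (- 1 / (2 * real (Suc d))))"
  proof
    assume "summable (\<lambda>d. m (Suc d) powr (- 1 / (2 * real (Suc d))))"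
    from suminf_ennreal2[OF powr_ge_zero this] top show False by simp
  qed
  then show ?thesis unfolding m_def .
qed

text \<open>Cauchy-Schwarz separates the weight and the monomial from the power of the coordinate:
  the norm in the weighted measure is at most a constant times the fourth root of the moment of
  order \<open>4 * n\<close> of \<open>\<nu>\<close>. These roots serve as \<open>M\<close> for all
  monomials at once.\<close>

lemma quasianalytic_density:
  fixes \<nu> :: "(real ^ 'm::finite) measure" and G :: "'m xpoly"
  assumes \<nu>: "moment_measure \<nu>" and carl: "carleman \<nu>"
  defines "\<rho> \<equiv> density \<nu> (\<lambda>y. ennreal \<bar>eval_x G y\<bar>)"
  shows "moment_measure \<rho>" "moment_measure.quasianalytic \<rho> j"
proof -
  interpret \<nu>: moment_measure \<nu> by fact
  have meas: "measurable \<rho> N = measurable borel N" for N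
    by (rule measurable_cong_sets) (simp_all add: \<rho>_def \<nu>.sets_eq)
  have int_prod: "integrable \<nu> (\<lambda>y. \<bar>eval_x G y\<bar> * eval_x q y)" for q
    by (rule Bochner_Integration.integrable_bound[OF \<nu>.integrable_eval[of "G * q"]])
       (auto simp: eval_x_mult abs_mult)
  have "integrable \<rho> (eval_x q)" for q
    unfolding \<rho>_def using int_prod[of q] by (subst integrable_density) auto
  from this[of "Poly_Mapping.single _ 1"] have "finite_moments \<rho>"
    by (simp add: finite_moments_def eval_x_single[abs_def])
  then show \<rho>: "moment_measure \<rho>"
    by (simp add: moment_measure_def \<rho>_def \<nu>.sets_eq)
  interpret \<rho>: moment_measure \<rho> by fact
  define m where "m k = (LINT y|\<nu>. (y $ j) ^ (2 * k))" for k
  have pow: "(\<lambda>y. (y $ j) ^ k) = eval_x (var_x j ^ k)" for k :: nat and j :: 'm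
    by (simp add: fun_eq_iff eval_x_power eval_x_var)
  have int_pow: "integrable \<nu> (\<lambda>y. (y $ j) ^ k)" for k unfolding pow by (rule \<nu>.integrable_eval)
  have m_nonneg: "m k \<ge> 0" for k unfolding m_def by (simp add: power_mult)
  have m_conv: "(m (k + l))\<^sup>2 \<le> m (2 * k) * m (2 * l)" for k l
  proof -
    have "(LINT y|\<nu>. (y $ j) ^ (2 * k) * (y $ j) ^ (2 * l))\<^sup>2 \<le>
        (LINT y|\<nu>. ((y $ j) ^ (2 * k))\<^sup>2) * (LINT y|\<nu>. ((y $ j) ^ (2 * l))\<^sup>2)"
      using int_pow by (intro integral_Cauchy_Schwarz) (auto simp flip: power_mult)
    then show ?thesis by (simp add: m_def distrib_left flip: power_mult power_add)
  qed
  \<comment> \<open>The even power \<open>2 * k + 2\<close> is split into \<open>k\<close> and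
    \<open>k + 2\<close>, which may be odd; this compares consecutive even moments.\<close>
  have m_conv1: "(m (Suc k))\<^sup>2 \<le> m k * m (Suc (Suc k))" for k
  proof -
    have "(LINT y|\<nu>. (y $ j) ^ k * (y $ j) ^ (Suc (Suc k)))\<^sup>2 \<le>
        (LINT y|\<nu>. ((y $ j) ^ k)\<^sup>2) * (LINT y|\<nu>. ((y $ j) ^ (Suc (Suc k)))\<^sup>2)"
      using int_pow by (intro integral_Cauchy_Schwarz) (auto simp del: power_Suc simp flip: power_mult)
    moreover have "k + Suc (Suc k) = 2 * Suc k" "k * 2 = 2 * k" "Suc (Suc k) * 2 = 2 * Suc (Suc k)" by simp_all
    ultimately show ?thesis by (simp only: m_def flip: power_mult power_add)
  qed
  show "\<rho>.quasianalytic j"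
  proof (cases "\<exists>k. m k = 0")
    case True
    then obtain k where "m k = 0" by blast
    then have "AE y in \<nu>. (y $ j) ^ (2 * k) = 0"
      unfolding m_def using integral_nonneg_eq_0_iff_AE[OF int_pow[of "2 * k"]] by (simp add: power_mult)
    \<comment> \<open>For \<open>k = 0\<close> the integrand is 1, so \<open>\<nu>\<close> is null
      and the claim holds trivially.\<close>
    then have "AE y in \<nu>. y $ j = 0" by eventually_elim (simp split: if_splits)
    then have "AE y in \<rho>. y $ j = 0" unfolding \<rho>_def by (subst AE_density) auto
    then show ?thesis by (simp add: \<rho>.quasianalytic_def)
  next
    case False
    with m_nonneg have m_pos: "m k > 0" for k by (metis order_le_less)
    define M where "M k = root 4 (m (2 * k))" for k
    have "\<not> summable (\<lambda>n. M n / M (Suc n))"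
      unfolding M_def
    proof (rule Carleman_imp_ratios_not_summable[where m = m, OF m_pos m_conv1])
      show "\<not> summable (\<lambda>d. m (Suc d) powr (- 1 / (2 * real (Suc d))))"
        using carleman_moments[OF carl, of j] m_pos unfolding m_def by blast
    qed
    moreover have "M n > 0" for n using m_pos by (simp add: M_def)
    moreover have "(M (Suc n))\<^sup>2 \<le> M n * M (Suc (Suc n))" for n
    proof -
      have "root 4 ((m (2 * Suc n))\<^sup>2) \<le> root 4 (m (2 * n) * m (2 * Suc (Suc n)))"
        using m_conv[of n "Suc (Suc n)"] by (simp add: mult_2)
      then show ?thesis by (simp only: M_def real_root_power real_root_mult)
    qed
    moreover have "\<exists>C>0. \<forall>n. \<rho>.nrm (\<lambda>y. monom_at y \<beta> * (y $ j) ^ n) \<le> C * M n" for \<beta>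
    proof -
      define K where "K = (LINT y|\<nu>. ((monom_at y \<beta>)\<^sup>2 * \<bar>eval_x G y\<bar>)\<^sup>2)"
      have monom: "monom_at y \<beta> = eval_x (Poly_Mapping.single \<beta> 1) y" for y by (simp add: eval_x_single)
      have int_K: "integrable \<nu> (\<lambda>y. ((monom_at y \<beta>)\<^sup>2 * \<bar>eval_x G y\<bar>)\<^sup>2)"
      proof -
        have "(\<lambda>y. ((monom_at y \<beta>)\<^sup>2 * \<bar>eval_x G y\<bar>)\<^sup>2) = eval_x ((Poly_Mapping.single \<beta> 1 ^ 2 * G) ^ 2)"
          unfolding fun_eq_iff eval_x_power eval_x_mult monom[symmetric] by (simp add: power_mult_distrib)
        then show ?thesis by (simp only: \<nu>.integrable_eval)
      qed
      \<comment> \<open>Adding 1 keeps the constant positive when \<open>K = 0\<close>.\<close>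
      have "\<rho>.nrm (\<lambda>y. monom_at y \<beta> * (y $ j) ^ n) \<le> (root 4 K + 1) * M n" for n
      proof -
        define I where "I = (LINT y|\<rho>. (monom_at y \<beta> * (y $ j) ^ n)\<^sup>2)"
        have "I = (LINT y|\<nu>. (y $ j) ^ (2 * n) * ((monom_at y \<beta>)\<^sup>2 * \<bar>eval_x G y\<bar>))"
          unfolding I_def \<rho>_def
          by (subst integral_density) (auto simp: power_mult_distrib mult_ac simp flip: power_mult)
        also have "\<dots>\<^sup>2 \<le> (LINT y|\<nu>. ((y $ j) ^ (2 * n))\<^sup>2) * K"
          unfolding K_def using int_pow int_K
          by (intro integral_Cauchy_Schwarz) (auto simp flip: power_mult)
        also have "(LINT y|\<nu>. ((y $ j) ^ (2 * n))\<^sup>2) = m (2 * n)"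
          by (simp add: m_def mult_ac flip: power_mult)
        finally have I: "I\<^sup>2 \<le> m (2 * n) * K" .
        have "I \<ge> 0" by (simp add: I_def)
        then have "sqrt I = sqrt (sqrt (I\<^sup>2))" by simp
        also have "\<dots> = root 4 (I\<^sup>2)" using real_root_mult_exp[of 2 2 "I\<^sup>2"] by (simp add: sqrt_def)
        also have "\<dots> \<le> root 4 (m (2 * n) * K)" using I by simp
        also have "\<dots> = root 4 K * M n" by (simp add: real_root_mult M_def)
        also have "\<dots> \<le> (root 4 K + 1) * M n" using m_pos[of "2 * n"] by (simp add: M_def mult_right_mono)
        finally show ?thesis by (simp add: \<rho>.nrm_def I_def)
      qed
      moreover have "K \<ge> 0" by (simp add: K_def)
      then have "root 4 K + 1 > 0" by (simp add: add_nonneg_pos)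
      ultimately show ?thesis by blast
    qed
    ultimately show ?thesis unfolding \<rho>.quasianalytic_def by blast
  qed
qed

text \<open>Replacing \<open>q\<close> by an approximable \<open>u\<close> changes the integral by
  that of \<open>(u - q) * (u + q) * G\<close>, which is small in the norm weighted by the absolute
  value of \<open>G\<close>. Cosine products then give the Gaussians centred at \<open>a\<close> by
  dominated convergence.\<close>

theorem carleman_poly_nonneg_on_support:
  fixes \<nu> :: "(real ^ 'm::finite) measure" and G :: "'m xpoly"
  assumes sets: "sets \<nu> = sets borel" and mom: "finite_moments \<nu>" and carl: "carleman \<nu>"
    and nonneg: "\<And>q. (LINT y|\<nu>. (eval_x q y)\<^sup>2 * eval_x G y) \<ge> 0"
    and a: "a \<in> measure_support \<nu>"
  shows "eval_x G a \<ge> 0"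
proof -
  interpret \<nu>: moment_measure \<nu> using sets mom by (simp add: moment_measure_def)
  define \<rho> where "\<rho> = density \<nu> (\<lambda>y. ennreal \<bar>eval_x G y\<bar>)"
  note \<rho>_props = quasianalytic_density[OF \<nu>.moment_measure_axioms carl, where G = G, folded \<rho>_def]
  interpret \<rho>: moment_measure \<rho> by (rule \<rho>_props)
  have int_\<rho>: "integrable \<nu> (\<lambda>y. f y * eval_x G y)" "\<bar>LINT y|\<nu>. f y * eval_x G y\<bar> \<le> (LINT y|\<rho>. \<bar>f y\<bar>)"
    if "integrable \<rho> f" for f
  proof -
    have [measurable]: "f \<in> borel_measurable borel" using borel_measurable_integrable[OF that] by simp
    have "integrable \<nu> (\<lambda>y. \<bar>eval_x G y\<bar> * f y)"
      using that unfolding \<rho>_def by (subst (asm) integrable_density) auto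
    then show int: "integrable \<nu> (\<lambda>y. f y * eval_x G y)"
      by (rule Bochner_Integration.integrable_bound) (auto simp: abs_mult)
    have "\<bar>LINT y|\<nu>. f y * eval_x G y\<bar> \<le> (LINT y|\<nu>. \<bar>f y * eval_x G y\<bar>)" by (rule integral_abs_bound)
    also have "\<dots> = (LINT y|\<rho>. \<bar>f y\<bar>)"
      unfolding \<rho>_def by (subst integral_density) (auto simp: abs_mult mult.commute)
    finally show "\<bar>LINT y|\<nu>. f y * eval_x G y\<bar> \<le> (LINT y|\<rho>. \<bar>f y\<bar>)" .
  qed
  have approx_nonneg: "(LINT y|\<nu>. (u y)\<^sup>2 * eval_x G y) \<ge> 0" if u: "\<rho>.approximable u" for u
  proof -
    obtain B where B: "\<And>y. \<bar>u y\<bar> \<le> B" using u by (auto simp: \<rho>.approximable_def)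
    have [measurable]: "u \<in> borel_measurable borel" using u by (simp add: \<rho>.approximable_def)
    interpret f: finite_measure \<rho> by (rule \<rho>.finite_measure)
    have L2_u: "\<rho>.L2 u"
    proof -
      have "integrable \<rho> (\<lambda>y. (u y)\<^sup>2)"
        by (rule f.integrable_const_bound[of _ "B\<^sup>2"]) (use power_mono[OF B abs_ge_zero, of _ 2] in auto)
      then show ?thesis by (simp add: \<rho>.L2_def)
    qed
    have "- (LINT y|\<nu>. (u y)\<^sup>2 * eval_x G y) \<le> e * (2 * \<rho>.nrm u + e)" if "e > 0" for e
    proof -
      have "\<rho>.poly_dist u \<le> 0" using u unfolding \<rho>.approximable_def by (auto dest: spec[of _ 0])
      obtain q where q: "\<rho>.nrm (\<lambda>y. u y - eval_x q y) < e"
      proof -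
        assume *: "\<And>q. \<rho>.nrm (\<lambda>y. u y - eval_x q y) < e \<Longrightarrow> thesis"
        have "\<rho>.poly_dist u < e" using \<open>\<rho>.poly_dist u \<le> 0\<close> \<open>e > 0\<close> by linarith
        then show thesis by (rule \<rho>.poly_dist_approx) (rule *)
      qed
      \<comment> \<open>\<open>?s\<close> is \<open>u + q\<close>, written through the difference
        \<open>?d\<close> so that its norm is controlled by those of \<open>u\<close> and
        \<open>?d\<close>.\<close>
      let ?d = "\<lambda>y. u y - eval_x q y" and ?s = "\<lambda>y. 2 * u y + -1 * (u y - eval_x q y)"
      have L2: "\<rho>.L2 ?d" "\<rho>.L2 ?s" "\<rho>.L2 (eval_x q)"
        by (intro \<rho>.L2_diff \<rho>.L2_add \<rho>.L2_cmult \<rho>.L2_eval L2_u)+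
      have ds: "integrable \<rho> (\<lambda>y. ?d y * ?s y)"
        using L2 by (intro integrable_product_of_squares) (auto simp: \<rho>.L2_def)
      have int: "integrable \<nu> (\<lambda>y. (u y)\<^sup>2 * eval_x G y)" "integrable \<nu> (\<lambda>y. (eval_x q y)\<^sup>2 * eval_x G y)"
        using L2_u L2(3) by (auto intro: int_\<rho>(1) simp: \<rho>.L2_def)
      have "(LINT y|\<nu>. (u y)\<^sup>2 * eval_x G y) - (LINT y|\<nu>. (eval_x q y)\<^sup>2 * eval_x G y) =
          (LINT y|\<nu>. (?d y * ?s y) * eval_x G y)"
        unfolding Bochner_Integration.integral_diff[OF int, symmetric]
        by (intro Bochner_Integration.integral_cong refl) (simp add: power2_eq_square algebra_simps)
      also have "\<dots> \<ge> - (LINT y|\<rho>. \<bar>?d y * ?s y\<bar>)"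
        using int_\<rho>(2)[OF ds] by linarith
      moreover have "(LINT y|\<rho>. \<bar>?d y * ?s y\<bar>) \<le> \<rho>.nrm ?d * \<rho>.nrm ?s"
      proof (rule power2_le_imp_le)
        have "(LINT y|\<rho>. \<bar>?d y\<bar> * \<bar>?s y\<bar>)\<^sup>2 \<le> (LINT y|\<rho>. \<bar>?d y\<bar>\<^sup>2) * (LINT y|\<rho>. \<bar>?s y\<bar>\<^sup>2)"
          using L2 by (intro integral_Cauchy_Schwarz) (auto simp: \<rho>.L2_def)
        then show "(LINT y|\<rho>. \<bar>?d y * ?s y\<bar>)\<^sup>2 \<le> (\<rho>.nrm ?d * \<rho>.nrm ?s)\<^sup>2"
          by (simp add: \<rho>.nrm_def power_mult_distrib abs_mult)
      qed (simp add: \<rho>.nrm_nonneg)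
      moreover have nrm_s: "\<rho>.nrm ?s \<le> 2 * \<rho>.nrm u + \<rho>.nrm ?d"
      proof -
        have "\<rho>.nrm ?s \<le> \<rho>.nrm (\<lambda>y. 2 * u y) + \<rho>.nrm (\<lambda>y. -1 * ?d y)"
          by (intro \<rho>.nrm_triangle \<rho>.L2_cmult L2_u L2)
        also have "\<dots> = 2 * \<rho>.nrm u + \<rho>.nrm ?d" unfolding \<rho>.nrm_cmult by simp
        finally show ?thesis .
      qed
      moreover have "\<rho>.nrm ?d * \<rho>.nrm ?s \<le> e * (2 * \<rho>.nrm u + e)"
        using q nrm_s \<open>e > 0\<close> by (intro mult_mono \<rho>.nrm_nonneg) linarith+
      ultimately show ?thesis using nonneg[of q] by linarith
    qed
    then have "\<forall>\<^sub>F e in at_right 0. - (LINT y|\<nu>. (u y)\<^sup>2 * eval_x G y) \<le> e * (2 * \<rho>.nrm u + e)"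
      by (auto simp: eventually_at_filter)
    moreover have "((\<lambda>e. e * (2 * \<rho>.nrm u + e)) \<longlongrightarrow> 0 * (2 * \<rho>.nrm u + 0)) (at_right 0)"
      by (intro tendsto_intros)
    ultimately have "- (LINT y|\<nu>. (u y)\<^sup>2 * eval_x G y) \<le> 0 * (2 * \<rho>.nrm u + 0)"
      by (intro tendsto_lowerbound) auto
    then show ?thesis by simp
  qed
  have "(LINT y|\<nu>. exp (- real k * (dist y a)\<^sup>2) * eval_x G y) \<ge> 0" for k
  proof -
    \<comment> \<open>With frequency \<open>sqrt (k / n)\<close> the \<open>n\<close>-th cosine
      power tends to a Gaussian with exponent \<open>k / 2\<close>; squaring \<open>u\<close>
      removes the 1/2.\<close>
    define t where "t n = sqrt (real k) / sqrt (real n)" for n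
    define u where "u n y = (\<Prod>j\<in>UNIV. cos (t n * y $ j + - t n * a $ j) ^ n)" for n and y :: "real ^ 'm"
    have "\<rho>.approximable (u n)" for n
      unfolding u_def by (intro \<rho>.approximable_cos_product \<rho>_props)
    then have "(LINT y|\<nu>. (u n y)\<^sup>2 * eval_x G y) \<ge> 0" for n by (rule approx_nonneg)
    moreover have "(\<lambda>n. LINT y|\<nu>. (u n y)\<^sup>2 * eval_x G y) \<longlonglongrightarrow> (LINT y|\<nu>. exp (- real k * (dist y a)\<^sup>2) * eval_x G y)"
    proof (rule integral_dominated_convergence)
      show "integrable \<nu> (\<lambda>y. \<bar>eval_x G y\<bar>)" by (intro integrable_abs \<nu>.integrable_eval)
      have "(\<lambda>n. (u n y)\<^sup>2 * eval_x G y) \<longlonglongrightarrow> exp (- real k * (dist y a)\<^sup>2) * eval_x G y" for y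
      proof (rule tendsto_mult_right)
        have "u n y = (\<Prod>j\<in>UNIV. cos (sqrt (real k) * (y $ j - a $ j) / sqrt (real n)) ^ n)" for n
          unfolding u_def t_def by (intro prod.cong refl) (simp add: algebra_simps diff_divide_distrib)
        then have "(\<lambda>n. (u n y)\<^sup>2) \<longlonglongrightarrow> (\<Prod>j\<in>UNIV. exp (- (sqrt (real k) * (y $ j - a $ j))\<^sup>2 / 2))\<^sup>2"
          by (simp only:) (intro tendsto_power tendsto_prod cos_power_tendsto_exp)
        also have "(\<Prod>j\<in>UNIV. exp (- (sqrt (real k) * (y $ j - a $ j))\<^sup>2 / 2))\<^sup>2 = exp (- real k * (dist y a)\<^sup>2)"
        proof -
          have "(dist y a)\<^sup>2 = (\<Sum>j\<in>UNIV. (y $ j - a $ j)\<^sup>2)"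
            by (simp add: dist_vec_def L2_set_def dist_real_def sum_nonneg)
          then have "exp (- real k * (dist y a)\<^sup>2) = exp (\<Sum>j\<in>UNIV. - (sqrt (real k) * (y $ j - a $ j))\<^sup>2)"
            by (simp add: power_mult_distrib sum_distrib_left sum_negf)
          also have "\<dots> = (\<Prod>j\<in>UNIV. exp (- (sqrt (real k) * (y $ j - a $ j))\<^sup>2 / 2) ^ 2)"
            by (simp add: exp_sum flip: exp_double)
          finally show ?thesis by (simp add: prod_power_distrib)
        qed
        finally show "(\<lambda>n. (u n y)\<^sup>2) \<longlonglongrightarrow> exp (- real k * (dist y a)\<^sup>2)" .
      qed
      then show "AE y in \<nu>. (\<lambda>n. (u n y)\<^sup>2 * eval_x G y) \<longlonglongrightarrow> exp (- real k * (dist y a)\<^sup>2) * eval_x G y" by simp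
      have "\<bar>u n y\<bar> \<le> 1" for n y
        unfolding u_def abs_prod by (intro prod_le_1) (auto simp: power_abs power_le_one)
      then have "(u n y)\<^sup>2 \<le> 1" for n y by (simp add: abs_square_le_1)
      then show "AE y in \<nu>. norm ((u n y)\<^sup>2 * eval_x G y) \<le> \<bar>eval_x G y\<bar>" for n
        by (auto simp: abs_mult intro!: mult_left_le_one_le)
      have [measurable]: "u n \<in> borel_measurable borel" for n
        using \<open>\<And>n. \<rho>.approximable (u n)\<close>[of n] by (simp add: \<rho>.approximable_def)
      show "(\<lambda>y. (u n y)\<^sup>2 * eval_x G y) \<in> borel_measurable \<nu>" for n by simp
      show "(\<lambda>y. exp (- real k * (dist y a)\<^sup>2) * eval_x G y) \<in> borel_measurable \<nu>" by simp
    qed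
    ultimately show ?thesis by (intro LIMSEQ_le_const) auto
  qed
  then show ?thesis
    using a \<nu>.finite_measure continuous_on_eval_x[of UNIV G]
    by (intro Gaussian_peak_nonneg[OF sets _ \<nu>.integrable_eval]) (auto simp: continuous_on_eq_continuous_at)
qed

subsection \<open>Moment sequences and the quadratic module\<close>

text \<open>The complement of the support is the union of all open null sets, and by the Lindelof
  property countably many of them suffice.\<close>

lemma AE_measure_support:
  fixes \<mu> :: "'a::second_countable_topology measure"
  assumes sets: "sets \<mu> = sets borel"
  shows "AE x in \<mu>. x \<in> measure_support \<mu>"
proof -
  define F where "F = {U. open U \<and> emeasure \<mu> U = 0}"
  obtain F' where F': "F' \<subseteq> F" "countable F'" "\<Union>F' = \<Union>F"
    using Lindelof[of F] by (auto simp: F_def)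
  have "\<Union>F' \<in> null_sets \<mu>"
  proof -
    have "U \<in> null_sets \<mu>" if "U \<in> F'" for U
      using that F'(1) by (intro null_setsI) (auto simp: F_def sets)
    then show ?thesis using null_sets_UN'[OF F'(2), of id] by simp
  qed
  then show ?thesis
    by (rule AE_I') (auto simp: F' F_def measure_support_def zero_less_iff_neq_zero)
qed

text \<open>With \<open>C \<ge> 1\<close> bounding the mass, the moment of order
  \<open>2 * d\<close> is at most \<open>(r * C) ^ (2 * d)\<close>. Every term of the Carleman
  series is thus at least \<open>1 / (r * C)\<close>.\<close>

lemma carleman_bounded_support:
  fixes \<mu> :: "(real ^ 'n::finite) measure"
  assumes \<mu>: "moment_measure \<mu>" and bound: "AE x in \<mu>. \<forall>i. \<bar>x $ i\<bar> \<le> r" and r: "r > 0"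
  shows "carleman \<mu>"
  unfolding carleman_def
proof
  fix j
  interpret moment_measure \<mu> by fact
  interpret finite_measure \<mu> by (rule finite_measure)
  define C where "C = max 1 (measure \<mu> (space \<mu>))"
  define \<kappa> where "\<kappa> = 1 / (r * C)"
  have C: "C \<ge> 1" "measure \<mu> (space \<mu>) \<le> C" by (simp_all add: C_def)
  have \<kappa>: "\<kappa> > 0" using C r by (simp add: \<kappa>_def)
  let ?f = "\<lambda>e. let d = Suc e; M = (LINT x|\<mu>. (x $ j) ^ (2 * d)) in
      if M = 0 then \<infinity> else ennreal (M powr (- 1 / (2 * real d)))"
  have f_ge: "ennreal \<kappa> \<le> ?f e" for e
  proof -
    define d where "d = Suc e"
    define M where "M = (LINT x|\<mu>. (x $ j) ^ (2 * d))"
    have "ennreal \<kappa> \<le> ennreal (M powr (- 1 / (2 * real d)))" if "M \<noteq> 0"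
    proof (rule ennreal_leI)
      have int: "integrable \<mu> (\<lambda>x. (x $ j) ^ (2 * d))"
        using integrable_monom[of "Poly_Mapping.single j (2 * d)"] by (simp add: monom_at_single)
      have "M \<ge> 0" by (simp add: M_def power_mult)
      with that have M: "M > 0" by simp
      have "M \<le> (LINT x|\<mu>. r ^ (2 * d))"
        unfolding M_def
      proof (rule integral_mono_AE[OF int])
        show "AE x in \<mu>. (x $ j) ^ (2 * d) \<le> r ^ (2 * d)"
          using bound
        proof eventually_elim
          case (elim x)
          then have "\<bar>x $ j\<bar> ^ (2 * d) \<le> r ^ (2 * d)" by (intro power_mono) auto
          then show ?case by (simp add: power_even_abs)
        qed
      qed simp
      also have "\<dots> \<le> C * r ^ (2 * d)" using C r by (simp add: mult_right_mono)
      also have "\<dots> \<le> C ^ (2 * d) * r ^ (2 * d)"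
      proof (rule mult_right_mono)
        show "C \<le> C ^ (2 * d)" using C(1) by (rule self_le_power) (simp add: d_def)
      qed (use r in simp)
      finally have le: "M \<le> (r * C) ^ (2 * d)" by (simp add: power_mult_distrib mult.commute)
      have "\<kappa> = ((r * C) ^ (2 * d)) powr (- 1 / (2 * real d))"
      proof -
        have "((r * C) ^ (2 * d)) powr (- 1 / (2 * real d)) = (r * C) powr (real (2 * d) * (- 1 / (2 * real d)))"
          by (subst powr_realpow[symmetric]) (use r C in simp, rule powr_powr)
        moreover have "real (2 * d) * (- 1 / (2 * real d)) = - 1" by (simp add: d_def)
        ultimately show ?thesis using r C by (simp only: \<kappa>_def powr_minus_divide) simp
      qed
      also have "\<dots> \<le> M powr (- 1 / (2 * real d))"
        using M le by (intro powr_mono2') auto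
      finally show "\<kappa> \<le> M powr (- 1 / (2 * real d))" .
    qed
    then show ?thesis by (simp add: Let_def M_def d_def del: mult_Suc_right)
  qed
  show "suminf ?f = \<infinity>"
  proof (rule ccontr)
    assume "suminf ?f \<noteq> \<infinity>"
    then obtain s where s: "suminf ?f = ennreal s" "s \<ge> 0" by (cases "suminf ?f") auto
    obtain n :: nat where n: "s < real n * \<kappa>" using \<kappa> reals_Archimedean3 by blast
    have "ennreal (real n * \<kappa>) = (\<Sum>e<n. ennreal \<kappa>)"
      using \<kappa> by (simp add: ennreal_mult ennreal_of_nat_eq_real_of_nat)
    also have "\<dots> \<le> (\<Sum>e<n. ?f e)" by (intro sum_mono f_ge)
    also have "\<dots> \<le> suminf ?f" by (intro sum_le_suminf) auto
    finally show False using s n by (simp add: ennreal_le_iff)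
  qed
qed

lemma riesz_eq_integral:
  assumes "\<And>\<alpha>. integrable \<mu> (\<lambda>x. monom_at x \<alpha>)" "\<And>\<alpha>. z \<alpha> = (LINT x|\<mu>. monom_at x \<alpha>)"
  shows "riesz z f = (LINT x|\<mu>. eval_x f x)"
  using assms by (simp add: riesz_def eval_x_def)

lemma sos_mult_square:
  assumes "\<tau> \<in> sos"
  shows "p\<^sup>2 * \<tau> \<in> sos"
proof -
  obtain qs where "\<tau> = (\<Sum>q\<leftarrow>qs. q\<^sup>2)" using assms by (auto simp: sos_def)
  then have "p\<^sup>2 * \<tau> = (\<Sum>q\<leftarrow>map ((*) p) qs. q\<^sup>2)"
    by (simp add: sum_list_const_mult o_def power_mult_distrib)
  then show ?thesis unfolding sos_def by blast
qed

text \<open>A square in \<open>x\<close> passes under the integral over \<open>y\<close> and joins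
  the multipliers.\<close>

lemma QM_mult_square:
  assumes "f \<in> QM s g \<nu>"
  shows "p\<^sup>2 * f \<in> QM s g \<nu>"
proof -
  obtain \<tau> where f: "f = (\<Sum>j\<le>s. integral_y \<nu> (\<tau> j * g j))" and \<tau>: "\<forall>j\<le>s. \<tau> j \<in> sos"
    using assms by (auto simp: QM_def)
  have "integral_y \<nu> ((emb_x p)\<^sup>2 * \<tau> j * g j) = p\<^sup>2 * integral_y \<nu> (\<tau> j * g j)" for j
    by (simp only: power2_eq_square mult.assoc integral_y_emb_x)
  then have "p\<^sup>2 * f = (\<Sum>j\<le>s. integral_y \<nu> ((emb_x p)\<^sup>2 * \<tau> j * g j))"
    by (simp only: f sum_distrib_left)
  moreover have "\<forall>j\<le>s. (emb_x p)\<^sup>2 * \<tau> j \<in> sos" using \<tau> by (simp add: sos_mult_square)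
  ultimately show ?thesis
    unfolding QM_def by (intro CollectI exI[of _ "\<lambda>j. (emb_x p)\<^sup>2 * \<tau> j"] conjI)
qed

lemma section_poly:
  fixes h :: "('n::finite, 'm::finite) xypoly"
  shows "\<exists>H. \<forall>x. eval_x H x = eval_xy h x y" "\<exists>H. \<forall>y. eval_x H y = eval_xy h x y"
proof -
  show "\<exists>H. \<forall>x. eval_x H x = eval_xy h x y"
  proof (induction h rule: poly_mapping_induct_add)
    case (single ab c)
    show ?case by (rule exI[of _ "Poly_Mapping.single (fst ab) (c * monom_at y (snd ab))"])
        (simp add: eval_x_single eval_xy_single)
  next
    case (add f g)
    then obtain F G where "\<forall>x. eval_x F x = eval_xy f x y" "\<forall>x. eval_x G x = eval_xy g x y" by blast
    then show ?case by (intro exI[of _ "F + G"]) (simp add: eval_x_add eval_xy_add)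
  qed
  show "\<exists>H. \<forall>y. eval_x H y = eval_xy h x y"
  proof (induction h rule: poly_mapping_induct_add)
    case (single ab c)
    show ?case by (rule exI[of _ "Poly_Mapping.single (snd ab) (c * monom_at x (fst ab))"])
        (simp add: eval_x_single eval_xy_single)
  next
    case (add f g)
    then obtain F G where "\<forall>y. eval_x F y = eval_xy f x y" "\<forall>y. eval_x G y = eval_xy g x y" by blast
    then show ?case by (intro exI[of _ "F + G"]) (simp add: eval_x_add eval_xy_add)
  qed
qed

text \<open>Fubini by linearity: for one monomial of \<open>h\<close> both iterated integrals factor
  into an integral over \<open>x\<close> and one over \<open>y\<close>. The polynomial
  \<open>G\<close> is the one to be tested on the support of \<open>\<nu>\<close>.\<close>

lemma weighted_integral_poly:
  fixes h :: "('n::finite, 'm::finite) xypoly"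
  assumes \<mu>: "moment_measure \<mu>" and \<nu>: "moment_measure \<nu>"
  obtains G where "\<And>y. eval_x G y = (LINT x|\<mu>. (eval_x a x)\<^sup>2 * eval_xy h x y)"
    "\<And>q. (LINT y|\<nu>. (eval_x q y)\<^sup>2 * eval_x G y) =
      (LINT x|\<mu>. (eval_x a x)\<^sup>2 * (LINT y|\<nu>. (eval_x q y)\<^sup>2 * eval_xy h x y))"
proof -
  interpret \<mu>: moment_measure \<mu> by fact
  interpret \<nu>: moment_measure \<nu> by fact
  have int_x: "integrable \<mu> (\<lambda>x. (eval_x a x)\<^sup>2 * eval_xy h x y)" for h :: "('n, 'm) xypoly" and y
  proof -
    obtain H where "\<And>x. eval_x H x = eval_xy h x y" using section_poly(1) by blast
    then show ?thesis
      using \<mu>.integrable_eval[of "a\<^sup>2 * H"] by (simp add: eval_x_mult[abs_def] eval_x_power)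
  qed
  have int_y: "integrable \<nu> (\<lambda>y. (eval_x q y)\<^sup>2 * eval_xy h x y)" for h :: "('n, 'm) xypoly" and x q
  proof -
    obtain H where "\<And>y. eval_x H y = eval_xy h x y" using section_poly(2) by blast
    then show ?thesis
      using \<nu>.integrable_eval[of "q\<^sup>2 * H"] by (simp add: eval_x_mult[abs_def] eval_x_power)
  qed
  have int_q: "integrable \<nu> (\<lambda>y. (eval_x q y)\<^sup>2 * eval_x f y)" for q f
    using \<nu>.integrable_eval[of "q\<^sup>2 * f"] by (simp add: eval_x_mult[abs_def] eval_x_power)
  have int_xy: "integrable \<mu> (\<lambda>x. (eval_x a x)\<^sup>2 * (LINT y|\<nu>. (eval_x q y)\<^sup>2 * eval_xy h x y))"
    for h :: "('n, 'm) xypoly" and q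
  proof -
    have eq: "eval_x (a\<^sup>2 * integral_y \<nu> ((emb_y q)\<^sup>2 * h)) =
        (\<lambda>x. (eval_x a x)\<^sup>2 * (LINT y|\<nu>. (eval_x q y)\<^sup>2 * eval_xy h x y))"
      unfolding fun_eq_iff eval_x_mult eval_x_power eval_integral_y[OF \<nu>.moments] eval_xy_mult eval_xy_power2 eval_emb_y by simp
    show ?thesis using \<mu>.integrable_eval[of "a\<^sup>2 * integral_y \<nu> ((emb_y q)\<^sup>2 * h)"] unfolding eq .
  qed
  have "\<exists>G. (\<forall>y. eval_x G y = (LINT x|\<mu>. (eval_x a x)\<^sup>2 * eval_xy h x y)) \<and>
    (\<forall>q. (LINT y|\<nu>. (eval_x q y)\<^sup>2 * eval_x G y) =
      (LINT x|\<mu>. (eval_x a x)\<^sup>2 * (LINT y|\<nu>. (eval_x q y)\<^sup>2 * eval_xy h x y)))"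
  proof (induction h rule: poly_mapping_induct_add)
    case (single ab c)
    define A where "A = (LINT x|\<mu>. (eval_x a x)\<^sup>2 * monom_at x (fst ab))"
    show ?case
    proof (intro exI[of _ "Poly_Mapping.single (snd ab) (c * A)"] conjI allI)
      fix y
      have "(LINT x|\<mu>. (eval_x a x)\<^sup>2 * eval_xy (Poly_Mapping.single ab c) x y) =
          (LINT x|\<mu>. c * monom_at y (snd ab) * ((eval_x a x)\<^sup>2 * monom_at x (fst ab)))"
        by (simp add: eval_xy_single mult_ac)
      then show "eval_x (Poly_Mapping.single (snd ab) (c * A)) y =
          (LINT x|\<mu>. (eval_x a x)\<^sup>2 * eval_xy (Poly_Mapping.single ab c) x y)"
        by (simp add: A_def eval_x_single)
    next
      fix q
      define B where "B = (LINT y|\<nu>. (eval_x q y)\<^sup>2 * monom_at y (snd ab))"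
      have "(LINT y|\<nu>. (eval_x q y)\<^sup>2 * eval_xy (Poly_Mapping.single ab c) x y) = c * monom_at x (fst ab) * B" for x
      proof -
        have "(LINT y|\<nu>. (eval_x q y)\<^sup>2 * eval_xy (Poly_Mapping.single ab c) x y) =
            (LINT y|\<nu>. c * monom_at x (fst ab) * ((eval_x q y)\<^sup>2 * monom_at y (snd ab)))"
          by (simp add: eval_xy_single mult_ac)
        then show ?thesis by (simp add: B_def)
      qed
      then have "(LINT x|\<mu>. (eval_x a x)\<^sup>2 * (LINT y|\<nu>. (eval_x q y)\<^sup>2 * eval_xy (Poly_Mapping.single ab c) x y)) =
          (LINT x|\<mu>. c * B * ((eval_x a x)\<^sup>2 * monom_at x (fst ab)))"
        by (simp add: mult_ac)
      also have "\<dots> = c * B * A" by (simp add: A_def)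
      also have "c * B * A = (LINT y|\<nu>. c * A * ((eval_x q y)\<^sup>2 * monom_at y (snd ab)))"
        by (simp add: B_def)
      also have "\<dots> = (LINT y|\<nu>. (eval_x q y)\<^sup>2 * eval_x (Poly_Mapping.single (snd ab) (c * A)) y)"
        by (simp add: eval_x_single mult_ac)
      finally show "(LINT y|\<nu>. (eval_x q y)\<^sup>2 * eval_x (Poly_Mapping.single (snd ab) (c * A)) y) =
          (LINT x|\<mu>. (eval_x a x)\<^sup>2 * (LINT y|\<nu>. (eval_x q y)\<^sup>2 * eval_xy (Poly_Mapping.single ab c) x y))" ..
    qed
  next
    case (add f g)
    then obtain F G where
      F: "\<And>y. eval_x F y = (LINT x|\<mu>. (eval_x a x)\<^sup>2 * eval_xy f x y)"
        "\<And>q. (LINT y|\<nu>. (eval_x q y)\<^sup>2 * eval_x F y) =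
          (LINT x|\<mu>. (eval_x a x)\<^sup>2 * (LINT y|\<nu>. (eval_x q y)\<^sup>2 * eval_xy f x y))" and
      G: "\<And>y. eval_x G y = (LINT x|\<mu>. (eval_x a x)\<^sup>2 * eval_xy g x y)"
        "\<And>q. (LINT y|\<nu>. (eval_x q y)\<^sup>2 * eval_x G y) =
          (LINT x|\<mu>. (eval_x a x)\<^sup>2 * (LINT y|\<nu>. (eval_x q y)\<^sup>2 * eval_xy g x y))"
      by blast
    show ?case
    proof (intro exI[of _ "F + G"] conjI allI)
      show "eval_x (F + G) y = (LINT x|\<mu>. (eval_x a x)\<^sup>2 * eval_xy (f + g) x y)" for y
        using int_x by (simp add: eval_x_add eval_xy_add distrib_left F(1) G(1))
      show "(LINT y|\<nu>. (eval_x q y)\<^sup>2 * eval_x (F + G) y) =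
          (LINT x|\<mu>. (eval_x a x)\<^sup>2 * (LINT y|\<nu>. (eval_x q y)\<^sup>2 * eval_xy (f + g) x y))" for q
      proof -
        have "(LINT y|\<nu>. (eval_x q y)\<^sup>2 * eval_x (F + G) y) =
            (LINT y|\<nu>. (eval_x q y)\<^sup>2 * eval_x F y) + (LINT y|\<nu>. (eval_x q y)\<^sup>2 * eval_x G y)"
          unfolding eval_x_add distrib_left by (rule Bochner_Integration.integral_add) (rule int_q)+
        also have "\<dots> = (LINT x|\<mu>. (eval_x a x)\<^sup>2 * (LINT y|\<nu>. (eval_x q y)\<^sup>2 * eval_xy f x y) +
            (eval_x a x)\<^sup>2 * (LINT y|\<nu>. (eval_x q y)\<^sup>2 * eval_xy g x y))"
          unfolding F(2) G(2) by (rule Bochner_Integration.integral_add[symmetric]) (rule int_xy)+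
        also have "\<dots> = (LINT x|\<mu>. (eval_x a x)\<^sup>2 * (LINT y|\<nu>. (eval_x q y)\<^sup>2 * eval_xy (f + g) x y))"
          unfolding eval_xy_add distrib_left
          by (subst Bochner_Integration.integral_add[OF int_y int_y]) (simp add: distrib_left)
        finally show ?thesis .
      qed
    qed
  qed
  then show thesis using that by blast
qed

section \<open>The two directions of the moment characterization\<close>

lemma moment_sequence_imp_nonneg:
  fixes g :: "nat \<Rightarrow> ('n::finite, 'm::finite) xypoly"
  assumes "moment_sequence (nonneg_set s g (measure_support \<nu>)) z"
    and "sets \<nu> = sets borel" "finite_moments \<nu>" "g 0 = 1" "j \<le> s"
  shows "riesz z (integral_y \<nu> (p\<^sup>2 * g j)) \<ge> 0"
proof -
  obtain \<mu> where \<mu>: "sets \<mu> = sets borel" "measure_support \<mu> \<subseteq> nonneg_set s g (measure_support \<nu>)"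
    "\<And>\<alpha>. integrable \<mu> (\<lambda>x. monom_at x \<alpha>)" "\<And>\<alpha>. z \<alpha> = (LINT x|\<mu>. monom_at x \<alpha>)"
    using assms(1) unfolding moment_sequence_def by auto
  have "AE x in \<mu>. 0 \<le> eval_x (integral_y \<nu> (p\<^sup>2 * g j)) x"
    using AE_measure_support[OF \<mu>(1)]
  proof eventually_elim
    case (elim x)
    then have x: "x \<in> nonneg_set s g (measure_support \<nu>)" using \<mu>(2) by blast
    \<comment> \<open>The set only constrains indices from 1 on; index 0 is covered by
      \<open>g 0 = 1\<close>.\<close>
    have g: "eval_xy (g j) x y \<ge> 0" if "y \<in> measure_support \<nu>" for y
    proof (cases "j = 0")
      case True
      then show ?thesis using assms(4) eval_xy_single[of 0 1 x y] by simp
    next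
      case False
      then show ?thesis using x that \<open>j \<le> s\<close> by (simp add: nonneg_set_def)
    qed
    have "AE y in \<nu>. 0 \<le> eval_xy (p\<^sup>2 * g j) x y"
      using AE_measure_support[OF assms(2)]
      by eventually_elim (simp add: eval_xy_mult eval_xy_power2 g)
    then show ?case unfolding eval_integral_y[OF assms(3)] by (rule integral_nonneg_AE)
  qed
  then show ?thesis unfolding riesz_eq_integral[OF \<mu>(3,4)] by (rule integral_nonneg_AE)
qed

text \<open>Adding the squares of the other variables turns the ball inequality into
  \<open>N\<close> minus the square of \<open>var_x i\<close>. With \<open>r = sqrt N\<close> this
  is \<open>4 * N\<close> times \<open>box_var r i * (1 - box_var r i)\<close>.\<close>

lemma archimedean_imp_box_positive:
  fixes g :: "nat \<Rightarrow> ('n::finite, 'm::finite) xypoly"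
  assumes fm: "finite_measure \<nu>" and mom: "finite_moments \<nu>" and g0: "g 0 = 1"
    and arch: "archimedean (QM s g \<nu>)" and nonneg: "\<And>f. f \<in> QM s g \<nu> \<Longrightarrow> riesz z f \<ge> 0"
  obtains r where "r > 0" "box_positive (box_var r) (riesz z)"
proof -
  interpret finite_measure \<nu> by fact
  let ?X = "\<Sum>i\<in>UNIV. (var_x i)\<^sup>2 :: 'n xpoly"
  obtain N :: nat where N: "N > 0" "of_nat N - ?X \<in> QM s g \<nu>"
    using arch by (auto simp: archimedean_def)
  define c where "c = measure \<nu> (space \<nu>)"
  \<comment> \<open>For null \<open>\<nu>\<close> every element of the module vanishes as a
    function, but the archimedean element has value \<open>N > 0\<close> at the origin.\<close>
  have "c \<noteq> 0"
  proof
    assume "c = 0"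
    then have "emeasure \<nu> (space \<nu>) = 0" by (simp add: c_def emeasure_eq_measure)
    then have null: "AE y in \<nu>. P y" for P by (intro AE_I[of _ _ "space \<nu>"]) auto
    have "eval_x (integral_y \<nu> h) x = 0" for h :: "('n, 'm) xypoly" and x
      unfolding eval_integral_y[OF mom] by (intro integral_eq_zero_AE null)
    then have "eval_x (of_nat N - ?X) 0 = 0"
      using N(2) by (auto simp: QM_def eval_x_sum)
    moreover have "eval_x (of_nat N - ?X) 0 = real N"
      using eval_x_single[of 0 "real N" 0]
      by (simp add: eval_x_diff eval_x_sum eval_x_power eval_x_var)
    ultimately show False using N(1) by simp
  qed
  then have c: "c > 0" by (simp add: c_def less_le)
  have lin: "linear_functional (riesz z)" by (simp add: linear_functional_def riesz_add riesz_scale)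
  have QM_iff: "\<forall>j\<le>s. \<forall>p. riesz z (integral_y \<nu> (p\<^sup>2 * g j)) \<ge> 0"
    using riesz_nonneg_on_QM_iff[of s g \<nu> z] nonneg by blast
  \<comment> \<open>A square in \<open>x\<close> integrates over \<open>y\<close> to
    \<open>c\<close> times itself; dividing by the mass \<open>c\<close> recovers the plain
    square.\<close>
  have sq: "riesz z (p\<^sup>2) \<ge> 0" for p
  proof -
    have "integral_y \<nu> (1 :: ('n, 'm) xypoly) = const_poly c"
      using integral_y_single[of \<nu> "0 :: 'n expo \<times> 'm expo" 1] by (simp add: c_def)
    moreover have "(emb_x p)\<^sup>2 * g 0 = emb_x p * (emb_x p * 1)"
      by (simp only: g0 power2_eq_square mult_1_right)
    ultimately have "integral_y \<nu> ((emb_x p)\<^sup>2 * g 0) = const_poly c * p\<^sup>2"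
      by (simp only: integral_y_emb_x power2_eq_square mult.assoc mult.commute[of "const_poly c"])
    then have "c * riesz z (p\<^sup>2) = riesz z (integral_y \<nu> ((emb_x p)\<^sup>2 * g 0))" by (simp only: riesz_scale)
    also have "\<dots> \<ge> 0" using QM_iff by blast
    finally have "c * riesz z (p\<^sup>2) \<ge> 0" .
    with c show ?thesis by (simp add: zero_le_mult_iff)
  qed
  define r where "r = sqrt (real N)"
  have r: "r > 0" "r\<^sup>2 = real N" using N(1) by (simp_all add: r_def)
  have ball: "riesz z (p\<^sup>2 * (of_nat N - (var_x i)\<^sup>2)) \<ge> 0" for p i
  proof -
    have "p\<^sup>2 * (of_nat N - (var_x i)\<^sup>2) = p\<^sup>2 * (of_nat N - ?X) + (\<Sum>k\<in>UNIV - {i}. (p * var_x k)\<^sup>2)"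
      by (simp add: sum.remove[of UNIV i] power_mult_distrib right_diff_distrib distrib_left flip: sum_distrib_left)
    moreover have "riesz z (p\<^sup>2 * (of_nat N - ?X)) \<ge> 0" by (intro nonneg QM_mult_square N)
    moreover have "riesz z (\<Sum>k\<in>UNIV - {i}. (p * var_x k)\<^sup>2) \<ge> 0"
      unfolding riesz_sum by (intro sum_nonneg sq)
    ultimately show ?thesis by (simp add: riesz_add)
  qed
  have "riesz z (p\<^sup>2 * (box_var r i * (1 - box_var r i))) \<ge> 0" for p i
  proof -
    let ?a = "const_poly (1 / 2) :: 'n xpoly" and ?b = "const_poly (1 / (2 * r)) :: 'n xpoly"
    have one: "(1 :: 'n xpoly) = ?a + ?a" by (simp flip: single_add)
    have a2: "?a * ?a = const_poly (1 / (4 * real N)) * of_nat N"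
      using N(1) by (simp add: mult_single flip: single_of_nat)
    have b2: "?b * ?b = const_poly (1 / (4 * real N))"
      using r by (simp add: mult_single power2_eq_square)
    have "box_var r i * (1 - box_var r i) = ?a * ?a - ?b * ?b * (var_x i)\<^sup>2"
      unfolding box_var_def by (subst one) (simp add: algebra_simps power2_eq_square)
    also have "\<dots> = const_poly (1 / (4 * real N)) * (of_nat N - (var_x i)\<^sup>2)"
      unfolding a2 b2 by (simp add: right_diff_distrib)
    finally have "p\<^sup>2 * (box_var r i * (1 - box_var r i)) =
        const_poly (1 / (4 * real N)) * (p\<^sup>2 * (of_nat N - (var_x i)\<^sup>2))" by (simp add: mult_ac)
    then show ?thesis using ball[of p i] by (simp add: riesz_scale)
  qed
  with lin sq r(1) show thesis by (intro that[of r]) (simp_all add: box_positive_def)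
qed

text \<open>Testing with squares of products \<open>a * q\<close>, with \<open>a\<close> in
  \<open>x\<close> and \<open>q\<close> in \<open>y\<close>, separates the variables. For fixed
  \<open>a\<close>, varying \<open>q\<close> gives nonnegativity of the \<open>\<mu>\<close>-average
  at each \<open>y\<close> in the support of \<open>\<nu>\<close>; for fixed \<open>y\<close>,
  varying \<open>a\<close> then gives it at each \<open>x\<close> in the support of
  \<open>\<mu>\<close>.\<close>

lemma nonneg_imp_moment_sequence:
  fixes g :: "nat \<Rightarrow> ('n::finite, 'm::finite) xypoly"
  assumes sets: "sets \<nu> = sets borel" and fm: "finite_measure \<nu>" and mom: "finite_moments \<nu>"
    and carl: "carleman \<nu>" and g0: "g 0 = 1" and arch: "archimedean (QM s g \<nu>)"
    and nonneg: "\<And>f. f \<in> QM s g \<nu> \<Longrightarrow> riesz z f \<ge> 0"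
  shows "moment_sequence (nonneg_set s g (measure_support \<nu>)) z"
proof -
  have \<nu>: "moment_measure \<nu>" using sets mom by (simp add: moment_measure_def)
  obtain r where r: "r > 0" "box_positive (box_var r) (riesz z)"
    using archimedean_imp_box_positive[OF fm mom g0 arch nonneg] by blast
  obtain \<mu> where \<mu>: "finite_measure \<mu>" "sets \<mu> = sets borel" "AE x in \<mu>. \<forall>i. \<bar>x $ i\<bar> \<le> r"
    "\<And>f. integrable \<mu> (eval_x f)" "\<And>f. riesz z f = (LINT x|\<mu>. eval_x f x)"
    by (rule box_moment_problem[OF r(2,1)]) (rule that)
  have monom: "(\<lambda>x. monom_at x \<alpha>) = eval_x (Poly_Mapping.single \<alpha> 1)" for \<alpha> :: "'n expo"
    by (simp add: fun_eq_iff eval_x_single)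
  have \<mu>_mom: "finite_moments \<mu>" unfolding finite_moments_def monom using \<mu>(4) by blast
  then have mm: "moment_measure \<mu>" using \<mu>(2) by (simp add: moment_measure_def)
  have \<mu>_carl: "carleman \<mu>" using mm \<mu>(3) r(1) by (rule carleman_bounded_support)
  have "measure_support \<mu> \<subseteq> nonneg_set s g (measure_support \<nu>)"
  proof
    fix x assume x: "x \<in> measure_support \<mu>"
    show "x \<in> nonneg_set s g (measure_support \<nu>)"
      unfolding nonneg_set_def
    proof (intro CollectI ballI)
      fix j y assume j: "j \<in> {1..s}" and y: "y \<in> measure_support \<nu>"
      obtain H where H: "\<And>x. eval_x H x = eval_xy (g j) x y" using section_poly(1) by blast
      have "(LINT x|\<mu>. (eval_x a x)\<^sup>2 * eval_x H x) \<ge> 0" for a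
      proof -
        obtain G where G: "\<And>y. eval_x G y = (LINT x|\<mu>. (eval_x a x)\<^sup>2 * eval_xy (g j) x y)"
          and swap: "\<And>q. (LINT y|\<nu>. (eval_x q y)\<^sup>2 * eval_x G y) =
            (LINT x|\<mu>. (eval_x a x)\<^sup>2 * (LINT y|\<nu>. (eval_x q y)\<^sup>2 * eval_xy (g j) x y))"
          by (rule weighted_integral_poly[OF mm \<nu>]) (rule that)
        have "(LINT y|\<nu>. (eval_x q y)\<^sup>2 * eval_x G y) \<ge> 0" for q
        proof -
          have "riesz z (integral_y \<nu> ((emb_x a * emb_y q)\<^sup>2 * g j)) \<ge> 0"
            using riesz_nonneg_on_QM_iff[of s g \<nu> z] nonneg j by auto
          also have "riesz z (integral_y \<nu> ((emb_x a * emb_y q)\<^sup>2 * g j)) =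
              (LINT x|\<mu>. (eval_x a x)\<^sup>2 * (LINT y|\<nu>. (eval_x q y)\<^sup>2 * eval_xy (g j) x y))"
          proof -
            have eq: "eval_xy ((emb_x a * emb_y q)\<^sup>2 * g j) x =
                (\<lambda>y. (eval_x a x)\<^sup>2 * ((eval_x q y)\<^sup>2 * eval_xy (g j) x y))" for x
              by (simp add: fun_eq_iff eval_xy_mult eval_xy_power2 eval_emb_x eval_emb_y power_mult_distrib)
            show ?thesis unfolding \<mu>(5) eval_integral_y[OF mom] eq by simp
          qed
          finally show ?thesis unfolding swap .
        qed
        from carleman_poly_nonneg_on_support[OF sets mom carl this y]
        show ?thesis unfolding G H .
      qed
      from carleman_poly_nonneg_on_support[OF \<mu>(2) \<mu>_mom \<mu>_carl this x]
      show "0 \<le> eval_xy (g j) x y" unfolding H .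
    qed
  qed
  moreover have "integrable \<mu> (\<lambda>x. monom_at x \<alpha>) \<and> z \<alpha> = (LINT x|\<mu>. monom_at x \<alpha>)" for \<alpha>
    unfolding monom using \<mu>(4) \<mu>(5)[of "Poly_Mapping.single \<alpha> 1"] by (simp add: riesz_single)
  ultimately show ?thesis unfolding moment_sequence_def using \<mu>(1,2) by blast
qed

theorem theorem4p4:
  fixes Q :: "(real ^ 'm::finite) set"
    and s :: nat
    and g :: "nat \<Rightarrow> ('n::finite, 'm) xypoly"
    and K :: "(real ^ 'n) set"
    and \<nu> :: "(real ^ 'm) measure"
    and z :: "'n expo \<Rightarrow> real"
  assumes "closed Q"
    and "g 0 = 1"
    and "K = nonneg_set s g Q"
    and "sets \<nu> = sets borel"
    and "finite_measure \<nu>"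
    and "finite_moments \<nu>"
    and "measure_support \<nu> = Q"
    and "carleman \<nu>"
  shows "((\<forall>f\<in>QM s g \<nu>. riesz z f \<ge> 0) \<longleftrightarrow>
           (\<forall>j\<le>s. \<forall>k\<ge>1. \<forall>l\<ge>1. pos_semidef (loc_index k l (g j)) (loc_matrix k l \<nu> (g j) z)))
       \<and> (archimedean (QM s g \<nu>) \<longrightarrow>
           (moment_sequence K z \<longleftrightarrow>
           (\<forall>j\<le>s. \<forall>k\<ge>1. \<forall>l\<ge>1. pos_semidef (loc_index k l (g j)) (loc_matrix k l \<nu> (g j) z))))"
proof -
  have psd: "(\<forall>j\<le>s. \<forall>k\<ge>1. \<forall>l\<ge>1. pos_semidef (loc_index k l (g j)) (loc_matrix k l \<nu> (g j) z)) \<longleftrightarrow>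
      (\<forall>f\<in>QM s g \<nu>. riesz z f \<ge> 0)"
    unfolding riesz_nonneg_on_QM_iff loc_matrix_psd_iff ..
  have "moment_sequence K z \<longleftrightarrow> (\<forall>f\<in>QM s g \<nu>. riesz z f \<ge> 0)" if "archimedean (QM s g \<nu>)"
  proof
    assume "moment_sequence K z"
    then show "\<forall>f\<in>QM s g \<nu>. riesz z f \<ge> 0"
      using assms(2-4,6,7) moment_sequence_imp_nonneg[of s g \<nu> z]
      unfolding riesz_nonneg_on_QM_iff by simp
  next
    assume "\<forall>f\<in>QM s g \<nu>. riesz z f \<ge> 0"
    then show "moment_sequence K z"
      using nonneg_imp_moment_sequence[OF assms(4-6,8,2) that] assms(3,7) by simp
  qed
  with psd show ?thesis by simp
qed

end
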